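(* There is a polynomial time $\frac{\varepsilon^2}{2}$-zCDP algorithm that takes $$n = \tilde{O}\left(\frac{d}{\alpha^2} + \frac{d}{\alpha \varepsilon}\right)$$ samples from an unknown product distribution $\mathcal{P}$ over $\{0,1\}^{d}$ and outputs a product distribution $\mathcal{Q}$ over $\{0,1\}^d$ such that, with high probability, $d_{\mathrm{TV}}(\mathcal{P},\mathcal{Q}) \leq \alpha$. Here $\tilde{O}(\cdot)$ hides polylogarithmic factors of $d, \frac{1}{\alpha},$ and $\frac{1}{\varepsilon}$. The same algorithm satisfies $(\varepsilon \sqrt{\log(1/\delta)},\delta)$-differential privacy for every $\delta > 0$.
   Context: Two datasets are neighboring if they differ in at most one entry. A randomized algorithm $M$ is $(\varepsilon,\delta)$-differentially private if for all neighboring datasets $X,X'$ and all measurable $Y$, $\Pr[M(X)\in Y]\le e^{\varepsilon}\Pr[M(X')\in Y]+\delta$. It is $\rho$-zCDP if for all neighboring $X,X'$ and all $\alpha\in(1,\infty)$, $D_\alpha(M(X)\|M(X'))\le\rho\alpha$, where $D_\alpha$ is the Rényi divergence of order $\alpha$. $d_{\mathrm{TV}}$ is total variation distance. A product distribution over $\{0,1\}^d$ is one whose coordinates are independent Bernoulli random variables. *)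

theory Defs
  imports "HOL-Probability.Probability" "HOL-Computational_Algebra.Polynomial"
begin

section \<open>Differential privacy\<close>

definition neighboring :: "'a list \<Rightarrow> 'a list \<Rightarrow> bool" where
  "neighboring X X' \<longleftrightarrow>
     length X = length X' \<and> card {i. i < length X \<and> X ! i \<noteq> X' ! i} \<le> 1"

text \<open>A randomized algorithm is given by the law of its output on each dataset; \<open>\<X>\<close> is the
  set of rows that may occur in a dataset.\<close>

definition differentially_private ::
    "'a set \<Rightarrow> ('a list \<Rightarrow> 'b measure) \<Rightarrow> real \<Rightarrow> real \<Rightarrow> bool" where
  "differentially_private \<X> M \<epsilon> \<delta> \<longleftrightarrow>
     (\<forall>X\<in>lists \<X>. \<forall>X'\<in>lists \<X>. neighboring X X' \<longrightarrow>
        (\<forall>Y\<in>sets (M X). measure (M X) Y \<le> exp \<epsilon> * measure (M X') Y + \<delta>))"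

text \<open>\<open>D\<^sub>a(P\<parallel>Q) = ln (\<integral> (dP/dQ)\<^sup>a dQ) / (a - 1)\<close> with values in the extended reals; it is
  infinite if \<open>P\<close> is not absolutely continuous with respect to \<open>Q\<close> (the library's
  \<^const>\<open>absolutely_continuous\<close> takes the dominating measure first) or if the integral
  diverges.\<close>

definition renyi_divergence :: "real \<Rightarrow> 'a measure \<Rightarrow> 'a measure \<Rightarrow> ereal" where
  "renyi_divergence a P Q =
     (let I = (\<integral>\<^sup>+x. ennreal (enn2real (RN_deriv Q P x) powr a) \<partial>Q)
      in if absolutely_continuous Q P \<and> I < \<infinity> then ereal (ln (enn2real I) / (a - 1)) else \<infinity>)"

definition zCDP :: "'a set \<Rightarrow> ('a list \<Rightarrow> 'b measure) \<Rightarrow> real \<Rightarrow> bool" where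
  "zCDP \<X> M \<rho> \<longleftrightarrow>
     (\<forall>X\<in>lists \<X>. \<forall>X'\<in>lists \<X>. neighboring X X' \<longrightarrow>
        (\<forall>a>1. renyi_divergence a (M X) (M X') \<le> ereal (\<rho> * a)))"


section \<open>Product distributions over the Boolean cube\<close>

text \<open>The points of \<open>{0,1}\<^sup>d\<close> are the functions \<open>nat \<Rightarrow> bool\<close> that are \<open>False\<close> outside
  \<open>{..<d}\<close>.\<close>

definition cube :: "nat \<Rightarrow> (nat \<Rightarrow> bool) set" where
  "cube d = PiE_dflt {..<d} False (\<lambda>_. UNIV)"

definition product_dist :: "nat \<Rightarrow> (nat \<Rightarrow> real) \<Rightarrow> (nat \<Rightarrow> bool) pmf" where
  "product_dist d p = Pi_pmf {..<d} False (\<lambda>j. bernoulli_pmf (p j))"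

definition product_distributions :: "nat \<Rightarrow> (nat \<Rightarrow> bool) pmf set" where
  "product_distributions d = product_dist d ` ({..<d} \<rightarrow>\<^sub>E {0..1})"

definition tv_dist :: "'a pmf \<Rightarrow> 'a pmf \<Rightarrow> real" where
  "tv_dist P Q = (SUP A. \<bar>measure_pmf.prob P A - measure_pmf.prob Q A\<bar>)"


section \<open>Randomized algorithms over the reals and their running time\<close>

text \<open>Algorithms are programs for a randomized real random access machine: memory cells hold real
  numbers, the field operations and comparisons are exact and have unit cost, and an independent
  standard Gaussian can be drawn at unit cost. Cells are addressed by natural-number variables. These
  have only addition and truncated subtraction, and reals cannot be rounded to naturals, so that
  the unit-cost measure does not hide super-polynomial work. The only constants are
  natural numbers, so that a program is a finite discrete object.\<close>

datatype nexp = NConst nat | NVar string | NAdd nexp nexp | NSub nexp nexp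

text \<open>\<open>Cell A e\<close> is the cell with index \<open>e\<close> of the array \<open>A\<close>.\<close>

datatype rexp = OfNat nexp | Cell string nexp
  | RAdd rexp rexp | RSub rexp rexp | RMul rexp rexp | RDiv rexp rexp

datatype bexp = NLess nexp nexp | RLess rexp rexp | BNot bexp | BAnd bexp bexp

datatype com = Skip
  | NAssign string nexp
  | RAssign string nexp rexp
  | Gauss string nexp
  | Seq com com
  | Cond bexp com com
  | While bexp com

record state =
  nats :: "string \<Rightarrow> nat"
  arrays :: "string \<Rightarrow> nat \<Rightarrow> real"
  tape :: "real stream"

fun nval :: "nexp \<Rightarrow> state \<Rightarrow> nat" where
  "nval (NConst k) s = k"
| "nval (NVar x) s = nats s x"
| "nval (NAdd e e') s = nval e s + nval e' s"
| "nval (NSub e e') s = nval e s - nval e' s"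

fun rval :: "rexp \<Rightarrow> state \<Rightarrow> real" where
  "rval (OfNat e) s = real (nval e s)"
| "rval (Cell A e) s = arrays s A (nval e s)"
| "rval (RAdd e e') s = rval e s + rval e' s"
| "rval (RSub e e') s = rval e s - rval e' s"
| "rval (RMul e e') s = rval e s * rval e' s"
| "rval (RDiv e e') s = rval e s / rval e' s"

fun bval :: "bexp \<Rightarrow> state \<Rightarrow> bool" where
  "bval (NLess e e') s \<longleftrightarrow> nval e s < nval e' s"
| "bval (RLess e e') s \<longleftrightarrow> rval e s < rval e' s"
| "bval (BNot b) s \<longleftrightarrow> \<not> bval b s"
| "bval (BAnd b b') s \<longleftrightarrow> bval b s \<and> bval b' s"

definition store :: "string \<Rightarrow> nat \<Rightarrow> real \<Rightarrow> state \<Rightarrow> state" where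
  "store A i v s = s\<lparr>arrays := (arrays s)(A := (arrays s A)(i := v))\<rparr>"

text \<open>\<open>big_step c s t s'\<close>: started in \<open>s\<close>, the command \<open>c\<close> halts in \<open>s'\<close> after \<open>t\<close> steps. All
  randomness is read from the tape, so execution is deterministic. The expressions occurring in a
  program have a size that does not depend on the input, so their evaluation is included in the
  unit charged for a command or a test.\<close>

inductive big_step :: "com \<Rightarrow> state \<Rightarrow> nat \<Rightarrow> state \<Rightarrow> bool" where
  Skip: "big_step Skip s 1 s"
| NAssign: "big_step (NAssign x e) s 1 (s\<lparr>nats := (nats s)(x := nval e s)\<rparr>)"
| RAssign: "big_step (RAssign A i e) s 1 (store A (nval i s) (rval e s) s)"
| Gauss: "big_step (Gauss A i) s 1 ((store A (nval i s) (shd (tape s)) s)\<lparr>tape := stl (tape s)\<rparr>)"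
| Seq: "big_step c1 s t1 s1 \<Longrightarrow> big_step c2 s1 t2 s2 \<Longrightarrow> big_step (Seq c1 c2) s (t1 + t2) s2"
| CondTrue: "bval b s \<Longrightarrow> big_step c1 s t s' \<Longrightarrow> big_step (Cond b c1 c2) s (t + 1) s'"
| CondFalse: "\<not> bval b s \<Longrightarrow> big_step c2 s t s' \<Longrightarrow> big_step (Cond b c1 c2) s (t + 1) s'"
| WhileFalse: "\<not> bval b s \<Longrightarrow> big_step (While b c) s 1 s"
| WhileTrue: "bval b s \<Longrightarrow> big_step c s t1 s1 \<Longrightarrow> big_step (While b c) s1 t2 s2
    \<Longrightarrow> big_step (While b c) s (t1 + t2 + 1) s2"

text \<open>The input consists of \<open>d\<close>, the number \<open>n\<close> of rows, \<open>\<alpha>\<close>, \<open>\<epsilon>\<close> and the dataset, which is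
  stored row by row in the array \<open>X\<close>. All other cells and variables are initially \<open>0\<close>.\<close>

definition init :: "nat \<Rightarrow> real \<Rightarrow> real \<Rightarrow> (nat \<Rightarrow> bool) list \<Rightarrow> real stream \<Rightarrow> state" where
  "init d \<alpha> \<epsilon> X \<omega> =
     \<lparr>nats = (\<lambda>_. 0)(''d'' := d, ''n'' := length X),
      arrays = (\<lambda>_ _. 0)
        (''alpha'' := (\<lambda>_. 0)(0 := \<alpha>),
         ''eps'' := (\<lambda>_. 0)(0 := \<epsilon>),
         ''X'' := (\<lambda>k. if k < length X * d then of_bool ((X ! (k div d)) (k mod d)) else 0)),
      tape = \<omega>\<rparr>"

definition final :: "com \<Rightarrow> state \<Rightarrow> state" where
  "final c s = (THE s'. \<exists>t. big_step c s t s')"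

text \<open>The output is the vector of the \<open>d\<close> means of a product distribution, read from the array
  \<open>Q\<close>.\<close>

definition result ::
    "com \<Rightarrow> nat \<Rightarrow> real \<Rightarrow> real \<Rightarrow> (nat \<Rightarrow> bool) list \<Rightarrow> real stream \<Rightarrow> nat \<Rightarrow> real" where
  "result c d \<alpha> \<epsilon> X \<omega> = restrict (arrays (final c (init d \<alpha> \<epsilon> X \<omega>)) ''Q'') {..<d}"

definition law :: "com \<Rightarrow> nat \<Rightarrow> real \<Rightarrow> real \<Rightarrow> (nat \<Rightarrow> bool) list \<Rightarrow> (nat \<Rightarrow> real) measure" where
  "law c d \<alpha> \<epsilon> X =
     distr (stream_space (density lborel std_normal_density))
       (\<Pi>\<^sub>M j\<in>{..<d}. borel) (result c d \<alpha> \<epsilon> X)"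

text \<open>Worst-case running time over all inputs and all random tapes, polynomial in the dimension and
  the number of rows.\<close>

definition polynomial_time :: "com \<Rightarrow> bool" where
  "polynomial_time c \<longleftrightarrow>
     (\<exists>p :: nat poly. \<forall>d\<ge>1. \<forall>\<alpha>>0. \<forall>\<epsilon>>0. \<forall>X\<in>lists (cube d). \<forall>\<omega>.
        \<exists>t s'. big_step c (init d \<alpha> \<epsilon> X \<omega>) t s' \<and> t \<le> poly p (d + length X))"

definition outputs_product_distribution :: "com \<Rightarrow> bool" where
  "outputs_product_distribution c \<longleftrightarrow>
     (\<forall>d\<ge>1. \<forall>\<alpha>>0. \<forall>\<epsilon>>0. \<forall>X\<in>lists (cube d). \<forall>\<omega>.
        result c d \<alpha> \<epsilon> X \<omega> \<in> {..<d} \<rightarrow>\<^sub>E {0..1})"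

text \<open>The law of the output when the dataset consists of \<open>n\<close> independent samples from \<open>P\<close>.\<close>

definition law_on_samples ::
    "com \<Rightarrow> nat \<Rightarrow> real \<Rightarrow> real \<Rightarrow> nat \<Rightarrow> (nat \<Rightarrow> bool) pmf \<Rightarrow> (nat \<Rightarrow> real) measure" where
  "law_on_samples c d \<alpha> \<epsilon> n P = measure_pmf (replicate_pmf n P) \<bind> law c d \<alpha> \<epsilon>"


section \<open>Sample complexity\<close>

text \<open>\<open>N = O(f)\<close> up to factors polylogarithmic in \<open>d\<close>, \<open>1/\<alpha>\<close>, \<open>1/\<epsilon>\<close>. The summand \<open>2\<close> keeps
  the logarithm above \<open>1\<close>.\<close>

definition soft_O :: "(nat \<Rightarrow> real \<Rightarrow> real \<Rightarrow> nat) \<Rightarrow> (nat \<Rightarrow> real \<Rightarrow> real \<Rightarrow> real) \<Rightarrow> bool" where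
  "soft_O N f \<longleftrightarrow>
     (\<exists>C k. \<forall>d\<ge>1. \<forall>\<alpha>>0. \<forall>\<epsilon>>0.
        real (N d \<alpha> \<epsilon>) \<le> C * f d \<alpha> \<epsilon> * ln (2 + real d + 1 / \<alpha> + 1 / \<epsilon>) ^ k)"

end

theory Submission
  imports Defs
begin

text \<open>The algorithm estimates the means of \<open>2 * d\<close> columns, the \<open>d\<close> coordinates and their
  complements, so that one of the two estimates of a coordinate concerns a mean at most about \<open>1 / 2\<close>. A
  column is released at stages \<open>r = 0, 1, \<dots>\<close> with Gaussian noise of standard deviation \<open>s / 2 ^ r\<close> on
  its count, until the noisy mean exceeds \<open>1 / (2 * 4 ^ r)\<close> or \<open>4 ^ r\<close> reaches \<open>d\<close>. A row that has
  the bit pays \<open>4 ^ r\<close>, the inverse of the noise variance up to \<open>s\<^sup>2\<close>, and is ignored as soon as its total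
  payment would exceed a budget \<open>B\<close>. This replaces clipping: every row influences the output with total
  divergence at most \<open>B / s\<^sup>2\<close>. A column of mean \<open>\<mu>\<close> is active only while \<open>4 ^ r\<close> is at most
  of order \<open>min (1 / \<mu>) d\<close>, so a random row pays \<open>O(d)\<close> in expectation and with high probability no row
  is ever ignored for a budget \<open>B\<close> of order \<open>d\<close> times a logarithm. The estimate of a column that stops at
  \<open>4 ^ r \<approx> 1 / \<mu>\<close> then has error of order \<open>\<alpha> * sqrt (\<mu> / d)\<close>, which bounds the chi-square
  divergence per coordinate by \<open>O(\<alpha>\<^sup>2 / d)\<close>, and columns of mean below \<open>1 / d\<close> have error
  \<open>O(\<alpha> / d)\<close>.

  Privacy is proved for the dual form of the Renyi divergence, an inequality between the expectation of a
  test function under one law and a norm of it under the other, because it composes adaptively and passes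
  to images of the laws without any density. The noise is scaled by \<open>\<epsilon> / (1 + \<epsilon>)\<close> rather than
  \<open>\<epsilon>\<close>: for large \<open>\<epsilon>\<close> the stated approximate privacy with \<open>\<delta>\<close> close to \<open>1\<close> fails at noise
  proportional to \<open>1 / \<epsilon>\<close>.\<close>

section \<open>Execution of programs\<close>

text \<open>A row can have its bit in many columns at once, so equal noise on all counts needs
  standard deviation of order sqrt d / \<epsilon>. A mean near 1 / d must be known up to \<alpha> /
  d, which would then force n of order d * sqrt d / (\<alpha> \<epsilon>). The stages exploit that a
  random row seldom has the bit of a column of small mean, so that such a column can afford a more
  precise release. Privacy hinges on how a row is charged: only its own bits, its own past payments
  and the values already released matter, so that changing one row leaves the charges of all others
  as they are while the released values agree. The noise level is set by \<open>d\<close>,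
  \<open>n\<close>, \<epsilon> and the confidence exponent \<open>c\<close>; the target \<alpha> is
  met through the size of \<open>n\<close>. As the budget contains a logarithm of \<open>n\<close>
  for a union bound over the rows, the condition on \<open>n\<close> is implicit and has to be
  solved at the end. Stopped columns keep drawing noise, so that every position of the tape belongs
  to a fixed column and stage, whatever the data.\<close>

lemma big_step_det:
  "big_step c s t s1 \<Longrightarrow> big_step c s t' s2 \<Longrightarrow> s1 = s2"
proof (induction arbitrary: t' s2 rule: big_step.induct)
  case (WhileTrue b s c t1 s1 t2 s2 t' s2')
  from WhileTrue.prems WhileTrue.hyps(1) obtain u1 u2 r1 where
    "big_step c s u1 r1" "big_step (While b c) r1 u2 s2'"
    by (cases rule: big_step.cases) auto
  with WhileTrue.IH show ?case by blast
next
  case (Seq c1 s t1 s1 c2 t2 s2 t' s2')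
  from Seq.prems obtain u1 u2 r1 where "big_step c1 s u1 r1" "big_step c2 r1 u2 s2'"
    by (cases rule: big_step.cases) auto
  with Seq.IH show ?case by blast
qed (erule big_step.cases; auto)+

text \<open>Total correctness with a postcondition on running time and final state. The equations
  below compute weakest preconditions, so straight-line code is executed symbolically by rewriting
  and only loops need an invariant.\<close>

definition runs :: "com \<Rightarrow> state \<Rightarrow> (nat \<Rightarrow> state \<Rightarrow> bool) \<Rightarrow> bool" where
  "runs c s \<Phi> \<longleftrightarrow> (\<exists>t s'. big_step c s t s' \<and> \<Phi> t s')"

inductive_cases big_step_elims:
  "big_step Skip s t s'" "big_step (NAssign x e) s t s'" "big_step (RAssign A i e') s t s'"
  "big_step (Gauss A i) s t s'" "big_step (Seq c1 c2) s t s'" "big_step (Cond b c1 c2) s t s'"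

lemma runs_simps [simp]:
  "runs Skip s \<Phi> \<longleftrightarrow> \<Phi> 1 s"
  "runs (NAssign x e) s \<Phi> \<longleftrightarrow> \<Phi> 1 (s\<lparr>nats := (nats s)(x := nval e s)\<rparr>)"
  "runs (RAssign A i e') s \<Phi> \<longleftrightarrow> \<Phi> 1 (store A (nval i s) (rval e' s) s)"
  "runs (Gauss A i) s \<Phi> \<longleftrightarrow>
     \<Phi> 1 ((store A (nval i s) (shd (tape s)) s)\<lparr>tape := stl (tape s)\<rparr>)"
  "runs (Seq c1 c2) s \<Phi> \<longleftrightarrow> runs c1 s (\<lambda>t1 s1. runs c2 s1 (\<lambda>t2 s2. \<Phi> (t1 + t2) s2))"
  unfolding runs_def
  by - (fastforce intro: big_step.intros elim: big_step_elims)+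

lemma runs_Cond [simp]:
  "runs (Cond b c1 c2) s \<Phi> \<longleftrightarrow>
     (if bval b s then runs c1 s (\<lambda>t. \<Phi> (t + 1)) else runs c2 s (\<lambda>t. \<Phi> (t + 1)))"
proof -
  have "big_step (Cond b c1 c2) s t s'
      \<longleftrightarrow> (\<exists>u. t = u + 1 \<and> big_step (if bval b s then c1 else c2) s u s')" for t s'
  proof
    assume "big_step (Cond b c1 c2) s t s'"
    then show "\<exists>u. t = u + 1 \<and> big_step (if bval b s then c1 else c2) s u s'"
      by (rule big_step_elims(6)) auto
  next
    assume "\<exists>u. t = u + 1 \<and> big_step (if bval b s then c1 else c2) s u s'"
    then show "big_step (Cond b c1 c2) s t s'"
      using big_step.CondTrue[of b s c1 _ s' c2] big_step.CondFalse[of b s c2 _ s' c1]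
      by (cases "bval b s") auto
  qed
  then show ?thesis unfolding runs_def by auto
qed

lemma runs_mono: "runs c s \<Phi> \<Longrightarrow> (\<And>t s'. \<Phi> t s' \<Longrightarrow> \<Psi> t s') \<Longrightarrow> runs c s \<Psi>"
  unfolding runs_def by blast

lemma runs_While:
  fixes I :: "nat \<Rightarrow> state \<Rightarrow> bool"
  assumes "I 0 s"
    and step: "\<And>k s. k < K \<Longrightarrow> I k s \<Longrightarrow> bval b s \<and> runs c s (\<lambda>t s'. t \<le> T \<and> I (Suc k) s')"
    and exit: "\<And>t s. I K s \<Longrightarrow> t \<le> K * (T + 1) + 1 \<Longrightarrow> \<not> bval b s \<and> \<Phi> t s"
  shows "runs (While b c) s \<Phi>"
proof -
  have "runs (While b c) s (\<lambda>t s'. t \<le> (K - k) * (T + 1) + 1 \<and> I K s')" if "k \<le> K" "I k s" for k s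
    using that
  proof (induction "K - k" arbitrary: k s)
    case 0
    then have "k = K" by simp
    with exit[of s 1] 0 have "\<not> bval b s" by auto
    with 0 \<open>k = K\<close> show ?case unfolding runs_def using big_step.WhileFalse[of b s c]
      by (intro exI[of _ 1] exI[of _ s]) auto
  next
    case (Suc m)
    then have k: "k < K" by linarith
    from step[OF k] Suc.prems have b: "bval b s" and "runs c s (\<lambda>t s'. t \<le> T \<and> I (Suc k) s')" by auto
    then obtain t1 s1 where 1: "big_step c s t1 s1" "t1 \<le> T" "I (Suc k) s1"
      unfolding runs_def by blast
    have "runs (While b c) s1 (\<lambda>t s'. t \<le> (K - Suc k) * (T + 1) + 1 \<and> I K s')"
      by (rule Suc.hyps(1)) (use Suc.hyps k 1 in auto)
    then obtain t2 s2 where 2: "big_step (While b c) s1 t2 s2"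
      "t2 \<le> (K - Suc k) * (T + 1) + 1" "I K s2"
      unfolding runs_def by blast
    have "K - k = Suc (K - Suc k)" using k by linarith
    then have "t1 + t2 + 1 \<le> (K - k) * (T + 1) + 1" using 1 2 by simp
    with big_step.WhileTrue[OF b 1(1) 2(1)] 2(3) show ?case
      unfolding runs_def by blast
  qed
  from this[of 0 s] assms(1) exit show ?thesis
    by (auto intro: runs_mono)
qed

lemma runs_final:
  assumes "runs c s \<Phi>"
  shows "\<exists>t. \<Phi> t (final c s)"
proof -
  obtain t s' where s': "big_step c s t s'" "\<Phi> t s'" using assms unfolding runs_def by blast
  have "final c s = s'" unfolding final_def
    using s' big_step_det by (intro the_equality) blast+
  with s' show ?thesis by auto
qed

section \<open>Renyi divergence by duality\<close>

text \<open>Young's inequality, integrated after both factors are normalised to norm 1. If a norm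
  vanishes, its factor and hence the product is zero almost everywhere.\<close>

lemma Hoelder_inequality_integral:
  fixes f g :: "'a \<Rightarrow> real"
  assumes pq: "p > 1" "q > 1" "1 / p + 1 / q = 1"
    and [measurable]: "f \<in> borel_measurable M" "g \<in> borel_measurable M"
    and nn: "\<And>x. 0 \<le> f x" "\<And>x. 0 \<le> g x"
    and int: "integrable M (\<lambda>x. f x powr p)" "integrable M (\<lambda>x. g x powr q)"
  shows "integrable M (\<lambda>x. f x * g x)"
    and "(\<integral>x. f x * g x \<partial>M) \<le> (\<integral>x. f x powr p \<partial>M) powr (1 / p) * (\<integral>x. g x powr q \<partial>M) powr (1 / q)"
proof -
  have young: "f x * g x \<le> f x powr p / p + g x powr q / q" for x
    using Youngs_inequality[OF pq nn] .
  show intg: "integrable M (\<lambda>x. f x * g x)"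
    by (rule Bochner_Integration.integrable_bound[where f = "\<lambda>x. f x powr p / p + g x powr q / q"])
      (use int young nn pq in \<open>auto simp: abs_mult intro!: AE_I2\<close>)
  define A where "A = (\<integral>x. f x powr p \<partial>M)"
  define B where "B = (\<integral>x. g x powr q \<partial>M)"
  have AB: "A \<ge> 0" "B \<ge> 0" by (auto simp: A_def B_def)
  have zero: "(\<integral>x. f x * g x \<partial>M) = 0" if "A = 0 \<or> B = 0"
  proof -
    have "AE x in M. f x * g x = 0"
      using that
    proof
      assume "A = 0"
      then have "AE x in M. f x powr p = 0" unfolding A_def
        by (subst (asm) integral_nonneg_eq_0_iff_AE) (use int in auto)
      then show ?thesis by eventually_elim simp
    next
      assume "B = 0"
      then have "AE x in M. g x powr q = 0" unfolding B_def
        by (subst (asm) integral_nonneg_eq_0_iff_AE) (use int in auto)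
      then show ?thesis by eventually_elim simp
    qed
    then show ?thesis by (rule integral_eq_zero_AE)
  qed
  show "(\<integral>x. f x * g x \<partial>M) \<le> (\<integral>x. f x powr p \<partial>M) powr (1 / p) * (\<integral>x. g x powr q \<partial>M) powr (1 / q)"
  proof (cases "A = 0 \<or> B = 0")
    case True
    then show ?thesis using zero by simp
  next
    case False
    with AB have pos: "A > 0" "B > 0" by auto
    define a b where "a = A powr (1 / p)" and "b = B powr (1 / q)"
    have ab: "a > 0" "b > 0" using pos by (auto simp: a_def b_def)
    have apow: "a powr p = A" "b powr q = B" using pq pos by (auto simp: a_def b_def powr_powr)
    have "f x / a * (g x / b) \<le> f x powr p / (A * p) + g x powr q / (B * q)" for x
      using Youngs_inequality[OF pq, of "f x / a" "g x / b"] nn[of x] ab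
      by (simp add: powr_divide apow)
    then have *: "f x * g x \<le> a * b * (f x powr p / (A * p) + g x powr q / (B * q))" for x
      using ab by (simp add: field_simps)
    have "(\<integral>x. f x * g x \<partial>M) \<le> (\<integral>x. a * b * (f x powr p / (A * p) + g x powr q / (B * q)) \<partial>M)"
      by (rule integral_mono) (use int intg * in auto)
    also have "\<dots> = a * b * (A / (A * p) + B / (B * q))"
      using int by (simp add: A_def B_def)
    also have "\<dots> = a * b" using pos pq by simp
    finally show ?thesis by (simp add: a_def b_def A_def B_def)
  qed
qed

section \<open>Exponential moments and mean shifts of the standard Gaussian\<close>

definition std_gauss :: "real measure" where
  "std_gauss = density lborel std_normal_density"

lemma sets_std_gauss [simp, measurable_cong]: "sets std_gauss = sets borel"
  by (simp add: std_gauss_def)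

lemma space_std_gauss [simp]: "space std_gauss = UNIV"
  by (simp add: std_gauss_def)

lemma prob_space_std_gauss: "prob_space std_gauss"
  unfolding std_gauss_def by (rule prob_space_normal_density) simp

lemma integral_std_gauss:
  fixes f :: "real \<Rightarrow> real"
  assumes "f \<in> borel_measurable borel"
  shows "(\<integral>x. f x \<partial>std_gauss) = (\<integral>x. std_normal_density x * f x \<partial>lborel)"
  unfolding std_gauss_def using assms by (subst integral_density) auto

lemma std_normal_density_tilt:
  "std_normal_density x * exp (l * x - l\<^sup>2 / 2) = normal_density l 1 x"
proof -
  have "- x\<^sup>2 / 2 + (l * x - l\<^sup>2 / 2) = - (x - l)\<^sup>2 / 2"
    by (simp add: power2_eq_square field_simps)
  then show ?thesis by (simp add: normal_density_def flip: exp_add)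
qed

lemma
  shows integrable_exp_std_gauss: "integrable std_gauss (\<lambda>x. exp (l * x))"
    and integral_exp_std_gauss: "(\<integral>x. exp (l * x) \<partial>std_gauss) = exp (l\<^sup>2 / 2)"
proof -
  have *: "std_normal_density x * exp (l * x) = exp (l\<^sup>2 / 2) * normal_density l 1 x" for x
  proof -
    have "exp (l * x) = exp (l * x - l\<^sup>2 / 2) * exp (l\<^sup>2 / 2)" by (simp flip: exp_add)
    then show ?thesis by (metis mult.assoc mult.commute std_normal_density_tilt)
  qed
  show "integrable std_gauss (\<lambda>x. exp (l * x))"
    unfolding std_gauss_def by (subst integrable_density) (auto simp: *)
  show "(\<integral>x. exp (l * x) \<partial>std_gauss) = exp (l\<^sup>2 / 2)"
    by (subst integral_std_gauss) (auto simp: *)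
qed

text \<open>A change of variables moves the shift into the density, where it becomes the likelihood
  ratio \<open>G\<close> of two Gaussians. Hoelder separates \<open>F\<close> from \<open>G\<close>,
  and the moment of order \<open>a\<close> of \<open>G\<close> is exp (a (a - 1) D^2 / 2). This is
  the dual form of the fact that the divergence of order \<open>a\<close> is a D^2 / 2.\<close>

lemma std_gauss_shift:
  fixes F :: "real \<Rightarrow> real"
  assumes [measurable]: "F \<in> borel_measurable borel"
    and F: "\<And>x. 0 \<le> F x" "\<And>x. F x \<le> K" and a: "a > 1"
  shows "(\<integral>x. F (x + D) \<partial>std_gauss)
    \<le> exp ((a - 1) * (D\<^sup>2 / 2)) * (\<integral>x. F x powr (a / (a - 1)) \<partial>std_gauss) powr ((a - 1) / a)"
proof -
  interpret prob_space std_gauss by (rule prob_space_std_gauss)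
  define G where "G x = exp (D * x - D\<^sup>2 / 2)" for x :: real
  have [measurable]: "G \<in> borel_measurable borel" unfolding G_def by measurable
  have "(\<integral>x. F (x + D) \<partial>std_gauss) = (\<integral>x. std_normal_density x * F (x + D) \<partial>lborel)"
    by (rule integral_std_gauss) simp
  also have "\<dots> = (\<integral>x. std_normal_density (x - D) * F x \<partial>lborel)"
    by (subst lborel_integral_real_affine[where c = 1 and t = "- D"]) (auto simp: algebra_simps)
  also have "\<dots> = (\<integral>x. std_normal_density x * (F x * G x) \<partial>lborel)"
    using std_normal_density_tilt[of _ D]
    by (intro Bochner_Integration.integral_cong) (auto simp: G_def normal_density_def)
  also have "\<dots> = (\<integral>x. F x * G x \<partial>std_gauss)"
    by (subst integral_std_gauss) auto
  also have "\<dots> \<le> (\<integral>x. F x powr (a / (a - 1)) \<partial>std_gauss) powr (1 / (a / (a - 1)))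
      * (\<integral>x. G x powr a \<partial>std_gauss) powr (1 / a)"
  proof (rule Hoelder_inequality_integral)
    show "1 / (a / (a - 1)) + 1 / a = 1" "a / (a - 1) > 1" using a by (auto simp: field_simps)
    show "integrable std_gauss (\<lambda>x. F x powr (a / (a - 1)))"
      by (rule integrable_const_bound[where B = "K powr (a / (a - 1))"])
        (use a F in \<open>auto intro!: AE_I2 powr_mono2\<close>)
    have "G x powr a = exp (- (a * D\<^sup>2 / 2)) * exp ((a * D) * x)" for x
      by (simp add: G_def powr_def algebra_simps flip: exp_add)
    then show "integrable std_gauss (\<lambda>x. G x powr a)"
      using integrable_exp_std_gauss[of "a * D"] by simp
  qed (use a F in \<open>auto simp: G_def\<close>)
  also have "(\<integral>x. G x powr a \<partial>std_gauss) = exp ((a - 1) * (D\<^sup>2 / 2) * a)"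
  proof -
    have "G x powr a = exp (- (a * D\<^sup>2 / 2)) * exp ((a * D) * x)" for x
      by (simp add: G_def powr_def algebra_simps flip: exp_add)
    then have "(\<integral>x. G x powr a \<partial>std_gauss) = exp (- (a * D\<^sup>2 / 2)) * exp ((a * D)\<^sup>2 / 2)"
      by (simp add: integral_exp_std_gauss)
    also have "\<dots> = exp ((a - 1) * (D\<^sup>2 / 2) * a)"
      by (simp add: algebra_simps power2_eq_square flip: exp_add)
    finally show ?thesis .
  qed
  finally show ?thesis using a by (simp add: powr_def mult.commute)
qed

text \<open>The best constant in such an inequality is the norm of dP/dQ in L^a(Q), which equals exp
  ((a - 1) / a * D) for the divergence D of order \<open>a\<close>. So the condition expresses D
  \<le> \<rho> a. Bounded test functions suffice and keep all integrals finite.\<close>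

definition renyi_dual :: "real \<Rightarrow> real \<Rightarrow> 'a measure \<Rightarrow> 'a measure \<Rightarrow> bool" where
  "renyi_dual a \<rho> P Q \<longleftrightarrow>
     (\<forall>h\<in>borel_measurable Q. \<forall>K::real. (\<forall>x. 0 \<le> h x \<and> h x \<le> K) \<longrightarrow>
        (\<integral>x. h x \<partial>P) \<le> exp ((a - 1) * \<rho>) * (\<integral>x. h x powr (a / (a - 1)) \<partial>Q) powr ((a - 1) / a))"

lemma renyi_dual_measure:
  assumes "prob_space P" "prob_space Q" "sets P = sets Q" "renyi_dual a \<rho> P Q" "a > 1"
    and Y: "Y \<in> sets P"
  shows "measure P Y \<le> exp ((a - 1) * \<rho>) * measure Q Y powr ((a - 1) / a)"
proof -
  have Y': "Y \<in> sets Q" using assms by simp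
  have "\<forall>x. 0 \<le> (indicator Y x :: real) \<and> indicator Y x \<le> (1 :: real)" by (simp add: indicator_def)
  moreover have "(indicator Y :: _ \<Rightarrow> real) \<in> borel_measurable Q" using Y' by simp
  ultimately have "(\<integral>x. indicator Y x \<partial>P)
    \<le> exp ((a - 1) * \<rho>) * (\<integral>x. (indicator Y x :: real) powr (a / (a - 1)) \<partial>Q) powr ((a - 1) / a)"
    using assms(4) unfolding renyi_dual_def by blast
  also have "(\<lambda>x. (indicator Y x :: real) powr (a / (a - 1))) = indicator Y"
    by (auto simp: indicator_def fun_eq_iff)
  finally show ?thesis using Y Y' by (simp add: prob_space.emeasure_le_1[OF assms(1)] prob_space.emeasure_le_1[OF assms(2)])
qed

lemma le_powr_self_imp_le:
  fixes I C a :: real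
  assumes "I \<le> C * I powr ((a - 1) / a)" "I \<ge> 0" "a > 1" "C > 0"
  shows "I \<le> C powr a"
proof (cases "I = 0")
  case False
  then have I: "I > 0" using assms by simp
  have "I powr (1 / a) * I powr ((a - 1) / a) = I"
    using I assms(3) by (simp add: diff_divide_distrib flip: powr_add)
  with assms(1) have "I powr (1 / a) * I powr ((a - 1) / a) \<le> C * I powr ((a - 1) / a)" by simp
  then have "I powr (1 / a) \<le> C" using I by simp
  then have "(I powr (1 / a)) powr a \<le> C powr a"
    using assms(3) by (intro powr_mono2) auto
  then show ?thesis using I assms(3) by (simp add: powr_powr)
qed simp

text \<open>The dual bound is tested on the truncations \<open>min f k powr (a - 1)\<close> of the density \<open>f\<close>,
  for which it becomes \<open>I \<le> C * I powr ((a - 1) / a)\<close> with a finite \<open>I\<close>.\<close>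

lemma renyi_divergence_le_of_dual:
  assumes P: "prob_space P" and Q: "prob_space Q" and sets: "sets P = sets Q"
    and dual: "renyi_dual a \<rho> P Q" and a: "a > 1" and \<rho>: "\<rho> \<ge> 0"
  shows "renyi_divergence a P Q \<le> ereal (\<rho> * a)"
proof -
  interpret P: prob_space P by fact
  interpret Q: prob_space Q by fact
  have ac: "absolutely_continuous Q P"
    unfolding absolutely_continuous_def
  proof
    fix Y assume "Y \<in> null_sets Q"
    then have "Y \<in> sets P" "measure Q Y = 0"
      using sets by (auto simp: measure_def)
    with renyi_dual_measure[OF P Q sets dual a this(1)] have "measure P Y = 0"
      using measure_nonneg[of P Y] by simp
    with \<open>Y \<in> sets P\<close> show "Y \<in> null_sets P"
      by (auto simp: null_sets_def P.emeasure_eq_measure)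
  qed
  define f where "f x = enn2real (RN_deriv Q P x)" for x
  have [measurable]: "f \<in> borel_measurable Q" unfolding f_def by measurable
  have f0: "f x \<ge> 0" for x by (simp add: f_def)
  have "AE x in Q. RN_deriv Q P x \<noteq> \<infinity>"
    by (rule Q.RN_deriv_finite[OF _ ac sets]) (rule P.sigma_finite_measure)
  then have AEf: "AE x in Q. RN_deriv Q P x = ennreal (f x)"
    by eventually_elim (simp add: f_def less_top)
  have Pf: "density Q (\<lambda>x. ennreal (f x)) = P"
  proof -
    have "density Q (\<lambda>x. ennreal (f x)) = density Q (RN_deriv Q P)"
      by (rule density_cong) (use AEf in auto)
    also have "\<dots> = P" by (rule Q.density_RN_deriv[OF ac sets])
    finally show ?thesis .
  qed
  have fint: "integrable Q f"
  proof -
    have "integrable P (\<lambda>_. 1 :: real)" by simp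
    then show ?thesis unfolding Pf[symmetric] by (subst (asm) integrable_density) (auto simp: f0)
  qed
  define C where "C = exp ((a - 1) * \<rho>)"
  have bound: "(\<integral>\<^sup>+x. ennreal (min (f x) (real k) powr a) \<partial>Q) \<le> ennreal (C powr a)" for k
  proof -
    define g where "g x = min (f x) (real k)" for x
    have [measurable]: "g \<in> borel_measurable Q" unfolding g_def by measurable
    have g: "0 \<le> g x" "g x \<le> real k" "g x \<le> f x" for x by (auto simp: g_def f0)
    have gp: "g x powr p \<le> real k powr p" if "p \<ge> 0" for x p using g that by (intro powr_mono2) auto
    have inta: "integrable Q (\<lambda>x. g x powr a)"
      by (rule Q.integrable_const_bound[where B = "real k powr a"]) (use gp a in auto)
    have eq: "g x * g x powr (a - 1) = g x powr a" for x
      using g[of x] a by (cases "g x = 0") (auto simp: powr_mult_base)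
    have "(\<integral>x. g x powr a \<partial>Q) \<le> (\<integral>x. f x * g x powr (a - 1) \<partial>Q)"
    proof (rule integral_mono[OF inta])
      have "\<bar>f x\<bar> * \<bar>g x powr (a - 1)\<bar> \<le> f x * real k powr (a - 1)" for x
        using gp[of "a - 1" x] a f0[of x] by (auto intro!: mult_mono)
      then show "integrable Q (\<lambda>x. f x * g x powr (a - 1))"
        by (intro Bochner_Integration.integrable_bound[OF integrable_mult_left[OF fint, of "real k powr (a - 1)"]])
          (auto simp: abs_mult f0)
      show "g x powr a \<le> f x * g x powr (a - 1)" for x
        unfolding eq[symmetric] using g[of x] by (intro mult_right_mono) auto
    qed
    also have "\<dots> = (\<integral>x. g x powr (a - 1) \<partial>P)"
      unfolding Pf[symmetric] by (subst integral_density) (auto simp: f0)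
    also have "\<dots> \<le> C * (\<integral>x. (g x powr (a - 1)) powr (a / (a - 1)) \<partial>Q) powr ((a - 1) / a)"
      using dual gp[of "a - 1"] a unfolding renyi_dual_def C_def
      by (elim ballE[of _ _ "\<lambda>x. g x powr (a - 1)"] allE[of _ "real k powr (a - 1)"]) auto
    also have "(\<lambda>x. (g x powr (a - 1)) powr (a / (a - 1))) = (\<lambda>x. g x powr a)"
      using a by (auto simp: powr_powr)
    finally have "(\<integral>x. g x powr a \<partial>Q) \<le> C powr a"
      by (rule le_powr_self_imp_le) (use a in \<open>auto simp: C_def\<close>)
    then show ?thesis unfolding g_def[symmetric]
      using inta by (subst nn_integral_eq_integral) (auto intro: ennreal_leI)
  qed
  have "(\<integral>\<^sup>+x. ennreal (f x powr a) \<partial>Q)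
      = (\<integral>\<^sup>+x. liminf (\<lambda>k. ennreal (min (f x) (real k) powr a)) \<partial>Q)"
  proof (rule nn_integral_cong)
    fix x
    have "eventually (\<lambda>k. ennreal (min (f x) (real k) powr a) = ennreal (f x powr a)) sequentially"
      using eventually_ge_at_top[of "nat \<lceil>f x\<rceil>"]
    proof eventually_elim
      case (elim k)
      then have "f x \<le> real k" by linarith
      then show ?case by (simp add: min_def)
    qed
    then have "(\<lambda>k. ennreal (min (f x) (real k) powr a)) \<longlonglongrightarrow> ennreal (f x powr a)"
      by (rule tendsto_eventually)
    then show "ennreal (f x powr a) = liminf (\<lambda>k. ennreal (min (f x) (real k) powr a))"
      by (rule lim_imp_Liminf[symmetric, OF sequentially_bot])
  qed
  \<comment> \<open>Fatou's lemma carries the bound, which is uniform in \<open>k\<close>, from the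
    truncations to \<open>f\<close>.\<close>
  also have "\<dots> \<le> liminf (\<lambda>k. \<integral>\<^sup>+x. ennreal (min (f x) (real k) powr a) \<partial>Q)"
    by (rule nn_integral_liminf) simp
  also have "\<dots> \<le> liminf (\<lambda>k::nat. ennreal (C powr a))"
    by (intro Liminf_mono) (use bound in auto)
  also have "\<dots> = ennreal (C powr a)" by (simp add: Liminf_const)
  finally have I: "(\<integral>\<^sup>+x. ennreal (f x powr a) \<partial>Q) \<le> ennreal (C powr a)" .
  define I where "I = enn2real (\<integral>\<^sup>+x. ennreal (f x powr a) \<partial>Q)"
  have fin: "(\<integral>\<^sup>+x. ennreal (f x powr a) \<partial>Q) < \<infinity>"
    using I by (simp add: le_less_trans)
  have "I \<le> C powr a" unfolding I_def using I by (intro enn2real_leI) auto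
  then have I2: "I \<le> exp (a * (a - 1) * \<rho>)" by (simp add: C_def powr_def mult_ac)
  \<comment> \<open>The case \<open>I = 0\<close> rests on the convention \<open>ln 0 = 0\<close>
    and on \<open>\<rho> \<ge> 0\<close>.\<close>
  have "ln I \<le> a * (a - 1) * \<rho>"
  proof (cases "I = 0")
    case False
    then have "I > 0" by (simp add: I_def less_le)
    with I2 show ?thesis using ln_le_cancel_iff[of I "exp (a * (a - 1) * \<rho>)"] by simp
  qed (use a \<rho> in auto)
  then have "ln I / (a - 1) \<le> \<rho> * a" using a by (simp add: divide_le_eq mult_ac)
  then show ?thesis
    using ac fin unfolding renyi_divergence_def Let_def f_def[symmetric] I_def by simp
qed

text \<open>For \<open>ln (1 / \<delta>) \<ge> 1\<close> the order \<open>a = 1 + 2 * sqrt (ln (1 / \<delta>)) / \<epsilon>\<close> is used; for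
  larger \<open>\<delta>\<close> order \<open>2\<close> together with \<open>c * sqrt q \<le> q + c\<^sup>2 / 4\<close> suffices.\<close>

lemma measure_le_of_renyi_dual:
  assumes P: "prob_space P" and Q: "prob_space Q" and sets: "sets P = sets Q"
    and dual: "\<And>a. a > 1 \<Longrightarrow> renyi_dual a \<rho> P Q"
    and \<epsilon>: "\<epsilon> > 0" and \<rho>: "\<rho> \<le> \<epsilon>\<^sup>2 / 8" "\<rho> \<le> \<epsilon> / 8" "\<rho> \<le> 1 / 25"
    and \<delta>: "\<delta> > 0" and Y: "Y \<in> sets P"
  shows "measure P Y \<le> exp (\<epsilon> * sqrt (ln (1 / \<delta>))) * measure Q Y + \<delta>"
proof -
  interpret P: prob_space P by fact
  interpret Q: prob_space Q by fact
  define L where "L = ln (1 / \<delta>)"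
  have \<delta>L: "\<delta> = exp (- L)" using \<delta> by (simp add: L_def ln_div)
  have Q0: "measure Q Y \<ge> 0" by simp
  consider "\<delta> \<ge> 1" | "\<delta> < 1" "L < 1" | "L \<ge> 1" by linarith
  then show ?thesis
  proof cases
    \<comment> \<open>For \<delta> > 1 the logarithm is negative, and so is its square root by the
      library's convention. The claim holds because the left side is a probability.\<close>
    case 1
    have "measure P Y \<le> 1" by simp
    also have "1 \<le> \<delta>" using 1 .
    also have "\<delta> \<le> exp (\<epsilon> * sqrt (ln (1 / \<delta>))) * measure Q Y + \<delta>" by simp
    finally show ?thesis .
  next
    case 2
    then have L: "L > 0" using \<delta> by (simp add: L_def)
    define q where "q = sqrt (measure Q Y)"
    have q: "q \<ge> 0" "q\<^sup>2 = measure Q Y" by (auto simp: q_def)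
    have "measure P Y \<le> exp \<rho> * q"
      using renyi_dual_measure[OF P Q sets dual[of 2] _ Y] by (simp add: q_def powr_half_sqrt)
    also have "\<dots> \<le> q\<^sup>2 + (exp \<rho>)\<^sup>2 / 4"
      using zero_le_power2[of "q - exp \<rho> / 2"] by (simp add: power2_eq_square algebra_simps)
    \<comment> \<open>Here \<delta> exceeds exp (- 1), which is at least 1 / 3, so \<rho> \<le> 1 /
      25 is small enough.\<close>
    also have "(exp \<rho>)\<^sup>2 / 4 \<le> \<delta>"
    proof -
      have "(exp \<rho>)\<^sup>2 = exp (2 * \<rho>)" by (simp add: power2_eq_square flip: exp_add)
      also have "\<dots> \<le> exp (2 / 25 :: real)" using \<rho> by simp
      also have "\<dots> \<le> 1 + 2 / 25 + (2 / 25)\<^sup>2" by (rule exp_bound) auto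
      also have "\<dots> \<le> 4 / 3 * (1 :: real)" by (simp add: power2_eq_square)
      finally have "(exp \<rho>)\<^sup>2 / 4 \<le> 1 / 3" by simp
      also have "\<dots> \<le> exp (- 1)" using exp_le by (simp add: exp_minus field_simps)
      also have "\<dots> \<le> \<delta>" using 2 by (simp add: \<delta>L)
      finally show ?thesis .
    qed
    also have "q\<^sup>2 \<le> exp (\<epsilon> * sqrt L) * measure Q Y"
    proof -
      have "1 \<le> exp (\<epsilon> * sqrt L)" using \<epsilon> L by simp
      from mult_right_mono[OF this Q0] show ?thesis using q by simp
    qed
    finally show ?thesis unfolding L_def by simp
  next
    case 3
    define \<eta> where "\<eta> = \<epsilon> * sqrt L"
    define a where "a = 1 + 2 * sqrt L / \<epsilon>"
    have L: "L > 0" "sqrt L \<ge> 1" using 3 by auto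
    have a: "a > 1" using L \<epsilon> by (simp add: a_def)
    \<comment> \<open>The order is chosen so that (a - 1) \<eta> = 2 L. The two parts of a \<rho>
      are at most \<eta> / 8, by \<rho> \<le> \<epsilon> / 8, and \<eta> / 4, by
      \<open>\<rho> \<le> \<epsilon>\<^sup>2 / 8\<close>, which leaves 5 / 8 of \<eta>.\<close>
    have key: "(a - 1) * (a * \<rho> - \<eta>) \<le> - L"
    proof -
      have "\<rho> * a = \<rho> + 2 * sqrt L / \<epsilon> * \<rho>" by (simp add: a_def algebra_simps)
      also have "\<dots> \<le> \<epsilon> / 8 * sqrt L + 2 * sqrt L / \<epsilon> * (\<epsilon>\<^sup>2 / 8)"
      proof (intro add_mono mult_left_mono)
        have "\<epsilon> / 8 * 1 \<le> \<epsilon> / 8 * sqrt L" using L \<epsilon> by (intro mult_left_mono) auto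
        then show "\<rho> \<le> \<epsilon> / 8 * sqrt L" using \<rho> by simp
      qed (use \<rho> \<epsilon> L in auto)
      also have "\<dots> = 3 / 8 * \<eta>" using \<epsilon> by (simp add: \<eta>_def power2_eq_square field_simps)
      finally have "a * \<rho> - \<eta> \<le> - 5 / 8 * \<eta>" by (simp add: mult.commute)
      then have "(a - 1) * (a * \<rho> - \<eta>) \<le> (a - 1) * (- 5 / 8 * \<eta>)"
        using a by (intro mult_left_mono) auto
      also have "\<dots> = - 5 / 4 * L" using \<epsilon> L by (simp add: a_def \<eta>_def field_simps)
      also have "\<dots> \<le> - L" using L by simp
      finally show ?thesis .
    qed
    \<comment> \<open>The bound is rewritten as a weighted geometric mean of \<open>x\<close> and
      \<open>z\<close>. Young's inequality then splits it into an additive part, at most \<delta>,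
      and the multiplicative part \<open>z\<close>.\<close>
    define z where "z = exp \<eta> * measure Q Y"
    define t where "t = (a - 1) / a"
    define x where "x = exp ((a - 1) * (a * \<rho> - \<eta>))"
    have tx: "exp ((a - 1) * \<rho>) * measure Q Y powr t = x powr (1 / a) * z powr t"
    proof -
      have "x powr (1 / a) * z powr t
          = (x powr (1 / a) * exp \<eta> powr t) * measure Q Y powr t"
        by (simp add: z_def powr_mult)
      also have "x powr (1 / a) * exp \<eta> powr t = exp ((a - 1) * (a * \<rho> - \<eta>) * (1 / a) + \<eta> * t)"
        by (simp add: x_def powr_def mult.commute flip: exp_add)
      also have "(a - 1) * (a * \<rho> - \<eta>) * (1 / a) + \<eta> * t = (a - 1) * \<rho>"
        using a by (simp add: t_def field_simps)
      finally show ?thesis by simp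
    qed
    have "measure P Y \<le> x powr (1 / a) * z powr t"
      using renyi_dual_measure[OF P Q sets dual[OF a] a Y] unfolding t_def[symmetric] tx .
    also have "\<dots> \<le> x / a + t * z"
    proof (cases "z = 0")
      case True
      then show ?thesis using a by (simp add: x_def)
    next
      case False
      then have "z > 0" using Q0 by (simp add: z_def less_le)
      have "1 / a + t = 1" using a by (simp add: t_def field_simps)
      with Youngs_inequality_0[of "1 / a" t x z] \<open>z > 0\<close> a show ?thesis
        by (simp add: x_def t_def)
    qed
    also have "\<dots> \<le> \<delta> + z"
    proof (rule add_mono)
      have "x / a \<le> x" using a by (simp add: x_def field_simps)
      also have "x \<le> \<delta>" unfolding x_def \<delta>L using key by simp
      finally show "x / a \<le> \<delta>" .
      have "t \<le> 1" "z \<ge> 0" using a Q0 by (auto simp: t_def z_def)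
      then show "t * z \<le> z" using mult_right_mono[of t 1 z] by simp
    qed
    finally show ?thesis by (simp add: z_def \<eta>_def L_def)
  qed
qed

section \<open>The mechanism\<close>

primrec iter :: "(nat \<Rightarrow> 's \<Rightarrow> real \<Rightarrow> 's) \<Rightarrow> nat \<Rightarrow> nat \<Rightarrow> 's \<Rightarrow> real stream \<Rightarrow> 's" where
  "iter f 0 t s \<omega> = s"
| "iter f (Suc k) t s \<omega> = iter f k (Suc t) (f t s (shd \<omega>)) (stl \<omega>)"

text \<open>Peeling off the first step serves the backward induction for privacy; peeling off the
  last one serves the forward invariants of the program and of the accuracy proof.\<close>

lemma iter_Suc_right: "iter f (Suc k) t s \<omega> = f (t + k) (iter f k t s \<omega>) (\<omega> !! k)"
  by (induction k arbitrary: t s \<omega>) auto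

definition hits :: "nat \<Rightarrow> real \<Rightarrow> (nat \<Rightarrow> bool) \<Rightarrow> real \<Rightarrow> bool \<Rightarrow> (nat \<Rightarrow> real) \<Rightarrow> nat set" where
  "hits n B x w active U = {i \<in> {..<n}. active \<and> x i \<and> U i + w \<le> B}"

definition charge :: "nat set \<Rightarrow> real \<Rightarrow> (nat \<Rightarrow> real) \<Rightarrow> nat \<Rightarrow> real" where
  "charge H w U = (\<lambda>i. if i \<in> H then U i + w else U i)"

text \<open>The index \<open>t\<close> enumerates the pairs of column and stage in order. At
  \<open>r = 0\<close> the flag is that of the previous column and is overridden. An inactive column
  hits no row and discards its draw, and each release overwrites the previous one, so that the last
  estimate of a column survives.\<close>

definition stage :: "nat \<Rightarrow> real \<Rightarrow> real \<Rightarrow> nat \<Rightarrow> (nat \<Rightarrow> nat \<Rightarrow> bool) \<Rightarrow> nat \<Rightarrow>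
    bool \<times> (nat \<Rightarrow> real) \<times> (nat \<Rightarrow> real) \<Rightarrow> real \<Rightarrow> bool \<times> (nat \<Rightarrow> real) \<times> (nat \<Rightarrow> real)" where
  "stage n B s R tab t = (\<lambda>(active, U, E) g.
     let col = t div R; r = t mod R;
         active' = (r = 0 \<or> active);
         H = hits n B (tab col) (4 ^ r) active' U;
         y = (real (card H) + s * g / 2 ^ r) / real n
     in (active' \<and> y < 1 / (2 * 4 ^ r), charge H (4 ^ r) U, if active' then E(col := y) else E))"

abbreviation noise_space :: "real stream measure" where
  "noise_space \<equiv> stream_space std_gauss"

lemma prob_space_noise: "prob_space noise_space"
  by (rule prob_space.prob_space_stream_space[OF prob_space_std_gauss])

text \<open>Only the estimates need a sigma-algebra. Given flag and charges before a stage, the new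
  charges do not depend on the draw and the new flag takes two values, so a case distinction on it
  reduces the claim to the induction hypothesis.\<close>

lemma measurable_estimates:
  "(\<lambda>(E, \<omega>). snd (snd (iter (stage n B s R tab) k t (active, U, E) \<omega>)))
     \<in> (\<Pi>\<^sub>M i\<in>UNIV. borel) \<Otimes>\<^sub>M noise_space \<rightarrow>\<^sub>M (\<Pi>\<^sub>M i\<in>UNIV. borel)"
proof (induction k arbitrary: t active U)
  case 0
  show ?case by (simp add: case_prod_beta')
next
  case (Suc k)
  define col r where "col = t div R" and "r = t mod R"
  define a' where "a' = (r = 0 \<or> active)"
  define H where "H = hits n B (tab col) (4 ^ r) a' U"
  define y where "y \<omega> = (real (card H) + s * shd \<omega> / 2 ^ r) / real n" for \<omega>
  define F where "F b = (\<lambda>(E, \<omega>). snd (snd (iter (stage n B s R tab) k (Suc t) (b, charge H (4 ^ r) U, E) \<omega>)))"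
    for b
  define E' where "E' E \<omega> = (if a' then E(col := y \<omega>) else E)" for E \<omega>
  have [measurable]: "F b \<in> (\<Pi>\<^sub>M i\<in>UNIV. borel) \<Otimes>\<^sub>M noise_space \<rightarrow>\<^sub>M (\<Pi>\<^sub>M i\<in>UNIV. borel)" for b
    unfolding F_def by (rule Suc)
  have [measurable]: "y \<in> borel_measurable noise_space" unfolding y_def by measurable
  have [measurable]: "(\<lambda>(E, \<omega>). E' E \<omega>) \<in> (\<Pi>\<^sub>M i\<in>UNIV. borel) \<Otimes>\<^sub>M noise_space \<rightarrow>\<^sub>M (\<Pi>\<^sub>M i\<in>UNIV. borel)"
  proof (cases a')
    case True
    have "(\<lambda>p i. (if i = col then y (snd p) else fst p i))
        \<in> (\<Pi>\<^sub>M i\<in>UNIV. borel) \<Otimes>\<^sub>M noise_space \<rightarrow>\<^sub>M (\<Pi>\<^sub>M i\<in>(UNIV :: nat set). borel)"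
      by (rule measurable_abs_UNIV) simp
    then show ?thesis using True by (simp add: E'_def case_prod_beta' fun_upd_def)
  next
    case False
    then show ?thesis by (simp add: E'_def case_prod_beta')
  qed
  have "(\<lambda>(E, \<omega>). snd (snd (iter (stage n B s R tab) (Suc k) t (active, U, E) \<omega>)))
      = (\<lambda>(E, \<omega>). if a' \<and> y \<omega> < 1 / (2 * 4 ^ r) then F True (E' E \<omega>, stl \<omega>)
           else F False (E' E \<omega>, stl \<omega>))"
    by (auto simp: fun_eq_iff F_def E'_def y_def H_def a'_def col_def r_def stage_def Let_def)
  also have "\<dots> \<in> (\<Pi>\<^sub>M i\<in>UNIV. borel) \<Otimes>\<^sub>M noise_space \<rightarrow>\<^sub>M (\<Pi>\<^sub>M i\<in>UNIV. borel)"
    by measurable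
  finally show ?case .
qed

text \<open>Fubini for the first draw. Nonnegativity and boundedness allow passing through the
  nonnegative integral and back.\<close>

lemma integral_noise_Stream:
  fixes f :: "real stream \<Rightarrow> real"
  assumes [measurable]: "f \<in> borel_measurable noise_space"
    and f: "\<And>\<omega>. 0 \<le> f \<omega>" "\<And>\<omega>. f \<omega> \<le> K"
  shows "(\<integral>\<omega>. f \<omega> \<partial>noise_space) = (\<integral>g. \<integral>\<omega>. f (g ## \<omega>) \<partial>noise_space \<partial>std_gauss)"
proof -
  interpret G: prob_space std_gauss by (rule prob_space_std_gauss)
  interpret S: prob_space noise_space by (rule prob_space_noise)
  have "(\<integral>\<omega>. f \<omega> \<partial>noise_space) = enn2real (\<integral>\<^sup>+\<omega>. ennreal (f \<omega>) \<partial>noise_space)"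
    by (rule integral_eq_nn_integral) (use f in auto)
  also have "(\<integral>\<^sup>+\<omega>. ennreal (f \<omega>) \<partial>noise_space)
      = (\<integral>\<^sup>+g. \<integral>\<^sup>+\<omega>. ennreal (f (g ## \<omega>)) \<partial>noise_space \<partial>std_gauss)"
    by (rule G.nn_integral_stream_space) simp
  also have "\<dots> = (\<integral>\<^sup>+g. ennreal (\<integral>\<omega>. f (g ## \<omega>) \<partial>noise_space) \<partial>std_gauss)"
    by (intro nn_integral_cong nn_integral_eq_integral S.integrable_const_bound[where B = K])
      (use f in auto)
  also have "enn2real \<dots> = (\<integral>g. \<integral>\<omega>. f (g ## \<omega>) \<partial>noise_space \<partial>std_gauss)"
    by (rule integral_eq_nn_integral[symmetric])
      (auto intro!: AE_I2 Bochner_Integration.integral_nonneg f)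
  finally show ?thesis .
qed

lemma card_split_at: "finite H \<Longrightarrow> real (card H) = real (card (H - {i})) + of_bool (i \<in> H)"
proof (cases "i \<in> H")
  case True
  assume "finite H"
  from card_Suc_Diff1[OF this True] have "card H = Suc (card (H - {i}))" by (rule sym)
  with True show ?thesis by (simp del: card_Diff_insert)
qed simp

text \<open>Backward induction on the number of remaining stages: a stage moves the mean of the released
  count by at most one per database whose row \<open>i0\<close> is hit, and a hit pays for the resulting Gaussian
  divergence out of the budget of that row.\<close>

lemma iter_stage_dual:
  fixes h :: "(nat \<Rightarrow> real) \<Rightarrow> real"
  assumes s: "s > 0" and a: "a > 1"
    and [measurable]: "h \<in> borel_measurable (\<Pi>\<^sub>M i\<in>UNIV. borel)"
    and h: "\<And>x. 0 \<le> h x" "\<And>x. h x \<le> K"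
    and agree: "\<And>col i. i < n \<Longrightarrow> i \<noteq> i0 \<Longrightarrow> tab col i = tab' col i"
    and U: "\<And>i. i < n \<Longrightarrow> i \<noteq> i0 \<Longrightarrow> U i = U' i"
  shows "(\<integral>\<omega>. h (snd (snd (iter (stage n B s R tab) k t (active, U, E) \<omega>))) \<partial>noise_space)
    \<le> exp ((a - 1) * ((max 0 (B - U i0) + max 0 (B - U' i0)) / (2 * s\<^sup>2)))
      * (\<integral>\<omega>. h (snd (snd (iter (stage n B s R tab') k t (active, U', E) \<omega>))) powr (a / (a - 1))
          \<partial>noise_space) powr ((a - 1) / a)"
  using U
proof (induction k arbitrary: t active U U' E)
  case 0
  interpret S: prob_space noise_space by (rule prob_space_noise)
  have "0 \<le> (a - 1) * ((max 0 (B - U i0) + max 0 (B - U' i0)) / (2 * s\<^sup>2))"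
    using a s by (intro mult_nonneg_nonneg) auto
  then have "1 * h E \<le> exp ((a - 1) * ((max 0 (B - U i0) + max 0 (B - U' i0)) / (2 * s\<^sup>2))) * h E"
    using h by (intro mult_right_mono) auto
  moreover have "(h E powr (a / (a - 1))) powr ((a - 1) / a) = h E"
    using a h[of E] by (simp add: powr_powr)
  ultimately show ?case by (simp add: S.prob_space)
next
  case (Suc k)
  interpret G: prob_space std_gauss by (rule prob_space_std_gauss)
  interpret S: prob_space noise_space by (rule prob_space_noise)
  define col r where "col = t div R" and "r = t mod R"
  define a' where "a' = (r = 0 \<or> active)"
  define H where "H = hits n B (tab col) (4 ^ r) a' U"
  define H' where "H' = hits n B (tab' col) (4 ^ r) a' U'"
  define \<sigma> where "\<sigma> = s / 2 ^ r"
  define y' where "y' g = (real (card H') + s * g / 2 ^ r) / real n" for g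
  define D where "D = (real (card H) - real (card H')) / \<sigma>"
  define V where "V = charge H (4 ^ r) U"
  define V' where "V' = charge H' (4 ^ r) U'"
  define act where "act g \<longleftrightarrow> a' \<and> y' g < 1 / (2 * 4 ^ r)" for g
  define E' where "E' g = (if a' then E(col := y' g) else E)" for g
  define \<beta> where "\<beta> = a / (a - 1)"
  have \<beta>: "\<beta> > 1" "1 / \<beta> = (a - 1) / a" using a by (auto simp: \<beta>_def)
  have \<sigma>: "\<sigma> > 0" using s by (simp add: \<sigma>_def)
  have fin: "finite H" "finite H'" by (auto simp: H_def H'_def hits_def)
  have Hi: "i \<in> H \<longleftrightarrow> i \<in> H'" if "i \<noteq> i0" for i
    using that agree Suc.prems by (auto simp: H_def H'_def hits_def)
  then have rest: "H - {i0} = H' - {i0}" by auto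
  have diff: "real (card H) - real (card H') = of_bool (i0 \<in> H) - of_bool (i0 \<in> H')"
    using card_split_at[OF fin(1), of i0] card_split_at[OF fin(2), of i0] rest by simp
  \<comment> \<open>Row \<open>i0\<close> may be hit under either, both or none of the databases.
    For bits, (x - y)^2 \<le> x + y, so each database is charged only for its own hit; the variance
    s^2 / 4^r turns this into the price 4^r.\<close>
  have D2: "D\<^sup>2 / 2 \<le> (4 ^ r * of_bool (i0 \<in> H) + 4 ^ r * of_bool (i0 \<in> H')) / (2 * s\<^sup>2)"
  proof -
    have "D\<^sup>2 = (of_bool (i0 \<in> H) - of_bool (i0 \<in> H'))\<^sup>2 * 4 ^ r / s\<^sup>2"
      by (simp add: D_def diff \<sigma>_def power_divide) (simp add: power2_eq_square flip: power_mult_distrib)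
    also have "(of_bool (i0 \<in> H) - of_bool (i0 \<in> H') :: real)\<^sup>2 \<le> of_bool (i0 \<in> H) + of_bool (i0 \<in> H')"
      by auto
    finally show ?thesis using s by (simp add: field_simps)
  qed
  \<comment> \<open>A hit happens only when it is affordable, so it lowers the remaining budget by
    its full price.\<close>
  have budget: "max 0 (B - V i0) + 4 ^ r * of_bool (i0 \<in> H) \<le> max 0 (B - U i0)"
    "max 0 (B - V' i0) + 4 ^ r * of_bool (i0 \<in> H') \<le> max 0 (B - U' i0)"
    by (auto simp: V_def V'_def charge_def H_def H'_def hits_def)
  define b where "b = (max 0 (B - V i0) + max 0 (B - V' i0)) / (2 * s\<^sup>2)"
  have bD: "b + D\<^sup>2 / 2 \<le> (max 0 (B - U i0) + max 0 (B - U' i0)) / (2 * s\<^sup>2)"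
  proof -
    have "b + D\<^sup>2 / 2 \<le> (max 0 (B - V i0) + max 0 (B - V' i0)
        + (4 ^ r * of_bool (i0 \<in> H) + 4 ^ r * of_bool (i0 \<in> H'))) / (2 * s\<^sup>2)"
      unfolding b_def add_divide_distrib[of _ "4 ^ r * of_bool (i0 \<in> H) + 4 ^ r * of_bool (i0 \<in> H')"]
      using D2 by simp
    also have "\<dots> \<le> (max 0 (B - U i0) + max 0 (B - U' i0)) / (2 * s\<^sup>2)"
      using budget by (intro divide_right_mono) auto
    finally show ?thesis .
  qed
  define J where "J g \<omega> = h (snd (snd (iter (stage n B s R tab) k (Suc t) (act g, V, E' g) \<omega>)))" for g \<omega>
  define J' where "J' g \<omega> = h (snd (snd (iter (stage n B s R tab') k (Suc t) (act g, V', E' g) \<omega>)))" for g \<omega>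
  \<comment> \<open>Coupling: a draw \<open>g\<close> for the first database releases what the draw
    \<open>g + D\<close> releases for the second, so the flags and estimates that follow
    coincide.\<close>
  have step: "stage n B s R tab t (active, U, E) g = (act (g + D), V, E' (g + D))" for g
  proof -
    have "real (card H) + s * g / 2 ^ r = real (card H') + s * (g + D) / 2 ^ r"
      using \<sigma> s by (simp add: D_def \<sigma>_def field_simps)
    then show ?thesis
      unfolding stage_def Let_def prod.case col_def[symmetric] r_def[symmetric] a'_def[symmetric]
        H_def[symmetric] V_def[symmetric]
      by (simp add: act_def E'_def y'_def)
  qed
  have step': "stage n B s R tab' t (active, U', E) g = (act g, V', E' g)" for g
    unfolding stage_def Let_def prod.case col_def[symmetric] r_def[symmetric] a'_def[symmetric]
        H'_def[symmetric] V'_def[symmetric]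
    by (simp add: act_def E'_def y'_def)
  have [measurable]: "y' \<in> borel_measurable borel" unfolding y'_def by measurable
  have [measurable]: "E' \<in> borel \<rightarrow>\<^sub>M (\<Pi>\<^sub>M i\<in>UNIV. borel)"
  proof -
    have "(\<lambda>g i. if a' then (if i = col then y' g else E i) else E i) \<in> borel \<rightarrow>\<^sub>M (\<Pi>\<^sub>M i\<in>UNIV. borel)"
      by (rule measurable_abs_UNIV) simp
    also have "(\<lambda>g i. if a' then (if i = col then y' g else E i) else E i) = E'"
      by (auto simp: E'_def fun_eq_iff)
    finally show ?thesis .
  qed
  have meas: "(\<lambda>(g, \<omega>). h (snd (snd (iter (stage n B s R tab'') k (Suc t) (act g, V'', E' g) \<omega>))))
      \<in> borel_measurable (borel \<Otimes>\<^sub>M noise_space)" for tab'' V''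
  proof -
    define F where "F c = (\<lambda>(E, \<omega>). snd (snd (iter (stage n B s R tab'') k (Suc t) (c, V'', E) \<omega>)))" for c
    have [measurable]: "F c \<in> (\<Pi>\<^sub>M i\<in>UNIV. borel) \<Otimes>\<^sub>M noise_space \<rightarrow>\<^sub>M (\<Pi>\<^sub>M i\<in>UNIV. borel)" for c
      unfolding F_def by (rule measurable_estimates)
    have "(\<lambda>(g, \<omega>). h (snd (snd (iter (stage n B s R tab'') k (Suc t) (act g, V'', E' g) \<omega>))))
      = (\<lambda>(g, \<omega>). if a' \<and> y' g < 1 / (2 * 4 ^ r) then h (F True (E' g, \<omega>)) else h (F False (E' g, \<omega>)))"
      by (auto simp: fun_eq_iff F_def act_def)
    also have "\<dots> \<in> borel_measurable (borel \<Otimes>\<^sub>M noise_space)" by measurable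
    finally show ?thesis .
  qed
  have [measurable]: "(\<lambda>(g, \<omega>). J g \<omega>) \<in> borel_measurable (borel \<Otimes>\<^sub>M noise_space)"
    "(\<lambda>(g, \<omega>). J' g \<omega>) \<in> borel_measurable (borel \<Otimes>\<^sub>M noise_space)"
    unfolding J_def J'_def by (rule meas)+
  have J: "0 \<le> J g \<omega>" "J g \<omega> \<le> K" "0 \<le> J' g \<omega>" "J' g \<omega> \<le> K" for g \<omega>
    by (auto simp: J_def J'_def h)
  have J'\<beta>: "J' g \<omega> powr \<beta> \<le> K powr \<beta>" for g \<omega>
    using J[of g \<omega>] \<beta> by (intro powr_mono2) auto
  \<comment> \<open>The conditional norm of the test function given the next draw. Its power a / (a
    - 1) integrates to that of the joint norm, so the bound for the remaining stages and the
    Gaussian bound multiply.\<close>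
  define F where "F g = (\<integral>\<omega>. J' g \<omega> powr \<beta> \<partial>noise_space) powr (1 / \<beta>)" for g
  have [measurable]: "F \<in> borel_measurable borel" unfolding F_def by measurable
  have F: "0 \<le> F g" "F g \<le> (K powr \<beta>) powr (1 / \<beta>)" for g
  proof -
    have "(\<integral>\<omega>. J' g \<omega> powr \<beta> \<partial>noise_space) \<le> K powr \<beta>"
      using J'\<beta> by (intro S.integral_le_const S.integrable_const_bound[where B = "K powr \<beta>"]) auto
    then show "F g \<le> (K powr \<beta>) powr (1 / \<beta>)" unfolding F_def using \<beta> a by (intro powr_mono2) auto
  qed (auto simp: F_def)
  have VV: "V i = V' i" if "i < n" "i \<noteq> i0" for i
    using that Hi Suc.prems by (auto simp: V_def V'_def charge_def)
  have IH: "(\<integral>\<omega>. J g \<omega> \<partial>noise_space) \<le> exp ((a - 1) * b) * F g" for g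
    unfolding J_def J'_def F_def b_def \<beta>(2) unfolding \<beta>_def by (rule Suc.IH) (rule VV)
  have est: "(\<lambda>\<omega>. snd (snd (iter (stage n B s R tab'') (Suc k) t (active, U'', E) \<omega>)))
     \<in> noise_space \<rightarrow>\<^sub>M (\<Pi>\<^sub>M i\<in>UNIV. borel)" for tab'' U''
    using measurable_compose[OF measurable_Pair1' measurable_estimates[of n B s R tab'' "Suc k" t active U''], of E]
    by (simp add: space_PiM del: iter.simps)
  have m1: "(\<lambda>\<omega>. h (snd (snd (iter (stage n B s R tab) (Suc k) t (active, U, E) \<omega>))))
     \<in> borel_measurable noise_space"
    by (rule measurable_compose[OF est]) simp
  have m2: "(\<lambda>\<omega>. h (snd (snd (iter (stage n B s R tab') (Suc k) t (active, U', E) \<omega>))) powr \<beta>)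
     \<in> borel_measurable noise_space"
  proof -
    note [measurable] = measurable_compose[OF est, of h borel tab' U']
    show ?thesis by measurable
  qed
  have "(\<integral>\<omega>. h (snd (snd (iter (stage n B s R tab) (Suc k) t (active, U, E) \<omega>))) \<partial>noise_space)
      = (\<integral>g. \<integral>\<omega>. J (g + D) \<omega> \<partial>noise_space \<partial>std_gauss)"
    by (subst integral_noise_Stream[OF m1, where K = K]) (simp_all add: h step J_def[abs_def])
  also have "\<dots> \<le> (\<integral>g. exp ((a - 1) * b) * F (g + D) \<partial>std_gauss)"
  proof (rule integral_mono)
    have "\<bar>\<integral>\<omega>. J g \<omega> \<partial>noise_space\<bar> \<le> K" for g
    proof -
      have "(\<integral>\<omega>. J g \<omega> \<partial>noise_space) \<le> K"
        using J by (intro S.integral_le_const S.integrable_const_bound[where B = K]) auto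
      moreover have "(\<integral>\<omega>. J g \<omega> \<partial>noise_space) \<ge> 0" using J by (intro Bochner_Integration.integral_nonneg) auto
      ultimately show ?thesis by simp
    qed
    then show "integrable std_gauss (\<lambda>g. \<integral>\<omega>. J (g + D) \<omega> \<partial>noise_space)"
      by (intro G.integrable_const_bound[where B = K]) auto
    show "integrable std_gauss (\<lambda>g. exp ((a - 1) * b) * F (g + D))"
      using F by (intro integrable_mult_right G.integrable_const_bound[where B = "(K powr \<beta>) powr (1 / \<beta>)"]) auto
  qed (rule IH)
  also have "\<dots> = exp ((a - 1) * b) * (\<integral>g. F (g + D) \<partial>std_gauss)" by simp
  also have "\<dots> \<le> exp ((a - 1) * b) * (exp ((a - 1) * (D\<^sup>2 / 2))
      * (\<integral>g. F g powr (a / (a - 1)) \<partial>std_gauss) powr ((a - 1) / a))"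
    using F a by (intro mult_left_mono std_gauss_shift) auto
  also have "(\<integral>g. F g powr (a / (a - 1)) \<partial>std_gauss)
      = (\<integral>g. \<integral>\<omega>. J' g \<omega> powr \<beta> \<partial>noise_space \<partial>std_gauss)"
  proof (intro Bochner_Integration.integral_cong refl)
    fix g
    have "1 / \<beta> * \<beta> = 1" using \<beta>(1) by simp
    then show "F g powr (a / (a - 1)) = (\<integral>\<omega>. J' g \<omega> powr \<beta> \<partial>noise_space)"
      unfolding \<beta>_def[symmetric] F_def powr_powr by simp
  qed
  also have "\<dots> = (\<integral>\<omega>. h (snd (snd (iter (stage n B s R tab') (Suc k) t (active, U', E) \<omega>))) powr \<beta> \<partial>noise_space)"
  proof (subst integral_noise_Stream[OF m2, where K = "K powr \<beta>"])
    show "h (snd (snd (iter (stage n B s R tab') (Suc k) t (active, U', E) \<omega>))) powr \<beta> \<le> K powr \<beta>" for \<omega>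
      using h \<beta> by (intro powr_mono2) auto
  qed (simp_all add: step' J'_def[abs_def])
  also have "exp ((a - 1) * b) * (exp ((a - 1) * (D\<^sup>2 / 2)) * z)
      \<le> exp ((a - 1) * ((max 0 (B - U i0) + max 0 (B - U' i0)) / (2 * s\<^sup>2))) * z" if "z \<ge> 0" for z
  proof -
    have "(a - 1) * b + (a - 1) * (D\<^sup>2 / 2) \<le> (a - 1) * ((max 0 (B - U i0) + max 0 (B - U' i0)) / (2 * s\<^sup>2))"
      using mult_left_mono[OF bD, of "a - 1"] a by (simp add: distrib_left)
    then have "exp ((a - 1) * b) * exp ((a - 1) * (D\<^sup>2 / 2))
        \<le> exp ((a - 1) * ((max 0 (B - U i0) + max 0 (B - U' i0)) / (2 * s\<^sup>2)))"
      by (simp flip: exp_add)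
    from mult_right_mono[OF this that] show ?thesis by (simp add: mult.assoc)
  qed
  finally show ?case by (simp add: \<beta>_def)
qed

section \<open>The program\<close>

text \<open>The rounded-up binary logarithm. It is given as a least number, like the next two
  functions, because the machine cannot round and has to find it by a search.\<close>

definition lg :: "nat \<Rightarrow> nat" where "lg m = (LEAST k. m \<le> 2 ^ k)"

text \<open>The rounded-up square root of the row budget: the budget itself is
  \<open>side * side\<close>, so that the noise scale, proportional to its root, needs no square
  root. With B \<ge> d (36 + 6 (c + 1) lg), the exponent 4 - 3 B / (16 d) in the tail bound for a
  row is at most - 2 - (c + 1) lg.\<close>

definition side :: "nat \<Rightarrow> nat \<Rightarrow> nat \<Rightarrow> nat" where
  "side c d n = (LEAST b. d * (36 + 6 * (c + 1) * lg (n + d + 1)) \<le> b * b)"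

text \<open>Chosen so that the last stage \<open>r = stages d - 1\<close> satisfies d \<le> 4^r,
  while every stage satisfies 4^r < 4 d.\<close>

definition stages :: "nat \<Rightarrow> nat" where "stages d = (LEAST R. 4 * d \<le> 4 ^ R)"

lemma lg_upper: "m \<le> 2 ^ lg m"
  unfolding lg_def by (rule LeastI[of _ m]) (simp add: less_imp_le)

lemma lg_lower: "k < lg m \<Longrightarrow> 2 ^ k < m"
  unfolding lg_def using not_less_Least[of k "\<lambda>k. m \<le> 2 ^ k"] by simp

lemma lg_le: "lg m \<le> m"
  unfolding lg_def by (rule Least_le) (simp add: less_imp_le)

lemma side_upper: "d * (36 + 6 * (c + 1) * lg (n + d + 1)) \<le> side c d n * side c d n"
  unfolding side_def by (rule LeastI) (rule le_square)

lemma side_lower: "b < side c d n \<Longrightarrow> b * b < d * (36 + 6 * (c + 1) * lg (n + d + 1))"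
  unfolding side_def
  using not_less_Least[of b "\<lambda>b. d * (36 + 6 * (c + 1) * lg (n + d + 1)) \<le> b * b"] by simp

lemma side_le: "side c d n \<le> d * (36 + 6 * (c + 1) * lg (n + d + 1))"
  unfolding side_def by (rule Least_le) (rule le_square)

lemma stages_upper: "4 * d \<le> 4 ^ stages d"
proof -
  have "d < 4 ^ d" by (induction d) auto
  then have "4 * d \<le> 4 ^ Suc d" by simp
  then show ?thesis unfolding stages_def by (rule LeastI)
qed

lemma stages_lower: "r < stages d \<Longrightarrow> 4 ^ r < 4 * d"
  unfolding stages_def using not_less_Least[of r "\<lambda>R. 4 * d \<le> 4 ^ R"] by simp

lemma stages_pos: "d \<ge> 1 \<Longrightarrow> stages d > 0"
  using stages_upper[of d] by (cases "stages d") auto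

lemma stages_le: "d \<ge> 1 \<Longrightarrow> stages d \<le> d"
proof -
  assume "d \<ge> 1"
  then have "d \<le> 4 ^ (d - 1)"
  proof (induction d rule: nat_induct_at_least)
    case (Suc d)
    then show ?case by (cases d) auto
  qed simp
  with \<open>d \<ge> 1\<close> have "4 * d \<le> 4 ^ d" by (cases d) auto
  then show ?thesis unfolding stages_def by (rule Least_le)
qed

definition log_prog :: com where
  "log_prog = Seq (NAssign ''w'' (NConst 1))
     (While (NLess (NVar ''w'') (NAdd (NAdd (NVar ''n'') (NVar ''d'')) (NConst 1)))
       (Seq (NAssign ''w'' (NAdd (NVar ''w'') (NVar ''w'')))
         (NAssign ''lg'' (NAdd (NVar ''lg'') (NConst 1)))))"

text \<open>The products are formed in real arithmetic, since natural-number expressions only add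
  and subtract. The exponent \<open>c\<close> is compiled into the program as a constant.\<close>

definition side_prog :: "nat \<Rightarrow> com" where
  "side_prog c = While
     (RLess (RMul (OfNat (NVar ''b'')) (OfNat (NVar ''b'')))
       (RMul (OfNat (NVar ''d''))
         (RAdd (OfNat (NConst 36)) (RMul (OfNat (NConst (6 * (c + 1)))) (OfNat (NVar ''lg''))))))
     (NAssign ''b'' (NAdd (NVar ''b'') (NConst 1)))"

definition cost_exp :: rexp where
  "cost_exp = RMul (OfNat (NVar ''m'')) (OfNat (NVar ''m''))"

text \<open>The variable \<open>p\<close> walks down the current column in the array \<open>X\<close>, \<open>f\<close> is \<open>1\<close> in the complemented
  columns, whose bits are flipped, and \<open>a\<close> is \<open>1\<close> while the column is active. The cost \<open>4 ^ r\<close> of a hit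
  is the square of \<open>m = 2 ^ r\<close>.\<close>

definition row_prog :: com where
  "row_prog = While (NLess (NVar ''i'') (NVar ''n''))
     (Seq
       (Cond
         (BAnd (NLess (NConst 0) (NVar ''a''))
           (BAnd (RLess (OfNat (NConst 0))
               (RMul (RSub (Cell ''X'' (NVar ''p'')) (OfNat (NVar ''f'')))
                 (RSub (Cell ''X'' (NVar ''p'')) (OfNat (NVar ''f'')))))
             (BNot (RLess (RMul (OfNat (NVar ''b'')) (OfNat (NVar ''b'')))
               (RAdd (Cell ''U'' (NVar ''i'')) cost_exp)))))
         (Seq (NAssign ''cnt'' (NAdd (NVar ''cnt'') (NConst 1)))
           (RAssign ''U'' (NVar ''i'') (RAdd (Cell ''U'' (NVar ''i'')) cost_exp)))
         Skip)
       (Seq (NAssign ''i'' (NAdd (NVar ''i'') (NConst 1)))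
         (NAssign ''p'' (NAdd (NVar ''p'') (NVar ''d'')))))"

definition noise_exp :: rexp where
  "noise_exp = RDiv (RMul (RMul (OfNat (NConst 5)) (OfNat (NVar ''b'')))
     (RAdd (OfNat (NConst 1)) (Cell ''eps'' (NConst 0)))) (Cell ''eps'' (NConst 0))"

definition release_prog :: com where
  "release_prog =
     Seq (Gauss ''g'' (NConst 0))
     (Seq (RAssign ''y'' (NConst 0)
       (RDiv (RAdd (OfNat (NVar ''cnt''))
           (RDiv (RMul noise_exp (Cell ''g'' (NConst 0))) (OfNat (NVar ''m''))))
         (OfNat (NVar ''n''))))
     (Seq (Cond (NLess (NConst 0) (NVar ''a''))
       (Seq (RAssign ''E'' (NVar ''k'') (Cell ''y'' (NConst 0)))
         (Cond (RLess (Cell ''y'' (NConst 0))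
             (RDiv (OfNat (NConst 1)) (RMul (OfNat (NConst 2)) cost_exp)))
           Skip (NAssign ''a'' (NConst 0))))
       Skip)
     (NAssign ''m'' (NAdd (NVar ''m'') (NVar ''m'')))))"

definition stage_prog :: com where
  "stage_prog =
     Seq (NAssign ''i'' (NConst 0)) (Seq (NAssign ''p'' (NVar ''pp'')) (Seq (NAssign ''cnt'' (NConst 0))
     (Seq row_prog release_prog)))"

definition stage_loop :: com where
  "stage_loop = While (RLess cost_exp (RMul (OfNat (NConst 4)) (OfNat (NVar ''d'')))) stage_prog"

definition column_prog :: com where
  "column_prog =
     Seq (Cond (NLess (NVar ''k'') (NVar ''d''))
       (Seq (NAssign ''pp'' (NVar ''k'')) (NAssign ''f'' (NConst 0)))
       (Seq (NAssign ''pp'' (NSub (NVar ''k'') (NVar ''d''))) (NAssign ''f'' (NConst 1))))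
     (Seq (NAssign ''a'' (NConst 1)) (Seq (NAssign ''m'' (NConst 1))
     (Seq stage_loop (NAssign ''k'' (NAdd (NVar ''k'') (NConst 1))))))"

definition output_prog :: com where
  "output_prog = While (NLess (NVar ''j'') (NVar ''d''))
     (Seq (Cond (RLess (Cell ''E'' (NVar ''j'')) (RDiv (OfNat (NConst 1)) (OfNat (NConst 2))))
       (RAssign ''Q'' (NVar ''j'') (Cell ''E'' (NVar ''j'')))
       (RAssign ''Q'' (NVar ''j'')
         (RSub (OfNat (NConst 1)) (Cell ''E'' (NAdd (NVar ''j'') (NVar ''d''))))))
     (Seq (Cond (RLess (Cell ''Q'' (NVar ''j'')) (OfNat (NConst 0)))
       (RAssign ''Q'' (NVar ''j'') (OfNat (NConst 0))) Skip)
     (Seq (Cond (RLess (OfNat (NConst 1)) (Cell ''Q'' (NVar ''j'')))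
       (RAssign ''Q'' (NVar ''j'') (OfNat (NConst 1))) Skip)
     (NAssign ''j'' (NAdd (NVar ''j'') (NConst 1))))))"

definition estimator :: "nat \<Rightarrow> com" where
  "estimator c = Seq log_prog (Seq (side_prog c)
     (Seq (While (NLess (NVar ''k'') (NAdd (NVar ''d'') (NVar ''d''))) column_prog) output_prog))"

definition table :: "nat \<Rightarrow> (nat \<Rightarrow> bool) list \<Rightarrow> nat \<Rightarrow> nat \<Rightarrow> bool" where
  "table d X col i = (if col < d then (X ! i) col else \<not> (X ! i) (col - d))"

text \<open>With budget \<open>side\<close> squared, the factor 5 yields the divergence parameter
  \<rho> = (\<epsilon> / (1 + \<epsilon>))^2 / 25, which meets all three upper bounds on \<rho> in
  \<open>measure_le_of_renyi_dual\<close>.\<close>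

definition noise_scale :: "nat \<Rightarrow> nat \<Rightarrow> real \<Rightarrow> nat \<Rightarrow> real" where
  "noise_scale c d \<epsilon> n = 5 * real (side c d n) * (1 + \<epsilon>) / \<epsilon>"

definition clip01 :: "real \<Rightarrow> real" where
  "clip01 q = max 0 (min 1 q)"

definition readout :: "nat \<Rightarrow> (nat \<Rightarrow> real) \<Rightarrow> nat \<Rightarrow> real" where
  "readout d E = (\<lambda>j\<in>{..<d}. clip01 (if E j < 1 / 2 then E j else 1 - E (j + d)))"

definition mechanism :: "nat \<Rightarrow> nat \<Rightarrow> real \<Rightarrow> (nat \<Rightarrow> bool) list \<Rightarrow> nat \<Rightarrow> real stream
    \<Rightarrow> bool \<times> (nat \<Rightarrow> real) \<times> (nat \<Rightarrow> real)" where
  "mechanism c d \<epsilon> X t = iter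
     (stage (length X) ((real (side c d (length X)))\<^sup>2) (noise_scale c d \<epsilon> (length X)) (stages d) (table d X))
     t 0 (True, \<lambda>_. 0, \<lambda>_. 0)"

definition dataset_array :: "nat \<Rightarrow> (nat \<Rightarrow> bool) list \<Rightarrow> nat \<Rightarrow> real" where
  "dataset_array d X = (\<lambda>k. if k < length X * d then of_bool ((X ! (k div d)) (k mod d)) else 0)"

definition inputs :: "nat \<Rightarrow> real \<Rightarrow> (nat \<Rightarrow> bool) list \<Rightarrow> nat \<Rightarrow> state \<Rightarrow> bool" where
  "inputs d \<epsilon> X b s \<longleftrightarrow> nats s ''d'' = d \<and> nats s ''n'' = length X \<and> nats s ''b'' = b \<and>
     arrays s ''eps'' 0 = \<epsilon> \<and> arrays s ''X'' = dataset_array d X"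

section \<open>Simulation of the mechanism by the program\<close>

lemma row_prog:
  assumes inp: "inputs d \<epsilon> X b s" and d: "d > 0" and k: "k < 2 * d"
    and s: "nats s ''i'' = 0" "nats s ''cnt'' = 0" "nats s ''p'' = (if k < d then k else k - d)"
      "nats s ''f'' = of_bool (\<not> k < d)" "nats s ''a'' = of_bool a" "nats s ''m'' = 2 ^ r"
  defines "H \<equiv> hits (length X) ((real b)\<^sup>2) (table d X k) (4 ^ r) a (arrays s ''U'')"
  shows "runs row_prog s (\<lambda>t s'. t \<le> 6 * length X + 1 \<and>
    (\<exists>p. s' = s\<lparr>nats := (nats s)(''i'' := length X, ''p'' := p, ''cnt'' := card H),
      arrays := (arrays s)(''U'' := charge H (4 ^ r) (arrays s ''U''))\<rparr>))"
proof -
  define pp where "pp = (if k < d then k else k - d)"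
  have pp: "pp < d" using k by (auto simp: pp_def)
  \<comment> \<open>\<open>H\<close> is determined by the charges before the pass. This is
    consistent with charging row by row, because row \<open>i\<close> changes only its own
    charge.\<close>
  define st where "st i = s\<lparr>nats := (nats s)(''i'' := i, ''p'' := pp + i * d, ''cnt'' := card (H \<inter> {..<i})),
      arrays := (arrays s)(''U'' := charge (H \<inter> {..<i}) (4 ^ r) (arrays s ''U''))\<rparr>" for i
  have HX: "H \<inter> {..<length X} = H" by (auto simp: H_def hits_def)
  have four: "(2 ^ r * 2 ^ r :: real) = 4 ^ r" by (simp flip: power_mult_distrib)
  show ?thesis unfolding row_prog_def
  proof (rule runs_While[where K = "length X" and T = 5 and I = "\<lambda>i s'. s' = st i"])
    show "s = st 0"
      using s by (auto simp: st_def pp_def charge_def fun_eq_iff intro!: state.equality)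
  next
    fix i s' assume i: "i < length X" and s': "s' = st i"
    have Xi: "dataset_array d X (pp + i * d) = of_bool ((X ! i) pp)"
    proof -
      have "pp + i * d < length X * d"
      proof -
        have "pp + i * d < Suc i * d" using pp by simp
        also have "\<dots> \<le> length X * d" using i by (intro mult_right_mono) auto
        finally show ?thesis .
      qed
      then show ?thesis using pp by (simp add: dataset_array_def)
    qed
    define b1 where "b1 \<longleftrightarrow> i \<in> H"
    \<comment> \<open>The square of the difference of bit and \<open>f\<close> is positive exactly
      when they differ, which is the table entry of the original or the complemented column.\<close>
    have test: "bval
         (BAnd (NLess (NConst 0) (NVar ''a''))
           (BAnd (RLess (OfNat (NConst 0))
               (RMul (RSub (Cell ''X'' (NVar ''p'')) (OfNat (NVar ''f'')))
                 (RSub (Cell ''X'' (NVar ''p'')) (OfNat (NVar ''f'')))))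
             (BNot (RLess (RMul (OfNat (NVar ''b'')) (OfNat (NVar ''b'')))
               (RAdd (Cell ''U'' (NVar ''i'')) cost_exp))))) s' \<longleftrightarrow> i \<in> H"
      using i inp s Xi unfolding s' st_def cost_exp_def inputs_def H_def hits_def table_def charge_def
      by (auto simp: four pp_def power2_eq_square)
    have step: "H \<inter> {..<Suc i} = (if i \<in> H then insert i (H \<inter> {..<i}) else H \<inter> {..<i})"
      by (auto simp: less_Suc_eq)
    have "bval (NLess (NVar ''i'') (NVar ''n'')) s'"
      using inp i by (simp add: s' st_def inputs_def)
    moreover have "s'\<lparr>arrays := (arrays s')(''U'' := (arrays s' ''U'')(i := arrays s' ''U'' i + 2 ^ r * 2 ^ r)),
          nats := (nats s')(''cnt'' := Suc (nats s' ''cnt''), ''i'' := Suc (nats s' ''i''),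
            ''p'' := nats s' ''p'' + nats s' ''d'')\<rparr>
        = st (Suc i)" if "i \<in> H"
      using that inp unfolding s' st_def step inputs_def
      by (auto simp: charge_def fun_eq_iff four intro!: state.equality)
    moreover have "s'\<lparr>nats := (nats s')(''i'' := Suc (nats s' ''i''), ''p'' := nats s' ''p'' + nats s' ''d'')\<rparr>
        = st (Suc i)" if "i \<notin> H"
      using that inp unfolding s' st_def step inputs_def
      by (auto simp: fun_eq_iff intro!: state.equality)
    moreover have "nats s' ''i'' = i" "nats s' ''m'' = 2 ^ r" by (auto simp: s' st_def s)
    ultimately show "bval (NLess (NVar ''i'') (NVar ''n'')) s' \<and> runs (Seq
       (Cond
         (BAnd (NLess (NConst 0) (NVar ''a''))
           (BAnd (RLess (OfNat (NConst 0))
               (RMul (RSub (Cell ''X'' (NVar ''p'')) (OfNat (NVar ''f'')))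
                 (RSub (Cell ''X'' (NVar ''p'')) (OfNat (NVar ''f'')))))
             (BNot (RLess (RMul (OfNat (NVar ''b'')) (OfNat (NVar ''b'')))
               (RAdd (Cell ''U'' (NVar ''i'')) cost_exp)))))
         (Seq (NAssign ''cnt'' (NAdd (NVar ''cnt'') (NConst 1)))
           (RAssign ''U'' (NVar ''i'') (RAdd (Cell ''U'' (NVar ''i'')) cost_exp)))
         Skip)
       (Seq (NAssign ''i'' (NAdd (NVar ''i'') (NConst 1)))
         (NAssign ''p'' (NAdd (NVar ''p'') (NVar ''d''))))) s' (\<lambda>t s''. t \<le> 5 \<and> s'' = st (Suc i))"
      by (simp only: runs_simps runs_Cond test if_split) (simp add: store_def cost_exp_def)
  next
    fix t s' assume "s' = st (length X)" "t \<le> length X * (5 + 1) + 1"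
    then show "\<not> bval (NLess (NVar ''i'') (NVar ''n'')) s' \<and> t \<le> 6 * length X + 1 \<and>
      (\<exists>p. s' = s\<lparr>nats := (nats s)(''i'' := length X, ''p'' := p, ''cnt'' := card H),
      arrays := (arrays s)(''U'' := charge H (4 ^ r) (arrays s ''U''))\<rparr>)"
      using inp by (auto simp: st_def HX inputs_def)
  qed
qed

lemma stage_prog:
  fixes c d r k :: nat and X :: "(nat \<Rightarrow> bool) list" and \<omega> :: "real stream"
  assumes inp: "inputs d \<epsilon> X (side c d (length X)) s" and k: "k < 2 * d" and r: "r < stages d"
  defines "t \<equiv> k * stages d + r"
  assumes M: "mechanism c d \<epsilon> X t \<omega> = (active, U, E)"
    and s: "nats s ''k'' = k" "nats s ''pp'' = (if k < d then k else k - d)"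
      "nats s ''f'' = of_bool (\<not> k < d)" "nats s ''a'' = of_bool (r = 0 \<or> active)"
      "nats s ''m'' = 2 ^ r" "nats s ''j'' = 0"
      "arrays s ''U'' = U" "arrays s ''E'' = E" "tape s = sdrop t \<omega>"
    and M': "mechanism c d \<epsilon> X (Suc t) \<omega> = (active', U', E')"
  shows "runs stage_prog s (\<lambda>T s'. T \<le> 6 * length X + 11 \<and>
    inputs d \<epsilon> X (side c d (length X)) s' \<and>
    nats s' ''k'' = k \<and> nats s' ''pp'' = (if k < d then k else k - d) \<and>
    nats s' ''f'' = of_bool (\<not> k < d) \<and> nats s' ''a'' = of_bool active' \<and>
    nats s' ''m'' = 2 ^ Suc r \<and> nats s' ''j'' = 0 \<and>
    arrays s' ''U'' = U' \<and> arrays s' ''E'' = E' \<and> tape s' = sdrop (Suc t) \<omega>)"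
proof -
  define n b where "n = length X" and "b = side c d n"
  define a' where "a' = (r = 0 \<or> active)"
  define H where "H = hits n ((real b)\<^sup>2) (table d X k) (4 ^ r) a' U"
  define y where "y = (real (card H) + noise_scale c d \<epsilon> n * (\<omega> !! t) / 2 ^ r) / real n"
  have d: "d > 0" using k by simp
  have t: "t div stages d = k" "t mod stages d = r" using r by (auto simp: t_def)
  have "mechanism c d \<epsilon> X (Suc t) \<omega>
      = stage n ((real b)\<^sup>2) (noise_scale c d \<epsilon> n) (stages d) (table d X) t (mechanism c d \<epsilon> X t \<omega>) (\<omega> !! t)"
    unfolding mechanism_def iter_Suc_right by (simp add: n_def b_def)
  then have post: "active' \<longleftrightarrow> a' \<and> y < 1 / (2 * 4 ^ r)" "U' = charge H (4 ^ r) U"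
    "E' = (if a' then E(k := y) else E)"
    unfolding M M' stage_def Let_def prod.case t a'_def[symmetric] H_def[symmetric] y_def[symmetric]
    by auto
  have four: "(2 ^ r * 2 ^ r :: real) = 4 ^ r" by (simp flip: power_mult_distrib)
  define s0 where "s0 = s\<lparr>nats := (nats s)(''i'' := 0, ''p'' := (if k < d then k else k - d), ''cnt'' := 0)\<rparr>"
  have row: "runs row_prog s0 (\<lambda>t s'. t \<le> 6 * n + 1 \<and>
    (\<exists>p. s' = s0\<lparr>nats := (nats s0)(''i'' := n, ''p'' := p, ''cnt'' := card H),
      arrays := (arrays s0)(''U'' := charge H (4 ^ r) U)\<rparr>))"
    using row_prog[of d \<epsilon> X b s0 k a' r] inp d k s
    unfolding H_def n_def b_def a'_def by (simp add: s0_def inputs_def)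
  have pre: "runs (Seq (NAssign ''i'' (NConst 0)) (Seq (NAssign ''p'' (NVar ''pp''))
      (Seq (NAssign ''cnt'' (NConst 0)) q))) s \<Phi> \<longleftrightarrow> runs q s0 (\<lambda>t. \<Phi> (Suc (Suc (Suc t))))" for q \<Phi>
    by (simp add: s0_def s)
  show ?thesis unfolding stage_prog_def unfolding pre unfolding runs_simps(5)
  proof (rule runs_mono[OF row], elim conjE exE)
    fix T s' p assume T: "T \<le> 6 * n + 1" and s': "s' = s0\<lparr>nats := (nats s0)(''i'' := n, ''p'' := p, ''cnt'' := card H),
      arrays := (arrays s0)(''U'' := charge H (4 ^ r) U)\<rparr>"
    show "runs release_prog s' (\<lambda>t2 s2. Suc (Suc (Suc (T + t2))) \<le> 6 * length X + 11 \<and>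
       inputs d \<epsilon> X (side c d (length X)) s2 \<and>
       nats s2 ''k'' = k \<and> nats s2 ''pp'' = (if k < d then k else k - d) \<and>
       nats s2 ''f'' = of_bool (\<not> k < d) \<and> nats s2 ''a'' = of_bool active' \<and>
       nats s2 ''m'' = 2 ^ Suc r \<and> nats s2 ''j'' = 0 \<and>
       arrays s2 ''U'' = U' \<and> arrays s2 ''E'' = E' \<and> tape s2 = sdrop (Suc t) \<omega>)"
      using T inp unfolding s' s0_def release_prog_def
      by (cases a') (simp_all add: inputs_def store_def noise_exp_def cost_exp_def post s a'_def[symmetric] y_def
       noise_scale_def n_def[symmetric] b_def[symmetric] sdrop_simps four)
  qed
qed

lemma column_prog:
  fixes c d k :: nat and X :: "(nat \<Rightarrow> bool) list" and \<omega> :: "real stream"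
  assumes inp: "inputs d \<epsilon> X (side c d (length X)) s" and k: "k < 2 * d"
    and s: "nats s ''k'' = k" "nats s ''j'' = 0" "tape s = sdrop (k * stages d) \<omega>"
      "mechanism c d \<epsilon> X (k * stages d) \<omega> = (active, arrays s ''U'', arrays s ''E'')"
  shows "runs column_prog s (\<lambda>T s'. T \<le> d * (6 * length X + 12) + 7 \<and>
    inputs d \<epsilon> X (side c d (length X)) s' \<and> nats s' ''k'' = Suc k \<and> nats s' ''j'' = 0 \<and>
    tape s' = sdrop (Suc k * stages d) \<omega> \<and>
    (\<exists>active'. mechanism c d \<epsilon> X (Suc k * stages d) \<omega> = (active', arrays s' ''U'', arrays s' ''E'')))"
proof -
  let ?b = "side c d (length X)"
  have four: "(2 ^ r * 2 ^ r :: real) = 4 ^ r" for r by (simp flip: power_mult_distrib)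
  have d: "d \<ge> 1" using k by simp
  \<comment> \<open>At \<open>r = 0\<close> the mechanism still carries the flag of the previous
    column, whereas the program has already reset its own; the disjunction reconciles them.\<close>
  define I where "I r s' \<longleftrightarrow> inputs d \<epsilon> X ?b s' \<and>
    nats s' ''k'' = k \<and> nats s' ''pp'' = (if k < d then k else k - d) \<and>
    nats s' ''f'' = of_bool (\<not> k < d) \<and>
    nats s' ''m'' = 2 ^ r \<and> nats s' ''j'' = 0 \<and> tape s' = sdrop (k * stages d + r) \<omega> \<and>
    (\<exists>active. mechanism c d \<epsilon> X (k * stages d + r) \<omega> = (active, arrays s' ''U'', arrays s' ''E'')
       \<and> nats s' ''a'' = of_bool (r = 0 \<or> active))" for r s'
  have loop: "runs stage_loop s0
    (\<lambda>t s'. t \<le> d * (6 * length X + 12) + 1 \<and> I (stages d) s')" if "I 0 s0" for s0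
    unfolding stage_loop_def
  proof (rule runs_While[where K = "stages d" and T = "6 * length X + 11" and I = I])
    show "I 0 s0" by fact
  next
    fix r s' assume r: "r < stages d" and I: "I r s'"
    have "(4 ^ r :: real) < 4 * real d"
      using of_nat_less_iff[where 'a = real, THEN iffD2, OF stages_lower[OF r]] by simp
    with I have test: "bval (RLess cost_exp (RMul (OfNat (NConst 4)) (OfNat (NVar ''d'')))) s'"
      by (simp add: I_def cost_exp_def four inputs_def)
    from I obtain active where active:
      "mechanism c d \<epsilon> X (k * stages d + r) \<omega> = (active, arrays s' ''U'', arrays s' ''E'')"
      "nats s' ''a'' = of_bool (r = 0 \<or> active)"
      unfolding I_def by blast
    obtain a2 U2 E2 where next_state: "mechanism c d \<epsilon> X (Suc (k * stages d + r)) \<omega> = (a2, U2, E2)"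
      using prod_cases3 by blast
    have "runs stage_prog s' (\<lambda>t s''. t \<le> 6 * length X + 11 \<and> I (Suc r) s'')"
    proof (rule runs_mono[OF stage_prog[OF _ k r active(1) _ _ _ active(2) _ _ refl refl _ next_state]])
      show "nats s' ''f'' = of_bool (\<not> k < d)" using I unfolding I_def by blast
    qed (use I in \<open>simp_all add: I_def next_state\<close>)
    with test show "bval (RLess cost_exp (RMul (OfNat (NConst 4)) (OfNat (NVar ''d'')))) s' \<and>
      runs stage_prog s' (\<lambda>t s''. t \<le> 6 * length X + 11 \<and> I (Suc r) s'')" by blast
  next
    fix t s' assume I: "I (stages d) s'" and t: "t \<le> stages d * (6 * length X + 11 + 1) + 1"
    have "(4 ^ stages d :: real) \<ge> 4 * real d"
      using of_nat_le_iff[where 'a = real, THEN iffD2, OF stages_upper[of d]] by simp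
    moreover have "stages d * (6 * length X + 11 + 1) \<le> d * (6 * length X + 12)"
      using stages_le[OF d] by (intro mult_mono) auto
    ultimately show "\<not> bval (RLess cost_exp (RMul (OfNat (NConst 4)) (OfNat (NVar ''d'')))) s' \<and>
      t \<le> d * (6 * length X + 12) + 1 \<and> I (stages d) s'"
      using I t by (auto simp: I_def cost_exp_def four inputs_def)
  qed
  define s0 where "s0 = s\<lparr>nats := (nats s)(''pp'' := if k < d then k else k - d, ''f'' := of_bool (\<not> k < d),
     ''a'' := 1, ''m'' := 1)\<rparr>"
  have "I 0 s0" using inp s by (auto simp: I_def s0_def inputs_def)
  note loop = loop[OF this]
  have dn: "nats s ''d'' = d" using inp by (simp add: inputs_def)
  have pre: "runs (Seq (Cond (NLess (NVar ''k'') (NVar ''d''))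
       (Seq (NAssign ''pp'' (NVar ''k'')) (NAssign ''f'' (NConst 0)))
       (Seq (NAssign ''pp'' (NSub (NVar ''k'') (NVar ''d''))) (NAssign ''f'' (NConst 1))))
     (Seq (NAssign ''a'' (NConst 1)) (Seq (NAssign ''m'' (NConst 1)) q))) s \<Phi>
     \<longleftrightarrow> runs q s0 (\<lambda>t. \<Phi> (Suc (Suc (Suc (Suc (Suc t))))))" for q \<Phi>
    by (cases "k < d") (simp_all add: s dn s0_def)
  show ?thesis unfolding column_prog_def unfolding pre unfolding runs_simps(5)
    by (rule runs_mono[OF loop]) (auto simp: I_def inputs_def add.commute)
qed

lemma output_prog:
  assumes s: "nats s ''d'' = d" "nats s ''j'' = 0"
  shows "runs output_prog s (\<lambda>t s'. t \<le> d * 8 + 1 \<and>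
    restrict (arrays s' ''Q'') {..<d} = readout d (arrays s ''E''))"
  unfolding output_prog_def
proof (rule runs_While[where K = d and T = 7 and I = "\<lambda>j s'. nats s' ''d'' = d \<and> nats s' ''j'' = j \<and>
    arrays s' ''E'' = arrays s ''E'' \<and> (\<forall>i<j. arrays s' ''Q'' i = readout d (arrays s ''E'') i)"], goal_cases)
  case 1
  show ?case using s by simp
next
  case (2 j s')
  then show ?case
    by (auto simp: store_def readout_def clip01_def less_Suc_eq)
next
  case (3 t s')
  then show ?case by (auto simp: fun_eq_iff readout_def)
qed

lemma log_prog:
  assumes "nats s ''lg'' = 0"
  defines "m \<equiv> nats s ''n'' + nats s ''d'' + 1"
  shows "runs log_prog s (\<lambda>t s'. t \<le> 3 * lg m + 2 \<and>
    (\<exists>w. s' = s\<lparr>nats := (nats s)(''w'' := w, ''lg'' := lg m)\<rparr>))"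
proof -
  have "runs (While (NLess (NVar ''w'') (NAdd (NAdd (NVar ''n'') (NVar ''d'')) (NConst 1)))
       (Seq (NAssign ''w'' (NAdd (NVar ''w'') (NVar ''w'')))
         (NAssign ''lg'' (NAdd (NVar ''lg'') (NConst 1)))))
      (s\<lparr>nats := (nats s)(''w'' := 1)\<rparr>) (\<lambda>t s'. Suc t \<le> 3 * lg m + 2 \<and>
    (\<exists>w. s' = s\<lparr>nats := (nats s)(''w'' := w, ''lg'' := lg m)\<rparr>))"
  proof (rule runs_While[where K = "lg m" and T = 2 and
      I = "\<lambda>k s'. s' = s\<lparr>nats := (nats s)(''w'' := 2 ^ k, ''lg'' := k)\<rparr>"], goal_cases)
    case 1
    show ?case using assms by (auto simp: fun_eq_iff intro!: state.equality)
  next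
    case (2 k s')
    from lg_lower[OF this(1)] 2 show ?case
      by (auto simp: m_def fun_eq_iff intro!: state.equality)
  next
    case (3 t s')
    with lg_upper[of m] show ?case by (auto simp: m_def)
  qed
  then show ?thesis by (simp add: log_prog_def)
qed

lemma side_prog:
  assumes "nats s ''b'' = 0" "nats s ''d'' = d" "nats s ''lg'' = lg (n + d + 1)"
  shows "runs (side_prog c) s (\<lambda>t s'. t \<le> 2 * side c d n + 1 \<and>
    s' = s\<lparr>nats := (nats s)(''b'' := side c d n)\<rparr>)"
  unfolding side_prog_def
proof (rule runs_While[where K = "side c d n" and T = 1 and
      I = "\<lambda>k s'. s' = s\<lparr>nats := (nats s)(''b'' := k)\<rparr>"], goal_cases)
  case 1
  show ?case using assms by (auto simp: fun_eq_iff intro!: state.equality)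
next
  case (2 k s')
  from side_lower[OF this(1)] have "real (k * k) < real (d * (36 + 6 * (c + 1) * lg (n + d + 1)))"
    by (simp only: of_nat_less_iff)
  with 2 assms show ?case by (auto simp: fun_eq_iff algebra_simps)
next
  case (3 t s')
  from side_upper[of d c n]
  have "real (d * (36 + 6 * (c + 1) * lg (n + d + 1))) \<le> real (side c d n * side c d n)"
    by (simp only: of_nat_le_iff)
  with 3 assms show ?case by (auto simp: algebra_simps)
qed

text \<open>The time is cubic: 2 d columns, at most d stages each by the crude bound
  \<open>stages_le\<close>, and one pass over the rows per stage. The search for \<open>side\<close>
  accounts for the part that depends on \<open>c\<close>.\<close>

lemma estimator_runs:
  fixes X :: "(nat \<Rightarrow> bool) list"
  shows "runs (estimator c) (init d \<alpha> \<epsilon> X \<omega>) (\<lambda>t s'.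
    t \<le> (84 * (c + 1) + 60) * (d + length X + 1) ^ 3 \<and>
    restrict (arrays s' ''Q'') {..<d} = readout d (snd (snd (mechanism c d \<epsilon> X (2 * d * stages d) \<omega>))))"
proof -
  define n where "n = length X"
  define m where "m = n + d + 1"
  let ?s = "init d \<alpha> \<epsilon> X \<omega>"
  have main: "runs (While (NLess (NVar ''k'') (NAdd (NVar ''d'') (NVar ''d''))) column_prog) s
    (\<lambda>t s'. t \<le> 2 * d * (d * (6 * n + 12) + 8) + 1 \<and> nats s' ''d'' = d \<and> nats s' ''j'' = 0 \<and>
      arrays s' ''E'' = snd (snd (mechanism c d \<epsilon> X (2 * d * stages d) \<omega>)))"
    if s: "s = ?s\<lparr>nats := (nats ?s)(''w'' := w, ''lg'' := lg m, ''b'' := side c d n)\<rparr>" for s w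
  proof (rule runs_While[where K = "2 * d" and T = "d * (6 * n + 12) + 7" and I = "\<lambda>k s'.
      inputs d \<epsilon> X (side c d n) s' \<and> nats s' ''k'' = k \<and> nats s' ''j'' = 0 \<and>
      tape s' = sdrop (k * stages d) \<omega> \<and>
      (\<exists>active. mechanism c d \<epsilon> X (k * stages d) \<omega> = (active, arrays s' ''U'', arrays s' ''E''))"], goal_cases)
    case 1
    show ?case by (auto simp: s init_def inputs_def n_def mechanism_def dataset_array_def fun_eq_iff)
  next
    case (2 k s')
    then obtain active where "inputs d \<epsilon> X (side c d (length X)) s'" "nats s' ''k'' = k" "nats s' ''j'' = 0"
      "tape s' = sdrop (k * stages d) \<omega>"
      "mechanism c d \<epsilon> X (k * stages d) \<omega> = (active, arrays s' ''U'', arrays s' ''E'')"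
      by (auto simp: n_def)
    from column_prog[OF this(1) 2(1) this(2-)] 2 show ?case
      by (auto simp: inputs_def n_def)
  next
    case (3 t s')
    then show ?case by (auto simp: inputs_def add.commute)
  qed
  have total: "Suc (3 * lg m + 2) + (2 * side c d n + 1) + (2 * d * (d * (6 * n + 12) + 8) + 1) + (d * 8 + 1)
      \<le> (84 * (c + 1) + 60) * m ^ 3"
  proof -
    have m: "m \<ge> 1" "d \<le> m" "n \<le> m" "lg m \<le> m" using lg_le[of m] by (auto simp: m_def)
    have m2: "m \<le> m ^ 3" "1 \<le> m ^ 3" "m ^ 2 \<le> m ^ 3" "1 \<le> m ^ 2"
      using m power_increasing[of 1 3 m] power_increasing[of 2 3 m] by auto
    have "side c d n \<le> d * (36 + 6 * (c + 1) * lg m)" using side_le[of c d n] by (simp add: m_def)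
    also have "\<dots> \<le> m * (36 * ((c + 1) * m) + 6 * (c + 1) * m)"
    proof (intro mult_mono add_mono)
      have "36 * 1 \<le> 36 * ((c + 1) * m)" using m by (intro mult_left_mono) auto
      then show "36 \<le> 36 * ((c + 1) * m)" by simp
    qed (use m in auto)
    also have "\<dots> = 42 * (c + 1) * m ^ 2" by (simp add: power2_eq_square algebra_simps)
    also have "\<dots> \<le> 42 * (c + 1) * m ^ 3" using m2 by (intro mult_left_mono) auto
    finally have "side c d n \<le> 42 * (c + 1) * m ^ 3" .
    then have 1: "2 * side c d n \<le> 84 * (c + 1) * m ^ 3" by (simp add: algebra_simps)
    have "d * (6 * n + 12) + 8 \<le> m * (12 * m) + 8 * m ^ 2"
      using m m2 by (intro add_mono mult_mono) (auto simp: m_def)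
    also have "\<dots> = 20 * m ^ 2" by (simp add: power2_eq_square)
    finally have "2 * d * (d * (6 * n + 12) + 8) \<le> 2 * m * (20 * m ^ 2)"
      using m by (intro mult_mono) auto
    also have "\<dots> = 40 * m ^ 3" by (simp add: power2_eq_square power3_eq_cube)
    finally have 2: "2 * d * (d * (6 * n + 12) + 8) \<le> 40 * m ^ 3" .
    have "Suc (3 * lg m + 2) \<le> 3 * m ^ 3 + 3 * m ^ 3" "d * 8 + 1 \<le> 8 * m ^ 3 + m ^ 3"
      using m m2 by linarith+
    with 1 2 m2 show ?thesis unfolding distrib_right by linarith
  qed
  have a1: "nats ?s ''lg'' = 0" "nats ?s ''n'' = n" "nats ?s ''d'' = d" by (auto simp: init_def n_def)
  show ?thesis unfolding estimator_def runs_simps(5)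
  proof (rule runs_mono[OF log_prog[OF a1(1)]], unfold a1, fold m_def, elim conjE exE)
    fix t1 w and s1 :: state assume t1: "t1 \<le> 3 * lg m + 2" and s1: "s1 = ?s\<lparr>nats := (nats ?s)(''w'' := w, ''lg'' := lg m)\<rparr>"
    have sp: "runs (side_prog c) s1 (\<lambda>t s'. t \<le> 2 * side c d n + 1 \<and>
        s' = s1\<lparr>nats := (nats s1)(''b'' := side c d n)\<rparr>)"
      by (rule side_prog[where d = d]) (auto simp: s1 init_def m_def)
    show "runs (side_prog c) s1 (\<lambda>t2 s2. runs (While (NLess (NVar ''k'') (NAdd (NVar ''d'') (NVar ''d''))) column_prog) s2
       (\<lambda>t3 s3. runs output_prog s3 (\<lambda>t4 s4. t1 + (t2 + (t3 + t4)) \<le> (84 * (c + 1) + 60) * (d + length X + 1) ^ 3 \<and>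
          restrict (arrays s4 ''Q'') {..<d} = readout d (snd (snd (mechanism c d \<epsilon> X (2 * d * stages d) \<omega>))))))"
    proof (rule runs_mono[OF sp], elim conjE)
      fix t2 and s2 :: state assume t2: "t2 \<le> 2 * side c d n + 1" and s2: "s2 = s1\<lparr>nats := (nats s1)(''b'' := side c d n)\<rparr>"
      have "s2 = ?s\<lparr>nats := (nats ?s)(''w'' := w, ''lg'' := lg m, ''b'' := side c d n)\<rparr>"
        by (simp add: s2 s1)
      note main' = main[OF this]
      show "runs (While (NLess (NVar ''k'') (NAdd (NVar ''d'') (NVar ''d''))) column_prog) s2
       (\<lambda>t3 s3. runs output_prog s3 (\<lambda>t4 s4. t1 + (t2 + (t3 + t4)) \<le> (84 * (c + 1) + 60) * (d + length X + 1) ^ 3 \<and>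
          restrict (arrays s4 ''Q'') {..<d} = readout d (snd (snd (mechanism c d \<epsilon> X (2 * d * stages d) \<omega>)))))"
      proof (rule runs_mono[OF main'], elim conjE)
        fix t3 and s3 :: state assume 3: "t3 \<le> 2 * d * (d * (6 * n + 12) + 8) + 1" "nats s3 ''d'' = d" "nats s3 ''j'' = 0"
          "arrays s3 ''E'' = snd (snd (mechanism c d \<epsilon> X (2 * d * stages d) \<omega>))"
        show "runs output_prog s3 (\<lambda>t4 s4. t1 + (t2 + (t3 + t4)) \<le> (84 * (c + 1) + 60) * (d + length X + 1) ^ 3 \<and>
          restrict (arrays s4 ''Q'') {..<d} = readout d (snd (snd (mechanism c d \<epsilon> X (2 * d * stages d) \<omega>))))"
        proof (rule runs_mono[OF output_prog[OF 3(2,3)]], elim conjE, intro conjI)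
          fix t4 :: nat assume "t4 \<le> d * 8 + 1"
          then have "t1 + (t2 + (t3 + t4)) \<le> (84 * (c + 1) + 60) * m ^ 3"
            using t1 t2 3(1) total by linarith
          moreover have "d + length X + 1 = m" by (simp add: m_def n_def)
          ultimately show "t1 + (t2 + (t3 + t4)) \<le> (84 * (c + 1) + 60) * (d + length X + 1) ^ 3"
            by simp
        qed (simp add: 3)
      qed
    qed
  qed
qed

lemma polynomial_time_estimator: "polynomial_time (estimator c)"
proof -
  define p where "p = Polynomial.smult (84 * (c + 1) + 60) ([:1, 1:] ^ 3 :: nat poly)"
  have p: "poly p z = (84 * (c + 1) + 60) * (z + 1) ^ 3" for z
    by (simp add: p_def poly_power add.commute)
  show ?thesis unfolding polynomial_time_def
  proof (intro exI[of _ p] allI impI ballI)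
    fix d \<alpha> \<epsilon> X \<omega>
    from estimator_runs[of c d \<alpha> \<epsilon> X \<omega>]
    show "\<exists>t s'. big_step (estimator c) (init d \<alpha> \<epsilon> X \<omega>) t s' \<and> t \<le> poly p (d + length X)"
      unfolding runs_def p by blast
  qed
qed

lemma result_estimator:
  "result (estimator c) d \<alpha> \<epsilon> X \<omega> = readout d (snd (snd (mechanism c d \<epsilon> X (2 * d * stages d) \<omega>)))"
  using runs_final[OF estimator_runs[of c d \<alpha> \<epsilon> X \<omega>]] by (auto simp: result_def)

lemma outputs_product_distribution_estimator: "outputs_product_distribution (estimator c)"
  by (auto simp: outputs_product_distribution_def result_estimator readout_def clip01_def)

section \<open>Privacy of the program\<close>

lemma measurable_readout: "readout d \<in> (\<Pi>\<^sub>M i\<in>UNIV. borel) \<rightarrow>\<^sub>M (\<Pi>\<^sub>M j\<in>{..<d}. borel)"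
  unfolding readout_def clip01_def by measurable

lemma measurable_result:
  "result (estimator c) d \<alpha> \<epsilon> X \<in> noise_space \<rightarrow>\<^sub>M (\<Pi>\<^sub>M j\<in>{..<d}. borel)"
proof -
  have "(\<lambda>\<omega>. snd (snd (mechanism c d \<epsilon> X t \<omega>))) \<in> noise_space \<rightarrow>\<^sub>M (\<Pi>\<^sub>M i\<in>UNIV. borel)" for t
    unfolding mechanism_def
    using measurable_compose[OF measurable_Pair1' measurable_estimates, of "\<lambda>_. 0"]
    by (simp add: space_PiM)
  from measurable_compose[OF this measurable_readout] show ?thesis
    by (simp add: result_estimator[abs_def])
qed

lemma law_estimator:
  "law (estimator c) d \<alpha> \<epsilon> X = distr noise_space (\<Pi>\<^sub>M j\<in>{..<d}. borel) (result (estimator c) d \<alpha> \<epsilon> X)"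
  by (simp add: law_def std_gauss_def)

lemma prob_space_law_estimator: "prob_space (law (estimator c) d \<alpha> \<epsilon> X)"
  unfolding law_estimator by (rule prob_space.prob_space_distr[OF prob_space_noise measurable_result])

lemma sets_law [simp, measurable_cong]: "sets (law c d \<alpha> \<epsilon> X) = sets (\<Pi>\<^sub>M j\<in>{..<d}. borel)"
  by (simp add: law_def)

lemma side_pos: "d \<ge> 1 \<Longrightarrow> side c d n > 0"
  using side_upper[of d c n] by (cases "side c d n") auto

lemma neighboring_differ_at:
  assumes "neighboring X X'"
  obtains i0 where "\<And>i. i < length X \<Longrightarrow> i \<noteq> i0 \<Longrightarrow> X ! i = X' ! i"
proof -
  define D where "D = {i. i < length X \<and> X ! i \<noteq> X' ! i}"
  have "finite D" "card D \<le> Suc 0" using assms unfolding neighboring_def D_def by auto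
  then have "\<forall>i\<in>D. \<forall>j\<in>D. i = j" by (simp add: card_le_Suc0_iff_eq)
  then obtain i0 where "D \<subseteq> {i0}" by blast
  then have "{i. i < length X \<and> X ! i \<noteq> X' ! i} \<subseteq> {i0}" unfolding D_def .
  then show ?thesis by (intro that[of i0]) blast
qed

text \<open>At the start both databases have the full budget B, so the exponent of
  \<open>iter_stage_dual\<close> is 2 B / (2 s^2) = B / s^2. The post-processing by
  \<open>readout\<close> is absorbed into the test function.\<close>

lemma renyi_dual_law_estimator:
  assumes nb: "neighboring X X'" and d: "d \<ge> 1" and \<epsilon>: "\<epsilon> > 0" and a: "a > 1"
  shows "renyi_dual a ((\<epsilon> / (1 + \<epsilon>))\<^sup>2 / 25) (law (estimator c) d \<alpha> \<epsilon> X) (law (estimator c) d \<alpha> \<epsilon> X')"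
  unfolding renyi_dual_def
proof (intro ballI allI impI)
  fix h :: "(nat \<Rightarrow> real) \<Rightarrow> real" and K :: real
  assume "h \<in> borel_measurable (law (estimator c) d \<alpha> \<epsilon> X')" and h: "\<forall>x. 0 \<le> h x \<and> h x \<le> K"
  then have [measurable]: "h \<in> borel_measurable (\<Pi>\<^sub>M j\<in>{..<d}. borel)" by simp
  have len: "length X' = length X" using nb by (simp add: neighboring_def)
  define n b s where "n = length X" and "b = side c d n" and "s = noise_scale c d \<epsilon> n"
  have b: "b > 0" using side_pos[OF d] by (simp add: b_def)
  then have s: "s > 0" using \<epsilon> by (simp add: s_def noise_scale_def b_def)
  obtain i0 where i0: "\<And>i. i < length X \<Longrightarrow> i \<noteq> i0 \<Longrightarrow> X ! i = X' ! i"
    using neighboring_differ_at[OF nb] by blast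
  have rho: "(max 0 ((real b)\<^sup>2 - 0) + max 0 ((real b)\<^sup>2 - 0)) / (2 * s\<^sup>2) = (\<epsilon> / (1 + \<epsilon>))\<^sup>2 / 25"
  proof -
    have "s = 5 * real b / (\<epsilon> / (1 + \<epsilon>))" by (simp add: s_def noise_scale_def b_def)
    then have "s\<^sup>2 = 25 * (real b)\<^sup>2 / (\<epsilon> / (1 + \<epsilon>))\<^sup>2"
      by (simp only: power_divide power_mult_distrib) simp
    then show ?thesis using b by simp
  qed
  have hr: "(\<lambda>E. h (readout d E)) \<in> borel_measurable (\<Pi>\<^sub>M i\<in>UNIV. borel)"
    by (rule measurable_compose[OF measurable_readout]) simp
  have "(\<integral>\<omega>. h (readout d (snd (snd (mechanism c d \<epsilon> X (2 * d * stages d) \<omega>)))) \<partial>noise_space)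
    \<le> exp ((a - 1) * ((\<epsilon> / (1 + \<epsilon>))\<^sup>2 / 25)) *
      (\<integral>\<omega>. h (readout d (snd (snd (mechanism c d \<epsilon> X' (2 * d * stages d) \<omega>)))) powr (a / (a - 1)) \<partial>noise_space)
        powr ((a - 1) / a)"
    unfolding mechanism_def len n_def[symmetric] b_def[symmetric] s_def[symmetric] rho[symmetric]
    by (rule iter_stage_dual[where ?i0.0 = i0, OF s a hr]) (use h i0 in \<open>auto simp: table_def n_def\<close>)
  then show "(\<integral>x. h x \<partial>law (estimator c) d \<alpha> \<epsilon> X)
    \<le> exp ((a - 1) * ((\<epsilon> / (1 + \<epsilon>))\<^sup>2 / 25)) *
      (\<integral>x. h x powr (a / (a - 1)) \<partial>law (estimator c) d \<alpha> \<epsilon> X') powr ((a - 1) / a)"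
    unfolding law_estimator
    by (subst (1 2) integral_distr[OF measurable_result]) (simp_all add: result_estimator)
qed

lemma
  assumes d: "d \<ge> 1" and \<epsilon>: "\<epsilon> > 0"
  shows zCDP_estimator: "zCDP \<X> (law (estimator c) d \<alpha> \<epsilon>) (\<epsilon>\<^sup>2 / 2)"
    and differentially_private_estimator: "\<delta> > 0 \<Longrightarrow>
      differentially_private \<X> (law (estimator c) d \<alpha> \<epsilon>) (\<epsilon> * sqrt (ln (1 / \<delta>))) \<delta>"
proof -
  define x where "x = \<epsilon> / (1 + \<epsilon>)"
  \<comment> \<open>Being below both 1 and \<epsilon>, x has a square below 1, \<epsilon> and
    \<epsilon>^2, which serves large and small \<epsilon> at once.\<close>
  have x: "0 < x" "x \<le> 1" "x \<le> \<epsilon>" using \<epsilon> by (auto simp: x_def field_simps)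
  have x2: "x\<^sup>2 \<le> \<epsilon>\<^sup>2" "x\<^sup>2 \<le> 1" "x\<^sup>2 \<le> \<epsilon>"
    using x mult_mono[of x 1 x \<epsilon>] by (auto simp: power2_eq_square intro: mult_mono mult_le_one)
  have x8: "x\<^sup>2 / 25 \<le> \<epsilon>\<^sup>2 / 8" "x\<^sup>2 / 25 \<le> \<epsilon> / 8" "x\<^sup>2 / 25 \<le> 1 / 25"
    using x2 \<epsilon> zero_le_power2[of \<epsilon>] by linarith+
  show "zCDP \<X> (law (estimator c) d \<alpha> \<epsilon>) (\<epsilon>\<^sup>2 / 2)"
    unfolding zCDP_def
  proof (intro ballI impI allI)
    fix X X' :: "(nat \<Rightarrow> bool) list" and a :: real assume nb: "neighboring X X'" and a: "1 < a"
    have "renyi_divergence a (law (estimator c) d \<alpha> \<epsilon> X) (law (estimator c) d \<alpha> \<epsilon> X') \<le> ereal (x\<^sup>2 / 25 * a)"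
      by (rule renyi_divergence_le_of_dual)
        (use renyi_dual_law_estimator[OF nb d \<epsilon> a, of c \<alpha>] a in \<open>auto simp: prob_space_law_estimator x_def\<close>)
    also have "x\<^sup>2 / 25 * a \<le> \<epsilon>\<^sup>2 / 2 * a"
      using x2 a zero_le_power2[of \<epsilon>] by (intro mult_right_mono) linarith+
    finally show "renyi_divergence a (law (estimator c) d \<alpha> \<epsilon> X) (law (estimator c) d \<alpha> \<epsilon> X')
      \<le> ereal (\<epsilon>\<^sup>2 / 2 * a)" by simp
  qed
  show "differentially_private \<X> (law (estimator c) d \<alpha> \<epsilon>) (\<epsilon> * sqrt (ln (1 / \<delta>))) \<delta>" if \<delta>: "\<delta> > 0"
    unfolding differentially_private_def
  proof (intro ballI impI)
    fix X X' :: "(nat \<Rightarrow> bool) list" and Y assume nb: "neighboring X X'" and Y: "Y \<in> sets (law (estimator c) d \<alpha> \<epsilon> X)"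
    show "measure (law (estimator c) d \<alpha> \<epsilon> X) Y
      \<le> exp (\<epsilon> * sqrt (ln (1 / \<delta>))) * measure (law (estimator c) d \<alpha> \<epsilon> X') Y + \<delta>"
      using renyi_dual_law_estimator[OF nb d \<epsilon>, of _ c \<alpha>] \<epsilon> \<delta> Y x8
      unfolding x_def[symmetric]
      by (intro measure_le_of_renyi_dual[where \<rho> = "x\<^sup>2 / 25"] prob_space_law_estimator) auto
  qed
qed

section \<open>Total variation between product distributions\<close>

abbreviation bernoulli_product :: "'i set \<Rightarrow> ('i \<Rightarrow> real) \<Rightarrow> ('i \<Rightarrow> bool) pmf" where
  "bernoulli_product I p \<equiv> Pi_pmf I False (\<lambda>j. bernoulli_pmf (p j))"

lemma finite_set_bernoulli_product [simp]: "finite I \<Longrightarrow> finite (set_pmf (bernoulli_product I p))"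
  by (rule finite_subset[OF set_Pi_pmf_subset']) (auto intro!: finite_PiE_dflt)

lemma expectation_bernoulli_product_insert:
  fixes f :: "('i \<Rightarrow> bool) \<Rightarrow> real"
  assumes "finite I" "x \<notin> I" "p x \<in> {0..1}"
  shows "measure_pmf.expectation (bernoulli_product (insert x I) p) f
    = p x * measure_pmf.expectation (bernoulli_product I p) (\<lambda>w. f (w(x := True)))
      + (1 - p x) * measure_pmf.expectation (bernoulli_product I p) (\<lambda>w. f (w(x := False)))"
proof -
  have "bernoulli_product (insert x I) p
      = bernoulli_pmf (p x) \<bind> (\<lambda>y. map_pmf (\<lambda>w. w(x := y)) (bernoulli_product I p))"
    using assms by (simp add: Pi_pmf_insert' map_pmf_def)
  also have "measure_pmf.expectation \<dots> f
      = (\<Sum>y\<in>UNIV. pmf (bernoulli_pmf (p x)) y *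
          measure_pmf.expectation (map_pmf (\<lambda>w. w(x := y)) (bernoulli_product I p)) f)"
    using assms by (subst pmf_expectation_bind[where A = UNIV]) auto
  also have "\<dots> = (\<Sum>y\<in>UNIV. pmf (bernoulli_pmf (p x)) y *
          measure_pmf.expectation (bernoulli_product I p) (\<lambda>w. f (w(x := y))))"
    by (intro sum.cong refl arg_cong2[where f = "(*)"] integral_map_pmf)
  also have "\<dots> = pmf (bernoulli_pmf (p x)) True *
          measure_pmf.expectation (bernoulli_product I p) (\<lambda>w. f (w(x := True))) +
          pmf (bernoulli_pmf (p x)) False *
          measure_pmf.expectation (bernoulli_product I p) (\<lambda>w. f (w(x := False)))"
    unfolding UNIV_bool by (subst sum.insert) (simp_all only: sum.insert finite.emptyI sum.empty finite_insert, auto)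
  finally show ?thesis using assms(3) by (simp only: atLeastAtMost_iff pmf_bernoulli_True pmf_bernoulli_False)
qed

text \<open>Cauchy-Schwarz for the chi-square divergence of two Bernoulli laws, which is at most
  \<kappa>. Here \<open>A\<close> and \<open>W\<close> are mean and variance under \<open>m\<close>
  of the function with values u, v, and \<open>B\<close> is the change of its mean. Completing the
  square avoids dividing by m (1 - m), so m may be 0 or 1.\<close>

lemma bernoulli_chi_square:
  fixes p m u v \<kappa> :: real
  assumes m: "0 \<le> m" "m \<le> 1" and \<kappa>: "\<kappa> > 0" "(p - m)\<^sup>2 \<le> \<kappa> * (m * (1 - m))"
  shows "(p * u + (1 - p) * v)\<^sup>2 \<le> (1 + \<kappa>) * (m * u\<^sup>2 + (1 - m) * v\<^sup>2)"
proof -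
  define A where "A = m * u + (1 - m) * v"
  define B where "B = (p - m) * (u - v)"
  define W where "W = m * (1 - m) * (u - v)\<^sup>2"
  have 1: "p * u + (1 - p) * v = A + B" by (simp add: A_def B_def algebra_simps)
  have 2: "m * u\<^sup>2 + (1 - m) * v\<^sup>2 = A\<^sup>2 + W" by (simp add: A_def W_def power2_eq_square algebra_simps)
  have 3: "B\<^sup>2 \<le> \<kappa> * W"
    using mult_right_mono[OF \<kappa>(2), of "(u - v)\<^sup>2"] by (simp add: B_def W_def power_mult_distrib mult.assoc)
  have "\<kappa> * (\<kappa> * A\<^sup>2 + W - 2 * A * B) \<ge> (\<kappa> * A - B)\<^sup>2"
    using 3 by (simp add: power2_eq_square algebra_simps)
  then have "\<kappa> * (\<kappa> * A\<^sup>2 + W - 2 * A * B) \<ge> 0" using zero_le_power2 order_trans by blast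
  then have "\<kappa> * A\<^sup>2 + W - 2 * A * B \<ge> 0" using \<kappa> by (simp add: zero_le_mult_iff)
  with 3 have "(A + B)\<^sup>2 \<le> (1 + \<kappa>) * (A\<^sup>2 + W)" by (simp add: power2_eq_square algebra_simps)
  then show ?thesis by (simp only: 1 2)
qed

text \<open>The one-coordinate inequality tensorises: it is applied to the conditional expectations
  given the new coordinate, and the induction hypothesis to their squares.\<close>

lemma bernoulli_product_chi_square:
  fixes f :: "('i \<Rightarrow> bool) \<Rightarrow> real"
  assumes "finite I" and "\<And>j. j \<in> I \<Longrightarrow> p j \<in> {0..1}" "\<And>j. j \<in> I \<Longrightarrow> m j \<in> {0..1}"
    and \<kappa>: "\<kappa> > 0" and "\<And>j. j \<in> I \<Longrightarrow> (p j - m j)\<^sup>2 \<le> \<kappa> * (m j * (1 - m j))"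
  shows "(measure_pmf.expectation (bernoulli_product I p) f)\<^sup>2
    \<le> (1 + \<kappa>) ^ card I * measure_pmf.expectation (bernoulli_product I m) (\<lambda>w. (f w)\<^sup>2)"
  using assms(1,2,3,5)
proof (induction I arbitrary: f)
  case empty
  then show ?case by simp
next
  case (insert x I)
  let ?E = "\<lambda>p. measure_pmf.expectation (bernoulli_product I p)"
  have px: "p x \<in> {0..1}" "m x \<in> {0..1}" using insert.prems by auto
  have "(measure_pmf.expectation (bernoulli_product (insert x I) p) f)\<^sup>2
      \<le> (1 + \<kappa>) * (m x * (?E p (\<lambda>w. f (w(x := True))))\<^sup>2 + (1 - m x) * (?E p (\<lambda>w. f (w(x := False))))\<^sup>2)"
    using insert.hyps px insert.prems(3)[of x] \<kappa>
    by (subst expectation_bernoulli_product_insert) (auto intro!: bernoulli_chi_square)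
  also have "\<dots> \<le> (1 + \<kappa>) * (m x * ((1 + \<kappa>) ^ card I * ?E m (\<lambda>w. (f (w(x := True)))\<^sup>2))
      + (1 - m x) * ((1 + \<kappa>) ^ card I * ?E m (\<lambda>w. (f (w(x := False)))\<^sup>2)))"
    using px \<kappa> insert.prems by (intro mult_left_mono add_mono insert.IH) auto
  also have "\<dots> = (1 + \<kappa>) ^ card (insert x I)
      * measure_pmf.expectation (bernoulli_product (insert x I) m) (\<lambda>w. (f w)\<^sup>2)"
    using insert.hyps px by (subst expectation_bernoulli_product_insert) (auto simp: algebra_simps)
  finally show ?case .
qed

text \<open>Coordinates are exchanged one at a time. This covers means so close to 0 or 1 that the
  chi-square divergence is not controlled.\<close>

lemma bernoulli_product_hybrid:
  fixes f :: "('i \<Rightarrow> bool) \<Rightarrow> real"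
  assumes "finite I" and "\<And>j. j \<in> I \<Longrightarrow> p j \<in> {0..1}" "\<And>j. j \<in> I \<Longrightarrow> m j \<in> {0..1}"
    and "\<And>w. 0 \<le> f w" "\<And>w. f w \<le> 1"
  shows "\<bar>measure_pmf.expectation (bernoulli_product I p) f - measure_pmf.expectation (bernoulli_product I m) f\<bar>
    \<le> (\<Sum>j\<in>I. \<bar>p j - m j\<bar>)"
  using assms
proof (induction I arbitrary: f)
  case empty
  then show ?case by simp
next
  case (insert x I)
  let ?E = "\<lambda>p. measure_pmf.expectation (bernoulli_product I p)"
  define P1 P0 M1 M0 where "P1 = ?E p (\<lambda>w. f (w(x := True)))" and "P0 = ?E p (\<lambda>w. f (w(x := False)))"
    and "M1 = ?E m (\<lambda>w. f (w(x := True)))" and "M0 = ?E m (\<lambda>w. f (w(x := False)))"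
  define S where "S = (\<Sum>j\<in>I. \<bar>p j - m j\<bar>)"
  have px: "p x \<in> {0..1}" "m x \<in> {0..1}" using insert.prems by auto
  have IH: "\<bar>P1 - M1\<bar> \<le> S" "\<bar>P0 - M0\<bar> \<le> S"
    unfolding P1_def P0_def M1_def M0_def S_def
    by (rule insert.IH; use insert.prems in auto)+
  have M: "0 \<le> M1" "M1 \<le> 1" "0 \<le> M0" "M0 \<le> 1"
    unfolding M1_def M0_def using insert.prems insert.hyps
    by (auto intro!: Bochner_Integration.integral_nonneg measure_pmf.integral_le_const
        integrable_measure_pmf_finite)
  have "p x * P1 + (1 - p x) * P0 - (m x * M1 + (1 - m x) * M0)
      = p x * (P1 - M1) + (1 - p x) * (P0 - M0) + (p x - m x) * (M1 - M0)"
    by (simp add: algebra_simps)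
  also have "\<bar>\<dots>\<bar> \<le> \<bar>p x * (P1 - M1)\<bar> + \<bar>(1 - p x) * (P0 - M0)\<bar> + \<bar>(p x - m x) * (M1 - M0)\<bar>"
    by linarith
  also have "\<dots> \<le> p x * S + (1 - p x) * S + \<bar>p x - m x\<bar> * 1"
    unfolding abs_mult using px IH M by (intro add_mono mult_mono) auto
  also have "\<dots> = (\<Sum>j\<in>insert x I. \<bar>p j - m j\<bar>)"
    using insert.hyps by (simp add: S_def algebra_simps)
  finally show ?case
    using insert.hyps px
    by (simp add: expectation_bernoulli_product_insert P1_def P0_def M1_def M0_def)
qed

text \<open>The hybrid \<open>m\<close> takes \<open>q\<close> at coordinates with tiny error and
  \<open>p\<close> elsewhere. From \<open>p\<close> to \<open>m\<close> the coordinatewise bound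
  costs \<alpha> / 8; from \<open>m\<close> to \<open>q\<close> the chi-square bound with \<kappa> =
  \<alpha>^2 / (24 d) costs \<alpha> / 3.\<close>

lemma tv_dist_product_dist_le:
  assumes d: "d \<ge> 1" and \<alpha>: "0 < \<alpha>" "\<alpha> \<le> 1"
    and p: "p \<in> {..<d} \<rightarrow> {0..1}" and q: "q \<in> {..<d} \<rightarrow> {0..1}"
    and pq: "\<And>j. j < d \<Longrightarrow> \<bar>q j - p j\<bar> \<le> \<alpha> / (8 * real d)
      \<or> (q j - p j)\<^sup>2 \<le> \<alpha>\<^sup>2 / (24 * real d) * (p j * (1 - p j))"
  shows "tv_dist (product_dist d p) (product_dist d q) \<le> \<alpha>"
  unfolding tv_dist_def
proof (rule cSUP_least)
  fix A :: "(nat \<Rightarrow> bool) set"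
  define m where "m j = (if \<bar>q j - p j\<bar> \<le> \<alpha> / (8 * real d) then q j else p j)" for j
  define \<kappa> where "\<kappa> = \<alpha>\<^sup>2 / (24 * real d)"
  have \<kappa>: "\<kappa> > 0" using d \<alpha> by (simp add: \<kappa>_def)
  have m: "m j \<in> {0..1}" if "j < d" for j using p q that by (auto simp: m_def)
  let ?P = "bernoulli_product {..<d} p" and ?M = "bernoulli_product {..<d} m"
    and ?Q = "bernoulli_product {..<d} q"
  have "\<bar>measure_pmf.expectation ?P (indicator A) - measure_pmf.expectation ?M (indicator A)\<bar>
      \<le> (\<Sum>j<d. \<bar>p j - m j\<bar>)"
    using p m by (intro bernoulli_product_hybrid) auto
  also have "\<dots> \<le> real (card {..<d}) * (\<alpha> / (8 * real d))"
    by (rule sum_bounded_above) (use \<alpha> in \<open>auto simp: m_def abs_minus_commute\<close>)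
  also have "\<dots> = \<alpha> / 8" using d by simp
  finally have 1: "\<bar>measure_pmf.prob ?P A - measure_pmf.prob ?M A\<bar> \<le> \<alpha> / 8" by simp
  define t where "t = measure_pmf.prob ?M A"
  define \<Delta> where "\<Delta> = measure_pmf.prob ?Q A - t"
  \<comment> \<open>The test function that turns chi-square into total variation: its mean under
    \<open>q\<close> is 1 + \<Delta>^2, while its second moment under \<open>m\<close> is at most 1
    + \<Delta>^2, so one such factor cancels.\<close>
  define f where "f w = 1 + \<Delta> * (indicator A w - t)" for w
  have int: "integrable (measure_pmf (bernoulli_product {..<d} r)) g" for r and g :: "_ \<Rightarrow> real"
    by (rule integrable_measure_pmf_finite) simp
  have EQ: "measure_pmf.expectation ?Q f = 1 + \<Delta>\<^sup>2"
    unfolding f_def using int by (simp add: \<Delta>_def power2_eq_square)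
  have f2: "(f w)\<^sup>2 = 1 + 2 * \<Delta> * (indicator A w - t) + \<Delta>\<^sup>2 * (indicator A w * (1 - 2 * t) + t\<^sup>2)" for w
    by (auto simp: f_def indicator_def power2_eq_square algebra_simps)
  have "measure_pmf.expectation ?M (\<lambda>w. (f w)\<^sup>2) = 1 + \<Delta>\<^sup>2 * (t * (1 - 2 * t) + t\<^sup>2)"
    unfolding f2 using int by (simp add: t_def)
  also have "\<dots> \<le> 1 + \<Delta>\<^sup>2 * 1"
  proof (intro add_left_mono mult_left_mono)
    have "t * (1 - 2 * t) + t\<^sup>2 = t - t\<^sup>2" by (simp add: power2_eq_square algebra_simps)
    also have "\<dots> \<le> 1" using zero_le_power2[of t] measure_pmf.prob_le_1[of ?M A] unfolding t_def by linarith
    finally show "t * (1 - 2 * t) + t\<^sup>2 \<le> 1" .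
  qed simp
  finally have EM: "measure_pmf.expectation ?M (\<lambda>w. (f w)\<^sup>2) \<le> 1 + \<Delta>\<^sup>2" by simp
  have "(1 + \<Delta>\<^sup>2)\<^sup>2 \<le> (1 + \<kappa>) ^ card {..<d} * measure_pmf.expectation ?M (\<lambda>w. (f w)\<^sup>2)"
    unfolding EQ[symmetric]
  proof (rule bernoulli_product_chi_square)
    fix j assume "j \<in> {..<d}"
    then have "j < d" by simp
    from pq[OF this] m[OF this] \<kappa> show "(q j - m j)\<^sup>2 \<le> \<kappa> * (m j * (1 - m j))"
      by (auto simp: m_def \<kappa>_def)
  qed (use q m \<kappa> in auto)
  also have "\<dots> \<le> (1 + \<alpha>\<^sup>2 / 12) * (1 + \<Delta>\<^sup>2)"
  proof (rule mult_mono[OF _ EM])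
    have a2: "\<alpha>\<^sup>2 \<le> 1" using \<alpha> by (intro power_le_one) auto
    have "(1 + \<kappa>) ^ d \<le> exp \<kappa> ^ d" using \<kappa> by (intro power_mono) auto
    also have "\<dots> = exp (\<alpha>\<^sup>2 / 24)" using d by (simp add: \<kappa>_def flip: exp_of_nat_mult)
    also have "\<dots> \<le> 1 + \<alpha>\<^sup>2 / 24 + (\<alpha>\<^sup>2 / 24)\<^sup>2"
      using a2 by (intro exp_bound) auto
    also have "(\<alpha>\<^sup>2 / 24)\<^sup>2 \<le> \<alpha>\<^sup>2 / 24"
      unfolding power2_eq_square[of "\<alpha>\<^sup>2 / 24"] by (rule mult_left_le) (use a2 in auto)
    finally show "(1 + \<kappa>) ^ card {..<d} \<le> 1 + \<alpha>\<^sup>2 / 12" by simp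
  qed auto
  finally have "(1 + \<Delta>\<^sup>2) * (1 + \<Delta>\<^sup>2) \<le> (1 + \<alpha>\<^sup>2 / 12) * (1 + \<Delta>\<^sup>2)" by (simp add: power2_eq_square)
  then have "\<Delta>\<^sup>2 \<le> \<alpha>\<^sup>2 / 12" by (subst (asm) mult_le_cancel_right) (use zero_le_power2[of \<Delta>] in linarith)
  also have "\<dots> \<le> (\<alpha> / 3)\<^sup>2" by (simp add: power2_eq_square)
  finally have "\<bar>\<Delta>\<bar> \<le> \<alpha> / 3" using \<alpha> by (simp add: abs_le_square_iff[symmetric])
  with 1 show "\<bar>measure_pmf.prob (product_dist d p) A - measure_pmf.prob (product_dist d q) A\<bar> \<le> \<alpha>"
    using \<alpha> unfolding product_dist_def \<Delta>_def t_def by linarith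
qed simp

section \<open>Measurability of the event of an accurate output\<close>

lemma tv_dist_le_iff: "tv_dist P Q \<le> \<alpha> \<longleftrightarrow> (\<forall>A. \<bar>measure_pmf.prob P A - measure_pmf.prob Q A\<bar> \<le> \<alpha>)"
proof -
  have "\<bar>measure_pmf.prob P A - measure_pmf.prob Q A\<bar> \<le> 1" for A
    using measure_pmf.prob_le_1[of P A] measure_pmf.prob_le_1[of Q A]
      measure_nonneg[of P A] measure_nonneg[of Q A] by linarith
  then have "bdd_above (range (\<lambda>A. \<bar>measure_pmf.prob P A - measure_pmf.prob Q A\<bar>))"
    by (intro bdd_aboveI[of _ 1]) auto
  from cSUP_le_iff[OF _ this] show ?thesis by (simp add: tv_dist_def)
qed

lemma tv_dist_le_1: "tv_dist P Q \<le> 1"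
  unfolding tv_dist_le_iff
proof
  fix A show "\<bar>measure_pmf.prob P A - measure_pmf.prob Q A\<bar> \<le> 1"
    using measure_pmf.prob_le_1[of P A] measure_pmf.prob_le_1[of Q A]
      measure_nonneg[of P A] measure_nonneg[of Q A] by linarith
qed

lemma finite_cube: "finite (cube d)"
  unfolding cube_def by (rule finite_PiE_dflt) auto

lemma set_product_dist: "set_pmf (product_dist d p) \<subseteq> cube d"
  unfolding product_dist_def cube_def using set_Pi_pmf_subset'[of "{..<d}" False "\<lambda>j. bernoulli_pmf (p j)"]
  by (auto simp: PiE_dflt_def)

lemma prob_product_dist:
  assumes "q \<in> {..<d} \<rightarrow> {0..1}"
  shows "measure_pmf.prob (product_dist d q) A
    = (\<Sum>x\<in>A \<inter> cube d. \<Prod>j<d. if x j then q j else 1 - q j)"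
proof -
  have "measure_pmf.prob (product_dist d q) A = measure_pmf.prob (product_dist d q) (A \<inter> cube d)"
    by (metis Int_assoc inf.absorb_iff2 measure_Int_set_pmf set_product_dist)
  also have "\<dots> = (\<Sum>x\<in>A \<inter> cube d. pmf (product_dist d q) x)"
    by (rule measure_measure_pmf_finite) (simp add: finite_cube)
  also have "\<dots> = (\<Sum>x\<in>A \<inter> cube d. \<Prod>j<d. if x j then q j else 1 - q j)"
  proof (intro sum.cong refl)
    fix x assume "x \<in> A \<inter> cube d"
    then have "\<forall>j. j \<notin> {..<d} \<longrightarrow> x j = False" by (auto simp: cube_def PiE_dflt_def)
    then show "pmf (product_dist d q) x = (\<Prod>j<d. if x j then q j else 1 - q j)"
      unfolding product_dist_def using Pi_mem[OF assms] by (subst pmf_Pi) (auto intro!: prod.cong)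
  qed
  finally show ?thesis .
qed

text \<open>The supremum ranges over uncountably many events, but only their traces on the finite
  cube matter, and the probability of each trace is a polynomial in the means.\<close>

lemma sets_accurate:
  assumes P: "set_pmf P \<subseteq> cube d"
  shows "{q \<in> {..<d} \<rightarrow>\<^sub>E {0..1}. tv_dist P (product_dist d q) \<le> \<alpha>} \<in> sets (\<Pi>\<^sub>M j\<in>{..<d}. borel)"
proof -
  define D where "D A q = (\<Sum>x\<in>A \<inter> cube d. \<Prod>j<d. if x j then q j else 1 - q j)" for A and q :: "nat \<Rightarrow> real"
  have iff: "tv_dist P (product_dist d q) \<le> \<alpha> \<longleftrightarrow> (\<forall>B\<in>Pow (cube d). \<bar>measure_pmf.prob P B - D B q\<bar> \<le> \<alpha>)"
    if q: "q \<in> {..<d} \<rightarrow>\<^sub>E {0..1}" for q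
  proof -
    have q': "q \<in> {..<d} \<rightarrow> {0..1}" using q by auto
    have "measure_pmf.prob P A = measure_pmf.prob P (A \<inter> cube d)" "D A q = D (A \<inter> cube d) q" for A
      using P by (metis Int_assoc inf.absorb_iff2 measure_Int_set_pmf, simp add: D_def Int_assoc)
    then show ?thesis unfolding tv_dist_le_iff prob_product_dist[OF q'] D_def[symmetric]
      by (metis Int_lower2 PowI)
  qed
  have "{q \<in> {..<d} \<rightarrow>\<^sub>E {0..1}. tv_dist P (product_dist d q) \<le> \<alpha>}
    = {q \<in> space (\<Pi>\<^sub>M j\<in>{..<d}. borel). (\<forall>j\<in>{..<d}. 0 \<le> q j \<and> q j \<le> 1) \<and>
        (\<forall>B\<in>Pow (cube d). \<bar>measure_pmf.prob P B - D B q\<bar> \<le> \<alpha>)}"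
    using iff by (auto simp: space_PiM PiE_iff)
  also have "\<dots> \<in> sets (\<Pi>\<^sub>M j\<in>{..<d}. borel)"
  proof -
    have [measurable]: "D B \<in> borel_measurable (\<Pi>\<^sub>M j\<in>{..<d}. borel)" for B
      unfolding D_def
    proof (intro borel_measurable_sum borel_measurable_prod)
      fix x :: "nat \<Rightarrow> bool" and j assume "j \<in> {..<d}"
      then have q: "(\<lambda>q :: nat \<Rightarrow> real. q j) \<in> borel_measurable (\<Pi>\<^sub>M j\<in>{..<d}. borel)"
        by (rule measurable_component_singleton)
      show "(\<lambda>q :: nat \<Rightarrow> real. if x j then q j else 1 - q j) \<in> borel_measurable (\<Pi>\<^sub>M j\<in>{..<d}. borel)"
        using q borel_measurable_diff[OF borel_measurable_const[of 1] q] by (cases "x j") simp_all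
    qed
    show ?thesis
      by (intro sets.sets_Collect_conj sets.sets_Collect_finite_All) (use finite_cube[of d] in auto)
  qed
  finally show ?thesis .
qed

section \<open>Concentration of the sample and of the noise\<close>

lemma finite_set_replicate_pmf: "finite (set_pmf P) \<Longrightarrow> finite (set_pmf (replicate_pmf n P))"
proof (rule finite_subset)
  show "set_pmf (replicate_pmf n P) \<subseteq> {xs. set xs \<subseteq> set_pmf P \<and> length xs = n}"
    by (auto simp: set_replicate_pmf)
qed (rule finite_lists_length_eq)

lemma expectation_replicate_pmf_Suc:
  fixes f :: "'a list \<Rightarrow> real"
  assumes "finite (set_pmf P)"
  shows "measure_pmf.expectation (replicate_pmf (Suc n) P) f
    = (\<Sum>a\<in>set_pmf P. pmf P a * measure_pmf.expectation (replicate_pmf n P) (\<lambda>xs. f (a # xs)))"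
proof -
  have "replicate_pmf (Suc n) P = P \<bind> (\<lambda>a. map_pmf (\<lambda>xs. a # xs) (replicate_pmf n P))"
    by (simp add: map_pmf_def)
  moreover have "finite (set_pmf (replicate_pmf n P))" by (rule finite_set_replicate_pmf[OF assms])
  ultimately show ?thesis
    using assms by (simp del: replicate_pmf.simps) (subst pmf_expectation_bind[where A = "set_pmf P"], auto)
qed

lemma expectation_finite_pmf:
  fixes f :: "'a \<Rightarrow> real"
  assumes "finite (set_pmf P)"
  shows "measure_pmf.expectation P f = (\<Sum>a\<in>set_pmf P. pmf P a * f a)"
  using assms by (subst integral_measure_pmf[of "set_pmf P"]) auto

lemma expectation_replicate_pmf_sum_list:
  fixes g :: "'a \<Rightarrow> real"
  assumes fin: "finite (set_pmf P)"
  shows "measure_pmf.expectation (replicate_pmf n P) (\<lambda>xs. \<Sum>x\<leftarrow>xs. g x) = real n * measure_pmf.expectation P g"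
proof (induction n)
  case (Suc n)
  have int: "integrable (measure_pmf (replicate_pmf n P)) f" for f :: "_ \<Rightarrow> real"
    by (intro integrable_measure_pmf_finite finite_set_replicate_pmf fin)
  have 1: "(\<Sum>a\<in>set_pmf P. pmf P a) = 1" using fin by (rule sum_pmf_eq_1) simp
  have "measure_pmf.expectation (replicate_pmf (Suc n) P) (\<lambda>xs. \<Sum>x\<leftarrow>xs. g x)
      = (\<Sum>a\<in>set_pmf P. pmf P a * (g a + real n * measure_pmf.expectation P g))"
    using int by (simp add: expectation_replicate_pmf_Suc[OF fin] Suc.IH del: replicate_pmf.simps)
  also have "\<dots> = measure_pmf.expectation P g + real n * measure_pmf.expectation P g"
    by (simp add: distrib_left sum.distrib expectation_finite_pmf[OF fin] flip: sum_distrib_right)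
      (simp add: 1 sum_distrib_right[symmetric])
  finally show ?case by (simp add: algebra_simps)
qed simp

lemma expectation_replicate_pmf_exp_sum_list:
  fixes g :: "'a \<Rightarrow> real"
  assumes fin: "finite (set_pmf P)"
  shows "measure_pmf.expectation (replicate_pmf n P) (\<lambda>xs. exp (\<Sum>x\<leftarrow>xs. g x))
    = measure_pmf.expectation P (\<lambda>x. exp (g x)) ^ n"
proof (induction n)
  case (Suc n)
  show ?case
    by (simp add: expectation_replicate_pmf_Suc[OF fin] exp_add Suc.IH expectation_finite_pmf[OF fin]
        sum_distrib_right mult.assoc del: replicate_pmf.simps)
qed simp

lemma prob_le_expectation_pmf:
  fixes f :: "'a \<Rightarrow> real"
  assumes fin: "finite (set_pmf P)" and "\<And>x. 0 \<le> f x" "\<And>x. x \<in> A \<Longrightarrow> 1 \<le> f x"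
  shows "measure_pmf.prob P A \<le> measure_pmf.expectation P f"
proof -
  have "measure_pmf.prob P A = measure_pmf.expectation P (indicator A)" by simp
  also have "\<dots> \<le> measure_pmf.expectation P f"
    using assms by (intro integral_mono integrable_measure_pmf_finite) (auto simp: indicator_def)
  finally show ?thesis .
qed

lemma prob_replicate_pmf_exists:
  assumes fin: "finite (set_pmf P)"
  shows "measure_pmf.prob (replicate_pmf n P) {xs. \<exists>x\<in>set xs. bad x} \<le> real n * measure_pmf.prob P {x. bad x}"
proof -
  have nn: "0 \<le> (\<Sum>x\<leftarrow>xs. indicator {x. bad x} x :: real)" for xs by (induction xs) auto
  have "1 \<le> (\<Sum>x\<leftarrow>xs. indicator {x. bad x} x :: real)" if "\<exists>x\<in>set xs. bad x" for xs
    using that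
  proof (induction xs)
    case (Cons y ys)
    then show ?case using nn[of ys] by (cases "bad y") auto
  qed simp
  then have "measure_pmf.prob (replicate_pmf n P) {xs. \<exists>x\<in>set xs. bad x}
      \<le> measure_pmf.expectation (replicate_pmf n P) (\<lambda>xs. \<Sum>x\<leftarrow>xs. indicator {x. bad x} x)"
    by (intro prob_le_expectation_pmf finite_set_replicate_pmf fin nn) auto
  also have "\<dots> = real n * measure_pmf.prob P {x. bad x}"
    by (simp add: expectation_replicate_pmf_sum_list[OF fin])
  finally show ?thesis .
qed

lemma exp_le_quadratic:
  fixes x :: real
  assumes "\<bar>x\<bar> \<le> 1"
  shows "exp x \<le> 1 + x + x\<^sup>2"
proof (cases "x \<ge> 0")
  case True
  then show ?thesis using exp_bound[of x] assms by simp
next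
  case False
  define y where "y = - x"
  have y: "0 \<le> y" "y \<le> 1" using False assms by (auto simp: y_def)
  have "1 + y + y\<^sup>2 / 2 \<le> exp y" by (rule exp_lower_Taylor_quadratic[OF y(1)])
  \<comment> \<open>Taylor's lower bound for exp y is inverted: 1 - y + y^2 is at least its
    reciprocal.\<close>
  have "1 \<le> (1 - y + y\<^sup>2) * (1 + y + y\<^sup>2 / 2)"
  proof -
    have "(1 - y + y\<^sup>2) * (1 + y + y\<^sup>2 / 2) = 1 + (y\<^sup>2 + y ^ 3 + y ^ 4) / 2"
      by (simp add: field_simps power2_eq_square power3_eq_cube power4_eq_xxxx)
    also have "\<dots> \<ge> 1" using y by simp
    finally show ?thesis .
  qed
  also have "\<dots> \<le> (1 - y + y\<^sup>2) * exp y"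
    using \<open>1 + y + y\<^sup>2 / 2 \<le> exp y\<close> y by (intro mult_left_mono) (auto intro: add_nonneg_nonneg)
  finally have "exp (- y) \<le> 1 - y + y\<^sup>2" by (simp add: exp_minus field_simps)
  then show ?thesis by (simp add: y_def)
qed

text \<open>The variance proxy \<open>m\<close> may exceed the mean \<open>q\<close>; below, it is
  the maximum of the mean and 1 / d, which keeps the deviation bound useful for very rare
  bits.\<close>

lemma exp_moment_bernoulli_le:
  assumes fin: "finite (set_pmf P)" and l: "\<bar>l\<bar> \<le> 1"
    and q: "q = measure_pmf.prob P {x. \<beta> x}" and m: "q \<le> m"
  shows "measure_pmf.expectation P (\<lambda>x. exp (l * (of_bool (\<beta> x) - q))) \<le> exp (m * l\<^sup>2)"
proof -
  have q01: "q \<ge> 0" by (simp add: q)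
  have int: "integrable (measure_pmf P) f" for f :: "_ \<Rightarrow> real"
    by (rule integrable_measure_pmf_finite[OF fin])
  have eq: "exp (l * (of_bool (\<beta> x) - q)) = exp (- l * q) * (1 + (exp l - 1) * indicator {x. \<beta> x} x)" for x
    by (simp add: indicator_def right_diff_distrib flip: exp_add)
  have "measure_pmf.expectation P (\<lambda>x. exp (l * (of_bool (\<beta> x) - q)))
      = exp (- l * q) * (1 + (exp l - 1) * q)"
    unfolding eq using int by (simp add: q)
  also have "\<dots> \<le> exp (- l * q) * exp ((exp l - 1) * q)"
    by (intro mult_left_mono) auto
  also have "\<dots> = exp ((exp l - 1 - l) * q)" by (simp add: algebra_simps flip: exp_add)
  also have "(exp l - 1 - l) * q \<le> l\<^sup>2 * m"
    using exp_le_quadratic[OF l] exp_ge_add_one_self[of l] q01 m by (intro mult_mono) auto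
  finally show ?thesis by (simp add: mult.commute)
qed

text \<open>The exponent - l t + m l^2 is minimal at l = t / (2 m), and t \<le> 2 m keeps l within
  the range of the quadratic bound for exp. Adding the exponentials for l and - l handles both
  signs.\<close>

lemma chernoff_count:
  assumes fin: "finite (set_pmf P)"
    and q: "q = measure_pmf.prob P {x. \<beta> x}" and m: "q \<le> m" "m > 0" and t: "0 < t" "t \<le> 2 * m"
  shows "measure_pmf.prob (replicate_pmf n P)
      {xs. \<bar>(\<Sum>x\<leftarrow>xs. of_bool (\<beta> x) - q)\<bar> > real n * t}
    \<le> 2 * exp (- (real n * t\<^sup>2 / (4 * m)))"
proof -
  define l where "l = t / (2 * m)"
  have l: "0 < l" "l \<le> 1" using m t by (auto simp: l_def)
  define Z where "Z xs = (\<Sum>x\<leftarrow>xs. of_bool (\<beta> x) - q)" for xs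
  have fin': "finite (set_pmf (replicate_pmf n P))" by (rule finite_set_replicate_pmf[OF fin])
  have E: "measure_pmf.expectation (replicate_pmf n P) (\<lambda>xs. exp (c * Z xs)) \<le> exp (real n * m * l\<^sup>2)"
    if c: "\<bar>c\<bar> = l" for c
  proof -
    have "measure_pmf.expectation (replicate_pmf n P) (\<lambda>xs. exp (c * Z xs))
        = measure_pmf.expectation P (\<lambda>x. exp (c * (of_bool (\<beta> x) - q))) ^ n"
      unfolding Z_def sum_list_const_mult[symmetric] by (rule expectation_replicate_pmf_exp_sum_list[OF fin])
    also have "\<dots> \<le> exp (m * c\<^sup>2) ^ n"
      using c l by (intro power_mono exp_moment_bernoulli_le[OF fin _ q m(1)] Bochner_Integration.integral_nonneg) auto
    also have "c\<^sup>2 = l\<^sup>2" using c power2_abs[of c] by simp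
    finally show ?thesis by (simp add: exp_of_nat_mult[symmetric] mult.assoc)
  qed
  define u where "u = l * (real n * t)"
  have "measure_pmf.prob (replicate_pmf n P) {xs. \<bar>Z xs\<bar> > real n * t}
      \<le> measure_pmf.expectation (replicate_pmf n P) (\<lambda>xs. exp (- u) * exp (l * Z xs) + exp (- u) * exp ((- l) * Z xs))"
  proof (rule prob_le_expectation_pmf[OF fin'])
    fix xs assume "xs \<in> {xs. \<bar>Z xs\<bar> > real n * t}"
    then have "\<bar>Z xs\<bar> > real n * t" by simp
    then have "l * \<bar>Z xs\<bar> \<ge> u" unfolding u_def using l by (intro mult_left_mono) auto
    moreover have "l * \<bar>Z xs\<bar> = l * Z xs \<or> l * \<bar>Z xs\<bar> = - (l * Z xs)" by (simp add: abs_if)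
    ultimately have "u \<le> l * Z xs \<or> u \<le> - (l * Z xs)" by linarith
    then have "u \<le> l * Z xs \<or> u \<le> (- l) * Z xs" unfolding mult_minus_left .
    then have "1 \<le> exp (- u) * exp (l * Z xs) \<or> 1 \<le> exp (- u) * exp ((- l) * Z xs)"
      unfolding exp_add[symmetric] one_le_exp_iff by linarith
    then show "1 \<le> exp (- u) * exp (l * Z xs) + exp (- u) * exp ((- l) * Z xs)"
      by (smt (verit) exp_gt_zero mult_pos_pos)
  qed (auto intro: add_nonneg_nonneg)
  also have "\<dots> = exp (- u) * measure_pmf.expectation (replicate_pmf n P) (\<lambda>xs. exp (l * Z xs))
      + exp (- u) * measure_pmf.expectation (replicate_pmf n P) (\<lambda>xs. exp ((- l) * Z xs))"
    by (subst Bochner_Integration.integral_add) (auto intro!: integrable_measure_pmf_finite fin')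
  also have "\<dots> \<le> exp (- u) * exp (real n * m * l\<^sup>2) + exp (- u) * exp (real n * m * l\<^sup>2)"
    using l by (intro add_mono mult_left_mono E) auto
  also have "\<dots> = 2 * exp (- u + real n * m * l\<^sup>2)" unfolding exp_add by simp
  also have "- u + real n * m * l\<^sup>2 = - (real n * t\<^sup>2 / (4 * m))"
    using m by (simp add: u_def l_def power2_eq_square field_simps)
  finally show ?thesis by (simp add: Z_def)
qed

lemma sum_list_of_bool_diff:
  "(\<Sum>x\<leftarrow>xs. of_bool (\<beta> x) - q) = real (card {i. i < length xs \<and> \<beta> (xs ! i)}) - real (length xs) * q"
proof -
  have "(\<Sum>x\<leftarrow>xs. of_bool (\<beta> x) - q) = real (length (filter \<beta> xs)) - real (length xs) * q"
    by (induction xs) (auto simp: algebra_simps)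
  then show ?thesis by (simp add: length_filter_conv_card)
qed

lemma prob_product_dist_coordinate:
  assumes "p \<in> {..<d} \<rightarrow> {0..1}" "j < d"
  shows "measure_pmf.prob (product_dist d p) {x. x j} = p j"
    and "measure_pmf.prob (product_dist d p) {x. \<not> x j} = 1 - p j"
proof -
  have pj: "0 \<le> p j" "p j \<le> 1" using Pi_mem[OF assms(1), of j] assms(2) by auto
  have "map_pmf (\<lambda>x. x j) (product_dist d p) = bernoulli_pmf (p j)"
    using assms(2) unfolding product_dist_def by (subst Pi_pmf_component) auto
  then have *: "measure_pmf.prob (product_dist d p) ((\<lambda>x. x j) -` {b}) = pmf (bernoulli_pmf (p j)) b" for b
    by (metis measure_map_pmf measure_pmf_single)
  show "measure_pmf.prob (product_dist d p) {x. x j} = p j" using *[of True] pj by (simp add: vimage_def)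
  show "measure_pmf.prob (product_dist d p) {x. \<not> x j} = 1 - p j" using *[of False] pj by (simp add: vimage_def)
qed

text \<open>Up to the factor 16 d / 3, this bounds the total payment of a row over all 2 d columns.
  The normalisation makes each term at most 1 and the expectation over a random row at most
  2.\<close>

definition row_weight :: "nat \<Rightarrow> (nat \<Rightarrow> real) \<Rightarrow> (nat \<Rightarrow> bool) \<Rightarrow> real" where
  "row_weight d p x = (\<Sum>j<d. if x j then 1 / (real d * max (p j) (1 / real d))
                                 else 1 / (real d * max (1 - p j) (1 / real d)))"

text \<open>Exponential Markov inequality. By independence the moment factorises, and since each
  term is at most 1, every coordinate contributes a factor of at most 1 + 4 / d, in total at most
  exp 4.\<close>

lemma prob_row_weight:
  assumes p: "p \<in> {..<d} \<rightarrow> {0..1}" and d: "d \<ge> 1"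
  shows "measure_pmf.prob (product_dist d p) {x. row_weight d p x > z} \<le> exp (4 - z)"
proof -
  define v where "v j b = (if b then 1 / (real d * max (p j) (1 / real d))
                                 else 1 / (real d * max (1 - p j) (1 / real d)))" for j and b :: bool
  have V: "row_weight d p x = (\<Sum>j<d. v j (x j))" for x by (simp add: row_weight_def v_def)
  have fin: "finite (set_pmf (product_dist d p))" unfolding product_dist_def by simp
  have w: "exp (1 / (real d * max q (1 / real d))) * q \<le> q + 2 / real d" if q: "0 \<le> q" for q
  proof -
    define x where "x = 1 / (real d * max q (1 / real d))"
    have "real d * max q (1 / real d) \<ge> real d * (1 / real d)" by (intro mult_left_mono) auto
    then have x: "0 < x" "x \<le> 1" using d by (auto simp: x_def max_def intro: order_less_le_trans)
    have "exp x \<le> 1 + x + x\<^sup>2" using x by (intro exp_le_quadratic) auto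
    also have "\<dots> \<le> 1 + 2 * x" using x by (simp add: power2_eq_square mult_left_le)
    finally have "exp x * q \<le> (1 + 2 * x) * q" using q by (intro mult_right_mono) auto
    also have "\<dots> = q + 2 * (q * x)" by (simp add: algebra_simps)
    also have "q * x \<le> 1 / real d"
    proof -
      have "q * x \<le> max q (1 / real d) * x" using x by (intro mult_right_mono) auto
      also have "\<dots> = 1 / real d" using d \<open>0 < x\<close> by (auto simp: x_def zero_less_mult_iff)
      finally show ?thesis .
    qed
    finally show ?thesis by (simp add: x_def)
  qed
  have "measure_pmf.prob (product_dist d p) {x. row_weight d p x > z}
      \<le> measure_pmf.expectation (product_dist d p) (\<lambda>x. exp (- z) * exp (row_weight d p x))"
    by (rule prob_le_expectation_pmf[OF fin]) (auto simp flip: exp_add)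
  also have "\<dots> = exp (- z) * measure_pmf.expectation (product_dist d p) (\<lambda>x. \<Prod>j<d. exp (v j (x j)))"
    by (simp add: V exp_sum)
  also have "measure_pmf.expectation (product_dist d p) (\<lambda>x. \<Prod>j<d. exp (v j (x j)))
      = (\<Prod>j<d. measure_pmf.expectation (bernoulli_pmf (p j)) (\<lambda>b. exp (v j b)))"
    unfolding product_dist_def
    by (rule expectation_prod_Pi_pmf) (auto intro!: integrable_measure_pmf_finite)
  also have "\<dots> \<le> (\<Prod>j<d. exp (4 / real d))"
  proof (intro prod_mono conjI)
    fix j assume "j \<in> {..<d}"
    then have pj: "0 \<le> p j" "p j \<le> 1" using Pi_mem[OF p] by auto
    have "measure_pmf.expectation (bernoulli_pmf (p j)) (\<lambda>b. exp (v j b))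
        = p j * exp (v j True) + (1 - p j) * exp (v j False)"
      using pj by (simp add: integral_bernoulli_pmf)
    also have "\<dots> \<le> (p j + 2 / real d) + ((1 - p j) + 2 / real d)"
      using w[of "p j"] w[of "1 - p j"] pj by (intro add_mono) (auto simp: v_def mult.commute)
    also have "\<dots> = 1 + 4 / real d" by simp
    also have "\<dots> \<le> exp (4 / real d)" by simp
    finally show "measure_pmf.expectation (bernoulli_pmf (p j)) (\<lambda>b. exp (v j b)) \<le> exp (4 / real d)" .
  qed (auto intro!: Bochner_Integration.integral_nonneg)
  also have "(\<Prod>j<d. exp (4 / real d)) = exp 4" using d by (simp flip: exp_of_nat_mult)
  finally show ?thesis by (simp add: exp_diff exp_minus field_simps)
qed

section \<open>Simultaneous tail bound for the Gaussian draws\<close>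

lemma emeasure_noise_coordinate:
  assumes A: "A \<in> sets borel"
  shows "emeasure noise_space {\<omega> \<in> space noise_space. \<omega> !! t \<in> A} = emeasure std_gauss A"
proof (induction t)
  interpret G: prob_space std_gauss by (rule prob_space_std_gauss)
  interpret S: prob_space noise_space by (rule prob_space_noise)
  have sets: "{\<omega> \<in> space noise_space. \<omega> !! t \<in> A} \<in> sets noise_space" for t
    using A by measurable
  {
    case 0
    have "emeasure noise_space {\<omega> \<in> space noise_space. \<omega> !! 0 \<in> A} = (\<integral>\<^sup>+g. indicator A g \<partial>std_gauss)"
      unfolding G.emeasure_stream_space[OF sets[of 0]] using S.emeasure_space_1
      by (auto simp: space_stream_space indicator_def intro!: nn_integral_cong)
    then show ?case using A by simp
  next
    case (Suc t)
    have "emeasure noise_space {\<omega> \<in> space noise_space. \<omega> !! Suc t \<in> A}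
        = (\<integral>\<^sup>+g. emeasure noise_space {\<omega> \<in> space noise_space. \<omega> !! t \<in> A} \<partial>std_gauss)"
      unfolding G.emeasure_stream_space[OF sets[of "Suc t"]]
      by (auto simp: space_stream_space intro!: nn_integral_cong)
    then show ?case by (simp add: Suc G.emeasure_space_1[unfolded space_std_gauss])
  }
qed

lemma std_gauss_tail:
  assumes "\<tau> \<ge> 0"
  shows "measure std_gauss {x. \<bar>x\<bar> > \<tau>} \<le> 2 * exp (- \<tau>\<^sup>2 / 2)"
proof -
  interpret G: prob_space std_gauss by (rule prob_space_std_gauss)
  have "measure std_gauss {x. \<bar>x\<bar> > \<tau>} = (\<integral>x. indicator {x. \<bar>x\<bar> > \<tau>} x \<partial>std_gauss)" by simp
  also have "\<dots> \<le> (\<integral>x. exp (- \<tau>\<^sup>2) * (exp (\<tau> * x) + exp ((- \<tau>) * x)) \<partial>std_gauss)"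
  proof (rule integral_mono)
    show "integrable std_gauss (indicator {x. \<bar>x\<bar> > \<tau>} :: real \<Rightarrow> real)"
      by (rule integrable_real_indicator) (auto simp: less_top[symmetric])
    show "integrable std_gauss (\<lambda>x. exp (- \<tau>\<^sup>2) * (exp (\<tau> * x) + exp ((- \<tau>) * x)))"
      by (intro integrable_mult_right Bochner_Integration.integrable_add integrable_exp_std_gauss)
    fix x :: real
    show "indicator {x. \<bar>x\<bar> > \<tau>} x \<le> exp (- \<tau>\<^sup>2) * (exp (\<tau> * x) + exp ((- \<tau>) * x))"
    proof (cases "\<bar>x\<bar> > \<tau>")
      case True
      then have "\<tau> * \<bar>x\<bar> \<ge> \<tau>\<^sup>2" using assms by (auto simp: power2_eq_square intro!: mult_left_mono)
      then have "\<tau>\<^sup>2 \<le> \<tau> * x \<or> \<tau>\<^sup>2 \<le> (- \<tau>) * x" by (auto simp: abs_if split: if_splits)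
      then have "exp (\<tau>\<^sup>2) \<le> exp (\<tau> * x) \<or> exp (\<tau>\<^sup>2) \<le> exp ((- \<tau>) * x)" by simp
      then have "exp (\<tau>\<^sup>2) \<le> exp (\<tau> * x) + exp ((- \<tau>) * x)"
        using exp_gt_zero[of "\<tau> * x"] exp_gt_zero[of "(- \<tau>) * x"] by linarith
      then have "exp (- \<tau>\<^sup>2) * exp (\<tau>\<^sup>2) \<le> exp (- \<tau>\<^sup>2) * (exp (\<tau> * x) + exp ((- \<tau>) * x))"
        by (intro mult_left_mono) auto
      then show ?thesis using True by (simp flip: exp_add)
    qed (auto intro!: mult_nonneg_nonneg add_nonneg_nonneg)
  qed
  also have "\<dots> = exp (- \<tau>\<^sup>2) * (exp (\<tau>\<^sup>2 / 2) + exp ((- \<tau>)\<^sup>2 / 2))"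
    by (subst integral_mult_right_zero, subst Bochner_Integration.integral_add)
      (simp_all only: integrable_exp_std_gauss integral_exp_std_gauss)
  also have "\<dots> = 2 * exp (- \<tau>\<^sup>2 / 2)"
    by (simp add: distrib_left flip: exp_add)
  finally show ?thesis .
qed

lemma noise_bounded_prob:
  assumes "\<tau> \<ge> 0"
  shows "measure noise_space {\<omega> \<in> space noise_space. \<forall>t<T. \<bar>\<omega> !! t\<bar> \<le> \<tau>} \<ge> 1 - real T * (2 * exp (- \<tau>\<^sup>2 / 2))"
proof -
  interpret S: prob_space noise_space by (rule prob_space_noise)
  let ?B = "\<lambda>t. {\<omega> \<in> space noise_space. \<omega> !! t \<in> {x. \<bar>x\<bar> > \<tau>}}"
  have sets: "?B t \<in> sets noise_space" for t by measurable
  have eq: "{\<omega> \<in> space noise_space. \<forall>t<T. \<bar>\<omega> !! t\<bar> \<le> \<tau>} = space noise_space - (\<Union>t<T. ?B t)"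
    by (auto simp: not_less)
  have "measure noise_space (\<Union>t<T. ?B t) \<le> (\<Sum>t<T. measure noise_space (?B t))"
    using sets by (intro S.finite_measure_subadditive_finite) auto
  also have "\<dots> \<le> (\<Sum>t<T. 2 * exp (- \<tau>\<^sup>2 / 2))"
  proof (rule sum_mono)
    fix t
    have "measure noise_space (?B t) = measure std_gauss {x. \<bar>x\<bar> > \<tau>}"
      unfolding measure_def by (subst emeasure_noise_coordinate) auto
    then show "measure noise_space (?B t) \<le> 2 * exp (- \<tau>\<^sup>2 / 2)" using std_gauss_tail[OF assms] by simp
  qed
  finally have "measure noise_space (\<Union>t<T. ?B t) \<le> real T * (2 * exp (- \<tau>\<^sup>2 / 2))" by simp
  moreover have "measure noise_space (space noise_space - (\<Union>t<T. ?B t)) = 1 - measure noise_space (\<Union>t<T. ?B t)"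
    using sets by (intro S.prob_compl) auto
  ultimately show "measure noise_space {\<omega> \<in> space noise_space. \<forall>t<T. \<bar>\<omega> !! t\<bar> \<le> \<tau>} \<ge> 1 - real T * (2 * exp (- \<tau>\<^sup>2 / 2))"
    unfolding eq by simp
qed

section \<open>Accuracy of a good run\<close>

lemma real_four_pow: "(4::real) ^ r = 2 ^ r * 2 ^ r"
  by (simp flip: power_mult_distrib)

text \<open>The assumptions \<open>counts\<close>, \<open>budget\<close> and \<open>noise\<close> are the events of high probability. They
  guarantee that no row ever runs out of budget, that a column active at stage \<open>r\<close> has mean at most
  \<open>4 / 4 ^ r\<close>, and that its estimate is accurate at the scale of its mean when it stops.\<close>

locale good_run =
  fixes d n :: nat and tab :: "nat \<Rightarrow> nat \<Rightarrow> bool" and \<pi> :: "nat \<Rightarrow> real" and B s \<alpha> \<tau> :: real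
    and \<omega> :: "real stream"
  assumes d: "d \<ge> 1" and n: "n \<ge> 1" and s: "s > 0" and \<alpha>: "0 < \<alpha>" "\<alpha> \<le> 1" and \<tau>: "\<tau> \<ge> 0"
    and \<pi>: "\<And>k. 0 \<le> \<pi> k \<and> \<pi> k \<le> 1"
    and counts: "\<And>k. k < 2 * d \<Longrightarrow> \<bar>real (card {i. i < n \<and> tab k i}) / real n - \<pi> k\<bar>
        \<le> \<alpha> / 16 * sqrt (max (\<pi> k) (1 / real d) / real d)"
    and budget: "\<And>i. i < n \<Longrightarrow>
        (\<Sum>k<2 * d. of_bool (tab k i) * (16 / 3 / max (\<pi> k) (1 / real d))) \<le> B"
    and noise: "\<And>t. t < 2 * d * stages d \<Longrightarrow> \<bar>\<omega> !! t\<bar> \<le> \<tau>"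
    and small: "s * \<tau> / real n \<le> \<alpha> / (40 * sqrt (real d))"
begin

definition m :: "nat \<Rightarrow> real" where "m k = max (\<pi> k) (1 / real d)"
text \<open>Bound on what a row pays for one column: the prices up to stage r add up to (4^(r + 1) -
  1) / 3, and an active column has m 4^r \<le> 4.\<close>

definition W :: "nat \<Rightarrow> real" where "W k = 16 / 3 / m k"
text \<open>Twice the tolerance in \<open>counts\<close>: one half for sampling, one for
  noise.\<close>

definition err :: "nat \<Rightarrow> real" where "err k = \<alpha> / 8 * sqrt (m k / real d)"

text \<open>State before stage \<open>r\<close> of column \<open>k\<close>. The quotient (4^r - 1) /
  3 is the geometric sum of the prices paid so far for that column; a stopped column is charged its
  worst case \<open>W\<close> instead.\<close>

definition invariant :: "nat \<Rightarrow> nat \<Rightarrow> bool \<times> (nat \<Rightarrow> real) \<times> (nat \<Rightarrow> real) \<Rightarrow> bool" where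
  "invariant k r = (\<lambda>(active, U, E). let active' = (r = 0 \<or> active) in
     (\<forall>i<n. U i \<le> (\<Sum>k'<k. of_bool (tab k' i) * W k')
                     + of_bool (tab k i) * (if active' then (4 ^ r - 1) / 3 else W k)) \<and>
     (\<forall>k'<k. \<bar>E k' - \<pi> k'\<bar> \<le> err k') \<and>
     (if active' then \<pi> k * 4 ^ r \<le> 4 else \<bar>E k - \<pi> k\<bar> \<le> err k))"

lemma m: "1 / real d \<le> m k" "\<pi> k \<le> m k" "0 < m k"
  using d \<pi>[of k] by (auto simp: m_def less_max_iff_disj)

lemma W_nonneg: "W k \<ge> 0"
  using m(3)[of k] by (simp add: W_def)

lemma sqrt_m_le: "sqrt (m k / real d) \<le> m k"
proof -
  have "m k / real d \<le> m k * m k"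
    using mult_left_mono[OF m(1)[of k], of "m k"] m(3)[of k] by simp
  then have "sqrt (m k / real d) \<le> sqrt (m k * m k)" by (rule real_sqrt_le_mono)
  then show ?thesis using m(3)[of k] by simp
qed

lemma charge_bound:
  assumes k: "k < 2 * d" and i: "i < n"
  shows "(\<Sum>k'<k. of_bool (tab k' i) * W k') + of_bool (tab k i) * W k \<le> B"
proof -
  have "(\<Sum>k'<k. of_bool (tab k' i) * W k') + of_bool (tab k i) * W k = (\<Sum>k'<Suc k. of_bool (tab k' i) * W k')"
    by simp
  also have "\<dots> \<le> (\<Sum>k'<2 * d. of_bool (tab k' i) * W k')"
    using k W_nonneg by (intro sum_mono2) auto
  also have "\<dots> \<le> B" using budget[OF i] by (simp add: W_def m_def)
  finally show ?thesis .
qed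

text \<open>With u = 4^(-r), the sampling error is at most m / 16, the noise at most u / 16, and m
  \<le> \<pi> + 4 u. So a value below u / 2 forces \<pi> \<le> u, and a value above it forces u
  \<le> 6 \<pi>. In the latter case, and at the last stage, the noise is small on the scale of the
  mean.\<close>

lemma release_accuracy:
  fixes k r :: nat
  assumes k: "k < 2 * d" and r: "r < stages d" and g: "\<bar>g\<bar> \<le> \<tau>"
  defines "y \<equiv> (real (card {i. i < n \<and> tab k i}) + s * g / 2 ^ r) / real n"
  shows "y < 1 / (2 * 4 ^ r) \<Longrightarrow> \<pi> k * 4 ^ r \<le> 1"
    and "1 / 4 ^ r \<le> 1 / real d \<or> \<not> y < 1 / (2 * 4 ^ r) \<Longrightarrow> \<bar>y - \<pi> k\<bar> \<le> err k"
proof -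
  define v u where "v = 1 / (2::real) ^ r" and "u = 1 / (4::real) ^ r"
  have vu: "v * v = u" "v > 0" "u > 0" by (auto simp: v_def u_def real_four_pow)
  have sv: "v = sqrt u" using vu real_sqrt_abs2[of v] by simp
  have u4: "1 / (4 * real d) \<le> u"
  proof -
    have "real (4 ^ r) < real (4 * d)" using stages_lower[OF r] by (simp only: of_nat_less_iff)
    then show ?thesis unfolding u_def using d by (intro divide_left_mono) auto
  qed
  define \<eta> where "\<eta> = s * \<tau> / real n"
  have \<eta>0: "\<eta> \<ge> 0" using s \<tau> by (simp add: \<eta>_def)
  define t where "t = \<alpha> / 16 * sqrt (m k / real d)"
  have y: "\<bar>y - \<pi> k\<bar> \<le> t + \<eta> * v"
  proof -
    define z where "z = s * g / real n * v"
    have "y - \<pi> k = (real (card {i. i < n \<and> tab k i}) / real n - \<pi> k) + z"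
      using n by (simp add: y_def v_def z_def field_simps)
    moreover have "\<bar>z\<bar> \<le> \<eta> * v"
      unfolding z_def using g s n vu by (auto simp: abs_mult \<eta>_def intro!: mult_right_mono divide_right_mono mult_left_mono)
    moreover have "\<bar>real (card {i. i < n \<and> tab k i}) / real n - \<pi> k\<bar> \<le> t"
      using counts[OF k] by (simp add: t_def m_def)
    ultimately show ?thesis by linarith
  qed
  have tm: "t \<le> m k / 16"
  proof -
    have "t \<le> 1 / 16 * m k" unfolding t_def using \<alpha> sqrt_m_le[of k] m(3)[of k] by (intro mult_mono) auto
    then show ?thesis by simp
  qed
  have mk: "m k \<le> \<pi> k + 4 * u"
  proof -
    have "1 / real d \<le> 4 * u" using u4 by simp
    then show ?thesis using \<pi>[of k] vu by (auto simp: m_def)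
  qed
  have \<eta>v: "\<eta> * v \<le> u / 16"
  proof -
    have "\<eta> \<le> \<alpha> / (40 * sqrt (real d))" using small by (simp add: \<eta>_def)
    also have "\<dots> \<le> 1 / (40 * sqrt (real d))" using \<alpha> d by (intro divide_right_mono) auto
    also have "\<dots> = sqrt (1 / (4 * real d)) / 20" by (simp add: real_sqrt_divide real_sqrt_mult)
    also have "\<dots> \<le> v / 20" unfolding sv using u4 by (intro divide_right_mono real_sqrt_le_mono) auto
    finally have "\<eta> * v \<le> v / 20 * v" using vu by (intro mult_right_mono) auto
    then show ?thesis using vu by simp
  qed
  show "\<pi> k * 4 ^ r \<le> 1" if "y < 1 / (2 * 4 ^ r)"
  proof -
    have "y < u / 2" using that by (simp add: u_def)
    then have "\<pi> k \<le> u" using y tm mk \<eta>v vu unfolding abs_le_iff by linarith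
    then show ?thesis by (simp add: u_def field_simps)
  qed
  show "\<bar>y - \<pi> k\<bar> \<le> err k" if "1 / 4 ^ r \<le> 1 / real d \<or> \<not> y < 1 / (2 * 4 ^ r)"
  proof -
    have u6: "u \<le> 6 * m k"
      using that
    proof
      assume "1 / 4 ^ r \<le> 1 / real d"
      then have "u \<le> m k" using m(1)[of k] by (simp add: u_def)
      then show ?thesis using m(3)[of k] by linarith
    next
      assume "\<not> y < 1 / (2 * 4 ^ r)"
      then have "u / 2 \<le> y" by (simp add: u_def)
      then have "u \<le> 6 * \<pi> k" using y tm mk \<eta>v vu unfolding abs_le_iff by linarith
      then show ?thesis using m(2)[of k] by linarith
    qed
    have "\<eta> * v \<le> \<alpha> / (40 * sqrt (real d)) * v"
      using small vu by (intro mult_right_mono) (auto simp: \<eta>_def)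
    also have "\<dots> \<le> \<alpha> / (40 * sqrt (real d)) * (5 / 2 * sqrt (m k))"
    proof (rule mult_left_mono)
      \<comment> \<open>The factor 6 is rounded up to a square; 40 = 16 * 5 / 2 then makes the noise
        no larger than the sampling tolerance.\<close>
      have "u \<le> (5 / 2)\<^sup>2 * m k" using u6 m(3)[of k] by (simp add: power2_eq_square)
      then have "sqrt u \<le> sqrt ((5 / 2)\<^sup>2 * m k)" by (rule real_sqrt_le_mono)
      then show "v \<le> 5 / 2 * sqrt (m k)" unfolding sv by (simp only: real_sqrt_mult real_sqrt_abs)
    qed (use \<alpha> in auto)
    also have "\<dots> = \<alpha> / 16 * sqrt (m k / real d)" by (simp add: real_sqrt_divide)
    finally have "\<eta> * v \<le> t" by (simp add: t_def)
    with y have "\<bar>y - \<pi> k\<bar> \<le> 2 * t" by linarith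
    then show ?thesis by (simp add: t_def err_def)
  qed
qed

abbreviation step :: "nat \<Rightarrow> bool \<times> (nat \<Rightarrow> real) \<times> (nat \<Rightarrow> real) \<Rightarrow> real
    \<Rightarrow> bool \<times> (nat \<Rightarrow> real) \<times> (nat \<Rightarrow> real)" where
  "step \<equiv> stage n B s (stages d) tab"

text \<open>While a column is active, the bound on past payments shows that no row is refused. The
  released count is then the true count plus noise, and \<open>release_accuracy\<close> decides
  whether the column stays active or stops with a good estimate.\<close>

lemma invariant_step:
  assumes t: "t < 2 * d * stages d" and k: "k = t div stages d" and r: "r = t mod stages d"
    and inv: "invariant k r st"
  shows "if Suc r < stages d then invariant k (Suc r) (step t st (\<omega> !! t))
    else invariant (Suc k) 0 (step t st (\<omega> !! t))"
proof -
  obtain active U E where st: "st = (active, U, E)" using prod_cases3 by blast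
  define a where "a = (r = 0 \<or> active)"
  have kd: "k < 2 * d" using t by (simp add: k less_mult_imp_div_less)
  have rR: "r < stages d" using stages_pos[OF d] by (simp add: r)
  define H where "H = hits n B (tab k) (4 ^ r) a U"
  define y where "y = (real (card H) + s * (\<omega> !! t) / 2 ^ r) / real n"
  have step: "step t st (\<omega> !! t) = (a \<and> y < 1 / (2 * 4 ^ r), charge H (4 ^ r) U, if a then E(k := y) else E)"
    unfolding st stage_def Let_def prod.case k[symmetric] r[symmetric] a_def[symmetric]
      H_def[symmetric] y_def[symmetric] ..
  have I: "\<And>i. i < n \<Longrightarrow> U i \<le> (\<Sum>k'<k. of_bool (tab k' i) * W k')
        + of_bool (tab k i) * (if a then (4 ^ r - 1) / 3 else W k)"
    "\<And>k'. k' < k \<Longrightarrow> \<bar>E k' - \<pi> k'\<bar> \<le> err k'"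
    "if a then \<pi> k * 4 ^ r \<le> 4 else \<bar>E k - \<pi> k\<bar> \<le> err k"
    using inv unfolding invariant_def st Let_def prod.case a_def[symmetric] by auto
  \<comment> \<open>A column that never crosses its threshold is accurate as well, because the last
    stage has resolution 1 / d.\<close>
  have last: "1 / 4 ^ r \<le> 1 / real d" if "\<not> Suc r < stages d"
  proof -
    have "Suc r = stages d" using that rR by simp
    with stages_upper[of d] have "4 * d \<le> 4 * 4 ^ r" by (metis power_Suc)
    then have "real d \<le> real (4 ^ r)" by (simp only: of_nat_le_iff)
    then show ?thesis using d by (simp add: frac_le)
  qed
  show ?thesis
  proof (cases a)
    case False
    then have r0: "r \<noteq> 0" and act: "\<not> active" by (auto simp: a_def)
    have "H = {}" using False by (auto simp: H_def hits_def)
    then have new: "step t st (\<omega> !! t) = (False, U, E)" unfolding step using False by (simp add: charge_def)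
    show ?thesis
    proof (cases "Suc r < stages d")
      case True
      then show ?thesis using I False unfolding new invariant_def by simp
    next
      case False': False
      have "\<forall>k'<Suc k. \<bar>E k' - \<pi> k'\<bar> \<le> err k'" using I(2,3) False by (auto simp: less_Suc_eq)
      moreover have "\<forall>i<n. U i \<le> (\<Sum>k'<Suc k. of_bool (tab k' i) * W k')" using I(1) False by auto
      moreover have "\<pi> (Suc k) \<le> 4" using \<pi>[of "Suc k"] by simp
      ultimately show ?thesis using False' unfolding new invariant_def by simp
    qed
  next
    case True
    have \<pi>4: "\<pi> k * 4 ^ r \<le> 4" using I(3) True by simp
    \<comment> \<open>The mean is bounded by the invariant, and the floor 1 / d by the number of
      stages.\<close>
    have m4: "m k * 4 ^ r \<le> 4"
    proof -
      have "real (4 ^ r) \<le> real (4 * d)" using stages_lower[OF rR] by (simp only: of_nat_le_iff less_imp_le)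
      then have "1 / real d * 4 ^ r \<le> 4" using d by (simp add: divide_le_eq)
      then show ?thesis using \<pi>4 by (auto simp: m_def max_def)
    qed
    have W4: "(4 ^ Suc r - 1) / 3 \<le> W k"
    proof -
      from m4 have "4 ^ r \<le> 4 / m k" using m(3)[of k] by (simp add: pos_le_divide_eq mult.commute)
      then have "4 ^ Suc r / 3 \<le> 16 / 3 / m k" by simp
      moreover have "(4 ^ Suc r - 1) / 3 \<le> (4 ^ Suc r / 3 :: real)" by simp
      ultimately show ?thesis unfolding W_def by linarith
    qed
    have H: "H = {i. i < n \<and> tab k i}"
    proof -
      have "U i + 4 ^ r \<le> B" if i: "i < n" and tab: "tab k i" for i
      proof -
        have "U i + 4 ^ r \<le> (\<Sum>k'<k. of_bool (tab k' i) * W k') + (4 ^ Suc r - 1) / 3"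
          using I(1)[OF i] True tab by (simp add: field_simps)
        also have "\<dots> \<le> B"
        proof -
          have "of_bool (tab k i) * W k = W k" using tab by simp
          with charge_bound[OF kd i] W4 show ?thesis by linarith
        qed
        finally show ?thesis .
      qed
      then show ?thesis using True by (auto simp: H_def hits_def)
    qed
    have U': "charge H (4 ^ r) U i \<le> (\<Sum>k'<k. of_bool (tab k' i) * W k')
        + of_bool (tab k i) * ((4 ^ Suc r - 1) / 3)" if i: "i < n" for i
      using I(1)[OF i] True i by (cases "tab k i") (auto simp: H charge_def field_simps)
    have U'': "charge H (4 ^ r) U i \<le> (\<Sum>k'<k. of_bool (tab k' i) * W k') + of_bool (tab k i) * W k"
      if i: "i < n" for i
    proof -
      have "of_bool (tab k i) * ((4 ^ Suc r - 1) / 3) \<le> of_bool (tab k i) * W k"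
        using W4 by (intro mult_left_mono) auto
      with U'[OF i] show ?thesis by linarith
    qed
    have E': "\<bar>(E(k := y)) k' - \<pi> k'\<bar> \<le> err k'" if "k' < k" for k' using I(2)[OF that] that by simp
    note acc = release_accuracy[OF kd rR noise[OF t], folded H, folded y_def]
    have new: "step t st (\<omega> !! t) = (y < 1 / (2 * 4 ^ r), charge H (4 ^ r) U, E(k := y))"
      unfolding step using True by simp
    show ?thesis
    proof (cases "Suc r < stages d")
      case Suc: True
      then show ?thesis using U' U'' E' acc unfolding new invariant_def by simp
    next
      case False
      have "\<bar>y - \<pi> k\<bar> \<le> err k" using acc(2) last[OF False] by simp
      then have "\<forall>k'<Suc k. \<bar>(E(k := y)) k' - \<pi> k'\<bar> \<le> err k'" using E' by (auto simp: less_Suc_eq)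
      moreover have "\<forall>i<n. charge H (4 ^ r) U i \<le> (\<Sum>k'<Suc k. of_bool (tab k' i) * W k')" using U'' by auto
      moreover have "\<pi> (Suc k) \<le> 4" using \<pi>[of "Suc k"] by simp
      ultimately show ?thesis using False unfolding new invariant_def by simp
    qed
  qed
qed

lemma invariant_iter:
  "t \<le> 2 * d * stages d \<Longrightarrow>
    invariant (t div stages d) (t mod stages d) (iter step t 0 (True, \<lambda>_. 0, \<lambda>_. 0) \<omega>)"
proof (induction t)
  case 0
  have "\<pi> 0 \<le> 4" using \<pi>[of 0] by simp
  then show ?case by (simp add: invariant_def)
next
  case (Suc t)
  have R: "stages d > 0" using stages_pos[OF d] .
  have "invariant (t div stages d) (t mod stages d) (iter step t 0 (True, \<lambda>_. 0, \<lambda>_. 0) \<omega>)"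
    using Suc by simp
  from invariant_step[OF _ refl refl this] Suc.prems
  have "if Suc (t mod stages d) < stages d
    then invariant (t div stages d) (Suc (t mod stages d)) (iter step (Suc t) 0 (True, \<lambda>_. 0, \<lambda>_. 0) \<omega>)
    else invariant (Suc (t div stages d)) 0 (iter step (Suc t) 0 (True, \<lambda>_. 0, \<lambda>_. 0) \<omega>)"
    unfolding iter_Suc_right by simp
  moreover have "Suc (t mod stages d) \<le> stages d" using R by (simp add: Suc_le_eq)
  ultimately show ?case using R by (auto simp: div_Suc mod_Suc split: if_splits)
qed

lemma estimates_accurate:
  assumes "k < 2 * d"
  shows "\<bar>snd (snd (iter step (2 * d * stages d) 0 (True, \<lambda>_. 0, \<lambda>_. 0) \<omega>)) k - \<pi> k\<bar>
    \<le> \<alpha> / 8 * sqrt (max (\<pi> k) (1 / real d) / real d)"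
  using invariant_iter[of "2 * d * stages d"] stages_pos[OF d] assms
  by (auto simp: invariant_def Let_def err_def m_def split: prod.splits)

end

section \<open>Accuracy on samples\<close>

text \<open>The default 0 past the last column keeps the value in the unit interval, since the
  invariant also speaks of column 2 d once all columns are done.\<close>

definition column_mean :: "nat \<Rightarrow> (nat \<Rightarrow> real) \<Rightarrow> nat \<Rightarrow> real" where
  "column_mean d p k = (if k < d then p k else if k < 2 * d then 1 - p (k - d) else 0)"

lemma sum_lessThan_double:
  fixes f :: "nat \<Rightarrow> real"
  shows "(\<Sum>k<2 * d. f k) = (\<Sum>j<d. f j + f (j + d))"
proof -
  have "(\<Sum>k<2 * d. f k) = (\<Sum>k<d. f k) + (\<Sum>k=d..<d + d. f k)"
    by (simp add: lessThan_atLeast0 sum.atLeastLessThan_concat flip: mult_2)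
  also have "(\<Sum>k=d..<d + d. f k) = (\<Sum>j<d. f (j + d))"
    using sum.shift_bounds_nat_ivl[of f 0 d d] by (simp add: lessThan_atLeast0)
  finally show ?thesis by (simp add: sum.distrib)
qed

lemma row_budget:
  assumes d: "d \<ge> 1" and w: "row_weight d p (X ! i) \<le> 3 * B / (16 * real d)"
  shows "(\<Sum>k<2 * d. of_bool (table d X k i) * (16 / 3 / max (column_mean d p k) (1 / real d))) \<le> B"
proof -
  have "(\<Sum>k<2 * d. of_bool (table d X k i) * (16 / 3 / max (column_mean d p k) (1 / real d)))
      = 16 / 3 * real d * row_weight d p (X ! i)"
    unfolding sum_lessThan_double row_weight_def sum_distrib_left
    using d by (intro sum.cong refl) (simp add: table_def column_mean_def)
  also have "\<dots> \<le> 16 / 3 * real d * (3 * B / (16 * real d))"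
    using w by (intro mult_left_mono) auto
  also have "\<dots> = B" using d by simp
  finally show ?thesis .
qed

lemma abs_clip01_diff_le: "0 \<le> x \<Longrightarrow> x \<le> 1 \<Longrightarrow> \<bar>clip01 e - x\<bar> \<le> \<bar>e - x\<bar>"
  by (auto simp: clip01_def max_def min_def)

text \<open>For x \<le> 1 / d the tolerance is \<alpha> / (8 d). Otherwise its square is \<alpha>^2
  x / (64 d), which is \<alpha>^2 / (24 d) times 3 x / 8, and 1 - x \<ge> 3 / 8.\<close>

lemma light_or_heavy:
  fixes x e \<alpha> d :: real
  assumes d: "d \<ge> 1" and x: "0 \<le> x" "x \<le> 5 / 8" and \<alpha>: "\<alpha> > 0"
    and e: "\<bar>e - x\<bar> \<le> \<alpha> / 8 * sqrt (max x (1 / d) / d)"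
  shows "\<bar>e - x\<bar> \<le> \<alpha> / (8 * d) \<or> (e - x)\<^sup>2 \<le> \<alpha>\<^sup>2 / (24 * d) * (x * (1 - x))"
proof (cases "x \<le> 1 / d")
  case True
  then have "sqrt (max x (1 / d) / d) = sqrt (1 / (d * d))" by (simp add: max_def)
  also have "\<dots> = 1 / d" using d by (simp add: real_sqrt_divide)
  finally show ?thesis using e by simp
next
  case False
  have "(e - x)\<^sup>2 = \<bar>e - x\<bar>\<^sup>2" by simp
  also have "\<dots> \<le> (\<alpha> / 8 * sqrt (max x (1 / d) / d))\<^sup>2" using e by (intro power_mono) auto
  also have "\<dots> = (\<alpha> / 8)\<^sup>2 * (x / d)"
  proof -
    have "max x (1 / d) = x" using False by simp
    then show ?thesis using x d by (simp only: power_mult_distrib) simp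
  qed
  also have "\<dots> = \<alpha>\<^sup>2 / (24 * d) * (x * (3 / 8))" using d by (simp add: power2_eq_square field_simps)
  also have "\<dots> \<le> \<alpha>\<^sup>2 / (24 * d) * (x * (1 - x))"
    using x d by (intro mult_left_mono) auto
  finally show ?thesis by simp
qed

text \<open>Every estimate is off by at most 1 / 8, so the comparison with 1 / 2 selects a column of
  mean at most 5 / 8, as \<open>light_or_heavy\<close> requires. Clipping only reduces the
  error.\<close>

lemma tv_dist_readout:
  assumes d: "d \<ge> 1" and \<alpha>: "0 < \<alpha>" "\<alpha> \<le> 1" and p: "p \<in> {..<d} \<rightarrow> {0..1}"
    and E: "\<And>k. k < 2 * d \<Longrightarrow> \<bar>E k - column_mean d p k\<bar>
      \<le> \<alpha> / 8 * sqrt (max (column_mean d p k) (1 / real d) / real d)"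
  shows "tv_dist (product_dist d p) (product_dist d (readout d E)) \<le> \<alpha>"
proof (rule tv_dist_product_dist_le[OF d \<alpha> p])
  show "readout d E \<in> {..<d} \<rightarrow> {0..1}" by (auto simp: readout_def clip01_def)
  fix j assume j: "j < d"
  have pj: "0 \<le> p j" "p j \<le> 1" using Pi_mem[OF p] j by auto
  have d1: "real d \<ge> 1" using d by simp
  have e0: "\<bar>E j - p j\<bar> \<le> \<alpha> / 8 * sqrt (max (p j) (1 / real d) / real d)"
    using E[of j] j by (simp add: column_mean_def)
  have e1: "\<bar>E (j + d) - (1 - p j)\<bar> \<le> \<alpha> / 8 * sqrt (max (1 - p j) (1 / real d) / real d)"
    using E[of "j + d"] j by (simp add: column_mean_def)
  have "max (p j) (1 / real d) / real d \<le> 1 / 1"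
    using pj d1 by (intro frac_le) auto
  then have "sqrt (max (p j) (1 / real d) / real d) \<le> sqrt 1" by (intro real_sqrt_le_mono) simp
  then have "\<alpha> / 8 * sqrt (max (p j) (1 / real d) / real d) \<le> 1 / 8 * 1"
    using \<alpha> pj by (intro mult_mono) auto
  with e0 have e8: "\<bar>E j - p j\<bar> \<le> 1 / 8" by simp
  show "\<bar>readout d E j - p j\<bar> \<le> \<alpha> / (8 * real d) \<or>
    (readout d E j - p j)\<^sup>2 \<le> \<alpha>\<^sup>2 / (24 * real d) * (p j * (1 - p j))"
  proof (cases "E j < 1 / 2")
    case True
    have "\<bar>E j - p j\<bar> \<le> \<alpha> / (8 * real d) \<or> (E j - p j)\<^sup>2 \<le> \<alpha>\<^sup>2 / (24 * real d) * (p j * (1 - p j))"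
      using True e8 by (intro light_or_heavy d1 pj \<alpha> e0) linarith
    moreover have "\<bar>readout d E j - p j\<bar> \<le> \<bar>E j - p j\<bar>"
      using True j abs_clip01_diff_le[OF pj] by (simp add: readout_def)
    moreover from this have "(readout d E j - p j)\<^sup>2 \<le> (E j - p j)\<^sup>2" by (simp add: abs_le_square_iff)
    ultimately show ?thesis by linarith
  next
    case False
    let ?e = "E (j + d)" and ?x = "1 - p j"
    have "\<bar>?e - ?x\<bar> \<le> \<alpha> / (8 * real d) \<or> (?e - ?x)\<^sup>2 \<le> \<alpha>\<^sup>2 / (24 * real d) * (?x * (1 - ?x))"
      using False e8 pj by (intro light_or_heavy d1 \<alpha> e1) linarith+
    moreover have "\<bar>readout d E j - p j\<bar> \<le> \<bar>?e - ?x\<bar>"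
      using False j abs_clip01_diff_le[OF pj, of "1 - ?e"] by (simp add: readout_def)
    moreover from this have "(readout d E j - p j)\<^sup>2 \<le> (?e - ?x)\<^sup>2" by (simp add: abs_le_square_iff)
    moreover have "?x * (1 - ?x) = p j * (1 - p j)" by simp
    ultimately show ?thesis by (metis order_trans)
  qed
qed

definition good_sample :: "nat \<Rightarrow> (nat \<Rightarrow> real) \<Rightarrow> nat \<Rightarrow> real \<Rightarrow> real \<Rightarrow> (nat \<Rightarrow> bool) list \<Rightarrow> bool" where
  "good_sample d p n \<alpha> B X \<longleftrightarrow> length X = n \<and>
     (\<forall>k<2 * d. \<bar>real (card {i. i < n \<and> table d X k i}) / real n - column_mean d p k\<bar>
        \<le> \<alpha> / 16 * sqrt (max (column_mean d p k) (1 / real d) / real d)) \<and>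
     (\<forall>x\<in>set X. row_weight d p x \<le> 3 * B / (16 * real d))"

text \<open>Union bound over 2 d Chernoff events and the event that some row is too heavy. With the
  tolerance (\<alpha> / 16) sqrt (m / d) the unknown mean cancels from the Chernoff exponent,
  leaving 1024 = 4 * 16^2.\<close>

lemma prob_good_sample:
  assumes d: "d \<ge> 1" and n: "n \<ge> 1" and \<alpha>: "0 < \<alpha>" "\<alpha> \<le> 1" and p: "p \<in> {..<d} \<rightarrow> {0..1}"
  shows "measure_pmf.prob (replicate_pmf n (product_dist d p)) {X. good_sample d p n \<alpha> B X}
    \<ge> 1 - (4 * real d * exp (- (real n * \<alpha>\<^sup>2 / (1024 * real d))) + real n * exp (4 - 3 * B / (16 * real d)))"
proof -
  let ?P = "product_dist d p"
  let ?R = "replicate_pmf n ?P"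
  have fin: "finite (set_pmf ?P)" unfolding product_dist_def by simp
  define \<pi> where "\<pi> = column_mean d p"
  define m where "m k = max (\<pi> k) (1 / real d)" for k
  define t where "t k = \<alpha> / 16 * sqrt (m k / real d)" for k
  define \<beta> where "\<beta> k x = (if k < d then x k else \<not> x (k - d))" for k and x :: "nat \<Rightarrow> bool"
  define A where "A k = {X. \<bar>(\<Sum>x\<leftarrow>X. of_bool (\<beta> k x) - \<pi> k)\<bar> > real n * t k}" for k
  define C where "C = {X. \<exists>x\<in>set X. row_weight d p x > 3 * B / (16 * real d)}"
  have pb: "\<pi> k = measure_pmf.prob ?P {x. \<beta> k x}" if "k < 2 * d" for k
    using that prob_product_dist_coordinate[OF p, of k] prob_product_dist_coordinate[OF p, of "k - d"]
    by (auto simp: \<pi>_def column_mean_def \<beta>_def)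
  have probA: "measure_pmf.prob ?R (A k) \<le> 2 * exp (- (real n * \<alpha>\<^sup>2 / (1024 * real d)))" if k: "k < 2 * d" for k
  proof -
    have m: "\<pi> k \<le> m k" "m k > 0" "1 / real d \<le> m k" using d by (auto simp: m_def less_max_iff_disj)
    have "m k / real d \<le> m k * m k" using mult_left_mono[OF m(3), of "m k"] m by simp
    then have "sqrt (m k / real d) \<le> sqrt (m k * m k)" by (rule real_sqrt_le_mono)
    then have sq: "sqrt (m k / real d) \<le> m k" using m by simp
    have t0: "0 < t k" using \<alpha> m d by (simp add: t_def)
    have "t k \<le> 2 * m k" unfolding t_def using \<alpha> sq m by (intro mult_mono) auto
    from chernoff_count[OF fin pb[OF k] m(1,2) t0 this, of n]
    have "measure_pmf.prob ?R (A k) \<le> 2 * exp (- (real n * (t k)\<^sup>2 / (4 * m k)))" by (simp add: A_def)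
    also have "real n * (t k)\<^sup>2 / (4 * m k) = real n * \<alpha>\<^sup>2 / (1024 * real d)"
      using m d by (simp add: t_def power_mult_distrib power_divide)
    finally show ?thesis .
  qed
  have probC: "measure_pmf.prob ?R C \<le> real n * exp (4 - 3 * B / (16 * real d))"
    unfolding C_def
    by (rule order_trans[OF prob_replicate_pmf_exists[OF fin]]) (intro mult_left_mono prob_row_weight p d, simp)
  have sub: "set_pmf ?R - {X. good_sample d p n \<alpha> B X} \<subseteq> (\<Union>k<2 * d. A k) \<union> C"
  proof
    fix X assume X: "X \<in> set_pmf ?R - {X. good_sample d p n \<alpha> B X}"
    then have len: "length X = n" and ng: "\<not> good_sample d p n \<alpha> B X" by (auto simp: set_replicate_pmf)
    show "X \<in> (\<Union>k<2 * d. A k) \<union> C"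
    proof (rule ccontr)
      assume nX: "X \<notin> (\<Union>k<2 * d. A k) \<union> C"
      have "\<bar>real (card {i. i < n \<and> table d X k i}) / real n - \<pi> k\<bar> \<le> t k" if k: "k < 2 * d" for k
      proof -
        have "\<bar>real (card {i. i < n \<and> table d X k i}) - real n * \<pi> k\<bar> \<le> real n * t k"
          using nX k len unfolding A_def sum_list_of_bool_diff by (auto simp: table_def \<beta>_def not_less)
        then have "\<bar>real n * (real (card {i. i < n \<and> table d X k i}) / real n - \<pi> k)\<bar> \<le> real n * t k"
          using n by (simp add: right_diff_distrib)
        then show ?thesis using n by (simp add: abs_mult)
      qed
      then have "good_sample d p n \<alpha> B X"
        using nX len by (auto simp: good_sample_def \<pi>_def t_def m_def C_def not_less)
      with ng show False by simp
    qed
  qed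
  have "1 - measure_pmf.prob ?R {X. good_sample d p n \<alpha> B X} = measure_pmf.prob ?R (- {X. good_sample d p n \<alpha> B X})"
    by (subst measure_pmf.prob_compl[of "{X. good_sample d p n \<alpha> B X}", simplified Compl_eq_Diff_UNIV[symmetric] space_measure_pmf]) auto
  also have "\<dots> = measure_pmf.prob ?R (- {X. good_sample d p n \<alpha> B X} \<inter> set_pmf ?R)"
    by (simp add: measure_Int_set_pmf)
  also have "\<dots> \<le> measure_pmf.prob ?R ((\<Union>k<2 * d. A k) \<union> C)"
    using sub by (intro measure_pmf.finite_measure_mono) auto
  also have "\<dots> \<le> measure_pmf.prob ?R (\<Union>k<2 * d. A k) + measure_pmf.prob ?R C"
    by (rule measure_Un_le) auto
  also have "\<dots> \<le> (\<Sum>k<2 * d. measure_pmf.prob ?R (A k)) + measure_pmf.prob ?R C"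
    by (intro add_right_mono measure_pmf.finite_measure_subadditive_finite) auto
  also have "\<dots> \<le> (\<Sum>k<2 * d. 2 * exp (- (real n * \<alpha>\<^sup>2 / (1024 * real d)))) + real n * exp (4 - 3 * B / (16 * real d))"
    using probA probC by (intro add_mono sum_mono) auto
  finally show ?thesis by simp
qed

lemma measure_law_on_samples_ge:
  assumes S: "S \<in> sets (\<Pi>\<^sub>M j\<in>{..<d}. borel)" and b: "b \<ge> 0" and fin: "finite (set_pmf P)"
    and good: "\<And>X. X \<in> G \<Longrightarrow> measure (law (estimator c) d \<alpha> \<epsilon> X) S \<ge> 1 - b"
  shows "measure (law_on_samples (estimator c) d \<alpha> \<epsilon> n P) S \<ge> measure_pmf.prob (replicate_pmf n P) G - b"
proof -
  let ?R = "replicate_pmf n P"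
  have "measure_pmf.prob ?R G - b = measure_pmf.expectation ?R (\<lambda>X. indicator G X - b)"
    by (subst Bochner_Integration.integral_diff)
      (auto intro!: integrable_measure_pmf_finite finite_set_replicate_pmf fin)
  also have "\<dots> \<le> measure_pmf.expectation ?R (\<lambda>X. measure (law (estimator c) d \<alpha> \<epsilon> X) S)"
    using good b by (intro integral_mono integrable_measure_pmf_finite finite_set_replicate_pmf fin)
      (auto simp: indicator_def intro: order_trans[of _ 0])
  also have "\<dots> = measure (law_on_samples (estimator c) d \<alpha> \<epsilon> n P) S"
    unfolding law_on_samples_def
    by (rule measure_pmf.measure_bind[symmetric, OF _ S])
      (auto simp: space_subprob_algebra prob_space_imp_subprob_space prob_space_law_estimator)
  finally show ?thesis .
qed

lemma measure_law_estimator_ge: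
  assumes d: "d \<ge> 1" and n: "n \<ge> 1" and \<alpha>: "0 < \<alpha>" "\<alpha> \<le> 1" and \<epsilon>: "\<epsilon> > 0" and \<tau>: "\<tau> \<ge> 0"
    and p: "p \<in> {..<d} \<rightarrow> {0..1}"
    and X: "good_sample d p n \<alpha> ((real (side c d n))\<^sup>2) X"
    and small: "noise_scale c d \<epsilon> n * \<tau> / real n \<le> \<alpha> / (40 * sqrt (real d))"
  shows "measure (law (estimator c) d \<alpha> \<epsilon> X)
      {q \<in> {..<d} \<rightarrow>\<^sub>E {0..1}. tv_dist (product_dist d p) (product_dist d q) \<le> \<alpha>}
    \<ge> 1 - real (2 * d * stages d) * (2 * exp (- \<tau>\<^sup>2 / 2))"
proof -
  interpret S: prob_space noise_space by (rule prob_space_noise)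
  let ?S = "{q \<in> {..<d} \<rightarrow>\<^sub>E {0..1}. tv_dist (product_dist d p) (product_dist d q) \<le> \<alpha>}"
  let ?G = "{\<omega> \<in> space noise_space. \<forall>t<2 * d * stages d. \<bar>\<omega> !! t\<bar> \<le> \<tau>}"
  have S: "?S \<in> sets (\<Pi>\<^sub>M j\<in>{..<d}. borel)" by (rule sets_accurate[OF set_product_dist])
  have len: "length X = n" using X by (simp add: good_sample_def)
  have "?G \<subseteq> result (estimator c) d \<alpha> \<epsilon> X -` ?S \<inter> space noise_space"
  proof
    fix \<omega> assume \<omega>: "\<omega> \<in> ?G"
    let ?s = "noise_scale c d \<epsilon> n" and ?B = "(real (side c d n))\<^sup>2"
    have "good_run d n (table d X) (column_mean d p) ?B ?s \<alpha> \<tau> \<omega>"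
    proof
      show "0 < ?s" using side_pos[OF d, of c n] \<epsilon> by (simp add: noise_scale_def)
      show "0 \<le> column_mean d p k \<and> column_mean d p k \<le> 1" for k
        using Pi_mem[OF p, of k] Pi_mem[OF p, of "k - d"] by (auto simp: column_mean_def)
      show "(\<Sum>k<2 * d. of_bool (table d X k i) * (16 / 3 / max (column_mean d p k) (1 / real d))) \<le> ?B"
        if "i < n" for i
        using X that len by (intro row_budget[OF d]) (auto simp: good_sample_def)
    qed (use d n \<alpha> \<tau> \<omega> X small in \<open>auto simp: good_sample_def\<close>)
    then interpret good_run d n "table d X" "column_mean d p" ?B ?s \<alpha> \<tau> \<omega> .
    have "tv_dist (product_dist d p) (product_dist d (result (estimator c) d \<alpha> \<epsilon> X \<omega>)) \<le> \<alpha>"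
      unfolding result_estimator mechanism_def len
      by (rule tv_dist_readout[OF d \<alpha> p]) (rule estimates_accurate)
    then show "\<omega> \<in> result (estimator c) d \<alpha> \<epsilon> X -` ?S \<inter> space noise_space"
      using \<omega> by (auto simp: result_estimator readout_def clip01_def)
  qed
  then have "measure noise_space ?G \<le> measure noise_space (result (estimator c) d \<alpha> \<epsilon> X -` ?S \<inter> space noise_space)"
    by (intro S.finite_measure_mono measurable_sets[OF measurable_result S])
  also have "\<dots> = measure (law (estimator c) d \<alpha> \<epsilon> X) ?S"
    unfolding law_estimator by (rule measure_distr[symmetric, OF measurable_result S])
  finally show ?thesis using noise_bounded_prob[OF \<tau>, of "2 * d * stages d"] by linarith
qed

section \<open>Sample complexity\<close>

lemma lg_le_ln:
  assumes "m \<ge> 1"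
  shows "real (lg m) \<le> 1 + 2 * ln (real m)"
proof (cases "lg m")
  case 0
  then show ?thesis using assms by simp
next
  case (Suc k)
  then have "2 ^ k < m" by (intro lg_lower) simp
  then have "real (2 ^ k) < real m" by (simp only: of_nat_less_iff)
  then have "ln (2 ^ k) < ln (real m)" by (subst ln_less_cancel_iff) auto
  then have "real k * ln 2 < ln (real m)" by (simp add: ln_realpow)
  moreover have "real k * (1 / 2) \<le> real k * ln 2"
    using ln2_ge_two_thirds by (intro mult_left_mono) auto
  ultimately show ?thesis using Suc by simp
qed

lemma le_exp_lg: "real m \<le> exp (real (lg m))"
proof -
  have "real m \<le> real (2 ^ lg m)" using lg_upper by (simp only: of_nat_le_iff)
  also have "\<dots> = 2 ^ lg m" by simp
  also have "\<dots> \<le> exp 1 ^ lg m" using exp_ge_add_one_self[of 1] by (intro power_mono) auto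
  also have "\<dots> = exp (real (lg m))" by (simp flip: exp_of_nat_mult)
  finally show ?thesis .
qed

lemma side_bounds:
  fixes c d n :: nat
  defines "L \<equiv> 36 + 6 * real (c + 1) * real (lg (n + d + 1))"
  assumes d: "d \<ge> 1"
  shows "real d * L \<le> (real (side c d n))\<^sup>2" "real (side c d n) \<le> 2 * sqrt (real d * L)"
proof -
  have eq: "real (d * (36 + 6 * (c + 1) * lg (n + d + 1))) = real d * L" by (simp add: L_def)
  have "real (d * (36 + 6 * (c + 1) * lg (n + d + 1))) \<le> real (side c d n * side c d n)"
    using side_upper by (simp only: of_nat_le_iff)
  then show "real d * L \<le> (real (side c d n))\<^sup>2" unfolding eq by (simp add: power2_eq_square)
  have "side c d n - 1 < side c d n" using side_pos[OF d] by simp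
  from side_lower[OF this]
  have "real ((side c d n - 1) * (side c d n - 1)) \<le> real (d * (36 + 6 * (c + 1) * lg (n + d + 1)))"
    by (simp only: of_nat_le_iff less_imp_le)
  then have "(real (side c d n) - 1)\<^sup>2 \<le> real d * L"
    unfolding eq using side_pos[OF d, of c n] by (simp add: power2_eq_square of_nat_diff)
  then have "real (side c d n) - 1 \<le> sqrt (real d * L)" by (rule real_le_rsqrt)
  moreover have "1 \<le> sqrt (real d * L)"
  proof -
    have "1 * 1 \<le> real d * L" using d by (intro mult_mono) (auto simp: L_def)
    then show ?thesis by simp
  qed
  ultimately show "real (side c d n) \<le> 2 * sqrt (real d * L)" by linarith
qed

definition log_term :: "nat \<Rightarrow> real \<Rightarrow> real \<Rightarrow> real" where
  "log_term d \<alpha> \<epsilon> = ln (2 + real d + 1 / \<alpha> + 1 / \<epsilon>)"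

definition rate :: "nat \<Rightarrow> real \<Rightarrow> real \<Rightarrow> real" where
  "rate d \<alpha> \<epsilon> = real d / \<alpha>\<^sup>2 + real d / (\<alpha> * \<epsilon>)"

text \<open>36480000 = 400^2 * 114 * 2: the noise condition requires the factor 400, the logarithm
  in the budget costs 114 (c + 1), and the square of the noise bound 2 (c + 5).\<close>

definition sample_const :: "nat \<Rightarrow> real" where
  "sample_const c = 36480000 * (real c + 1) * (real c + 5)"

text \<open>The threshold at which a union bound over all 2 d \<open>stages d\<close> draws costs at
  most a third of the failure probability.\<close>

definition noise_bound :: "nat \<Rightarrow> nat \<Rightarrow> real" where
  "noise_bound c d = sqrt (2 * (ln 12 + (real c + 2) * ln (real d + 1)))"

lemma ln_12_le_3: "ln (12 :: real) \<le> 3"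
proof -
  have "(12 :: real) \<le> (5 / 2) ^ 3" by (simp add: power3_eq_cube)
  also have "\<dots> \<le> exp 1 ^ 3" using exp_lower_Taylor_quadratic[of 1] by (intro power_mono) auto
  also have "\<dots> = exp 3" by (simp flip: exp_of_nat_mult)
  finally have "ln (12 :: real) \<le> ln (exp 3)" by (subst ln_le_cancel_iff) auto
  then show ?thesis by simp
qed

lemma rate_bounds:
  assumes d: "d \<ge> 1" and \<alpha>: "0 < \<alpha>" "\<alpha> < 1" and \<epsilon>: "\<epsilon> > 0"
  shows "1 \<le> log_term d \<alpha> \<epsilon>" "ln (real d + 1) \<le> log_term d \<alpha> \<epsilon>"
    "real d \<le> rate d \<alpha> \<epsilon>" "real d / \<alpha>\<^sup>2 \<le> rate d \<alpha> \<epsilon>" "real d * (1 + 1 / \<epsilon>) / \<alpha> \<le> rate d \<alpha> \<epsilon>"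
    "ln (rate d \<alpha> \<epsilon>) \<le> 4 * log_term d \<alpha> \<epsilon>"
proof -
  define S where "S = 2 + real d + 1 / \<alpha> + 1 / \<epsilon>"
  have inv: "1 / \<alpha> \<ge> 1" "1 / \<epsilon> > 0" using \<alpha> \<epsilon> by auto
  have "S \<ge> 2 + 1 + 1 + 0" unfolding S_def using inv d by (intro add_mono) auto
  then have S: "S \<ge> 4" "real d + 1 \<le> S" "real d \<le> S" "1 / \<alpha> \<le> S" "1 / \<epsilon> \<le> S"
    using inv of_nat_0_le_iff[of d, where 'a = real] unfolding S_def by - linarith+
  have l: "log_term d \<alpha> \<epsilon> = ln S" by (simp add: log_term_def S_def)
  have "exp 1 \<le> S" using exp_le S by linarith
  then show l1: "1 \<le> log_term d \<alpha> \<epsilon>" unfolding l using S by (subst ln_ge_iff) auto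
  show "ln (real d + 1) \<le> log_term d \<alpha> \<epsilon>" unfolding l using S by (subst ln_le_cancel_iff) auto
  have a2: "real d / \<alpha> \<le> real d / \<alpha>\<^sup>2"
    using \<alpha> by (intro divide_left_mono) (auto simp: power2_eq_square mult_left_le)
  have "real d \<le> real d / \<alpha>" using \<alpha> by (simp add: le_divide_eq mult_left_le)
  moreover have pos: "0 \<le> real d / (\<alpha> * \<epsilon>)" using \<alpha> \<epsilon> by simp
  ultimately show df: "real d \<le> rate d \<alpha> \<epsilon>" using a2 unfolding rate_def by linarith
  show "real d / \<alpha>\<^sup>2 \<le> rate d \<alpha> \<epsilon>" using pos unfolding rate_def by linarith
  have "real d * (1 + 1 / \<epsilon>) / \<alpha> = real d / \<alpha> + real d / (\<alpha> * \<epsilon>)"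
    using \<alpha> \<epsilon> by (simp add: field_simps)
  then show "real d * (1 + 1 / \<epsilon>) / \<alpha> \<le> rate d \<alpha> \<epsilon>" using a2 unfolding rate_def by linarith
  have "rate d \<alpha> \<epsilon> = real d * (1 / \<alpha>) * (1 / \<alpha>) + real d * (1 / \<alpha>) * (1 / \<epsilon>)"
    by (simp add: rate_def power2_eq_square)
  also have "\<dots> \<le> S * S * S + S * S * S"
    using S inv \<alpha> by (intro add_mono mult_mono mult_nonneg_nonneg) auto
  also have "\<dots> \<le> S ^ 4"
  proof -
    have "2 * S ^ 3 \<le> S * S ^ 3" using S by (intro mult_right_mono) auto
    then show ?thesis by (simp add: power3_eq_cube power4_eq_xxxx mult.assoc)
  qed
  finally have "ln (rate d \<alpha> \<epsilon>) \<le> ln (S ^ 4)"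
    using df d S by (subst ln_le_cancel_iff) auto
  then show "ln (rate d \<alpha> \<epsilon>) \<le> 4 * log_term d \<alpha> \<epsilon>" unfolding l using S by (simp add: ln_realpow)
qed

text \<open>Writing \<open>n = x * rate d \<alpha> \<epsilon>\<close>, the logarithm of \<open>n\<close> contributes only \<open>ln x \<le> x - 1\<close> under a square
  root, so a sample size with \<open>x \<ge> K * (log_term d \<alpha> \<epsilon>)\<^sup>2\<close> still dominates it.\<close>

lemma sample_size_sufficient:
  assumes d: "d \<ge> 1" and \<alpha>: "0 < \<alpha>" "\<alpha> < 1" and \<epsilon>: "\<epsilon> > 0"
    and n: "real n \<ge> sample_const c * rate d \<alpha> \<epsilon> * (log_term d \<alpha> \<epsilon>)\<^sup>2"
  shows "n \<ge> 1"
    and "real n * \<alpha>\<^sup>2 / (1024 * real d) \<ge> ln 12 + (real c + 1) * ln (real d + 1)"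
    and "noise_scale c d \<epsilon> n * noise_bound c d / real n \<le> \<alpha> / (40 * sqrt (real d))"
proof -
  define l f K where "l = log_term d \<alpha> \<epsilon>" and "f = rate d \<alpha> \<epsilon>" and "K = sample_const c"
  note rb = rate_bounds[OF d \<alpha> \<epsilon>, folded l_def f_def]
  have n': "real n \<ge> K * f * l\<^sup>2" using n by (simp add: K_def f_def l_def)
  have f1: "f \<ge> 1" using rb(3) d by linarith
  have l2: "1 \<le> l\<^sup>2" "l \<le> l\<^sup>2" using rb(1) by (auto simp: power2_eq_square mult_ge1_I)
  have K: "K \<ge> 1024 * (real c + 4)" "K \<ge> 1"
  proof -
    have "1024 * 1 * (real c + 4) \<le> 36480000 * (real c + 1) * (real c + 5)"
      by (intro mult_mono) auto
    then show "K \<ge> 1024 * (real c + 4)" by (simp add: K_def sample_const_def)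
    then show "K \<ge> 1" by simp
  qed
  have nf: "real n \<ge> f"
  proof -
    have "1 * f * 1 \<le> K * f * l\<^sup>2" using K f1 l2 by (intro mult_mono) auto
    with n' show ?thesis by simp
  qed
  show n1: "n \<ge> 1" using nf f1 by simp
  have nd: "n \<ge> d" using nf rb(3) by simp
  show "real n * \<alpha>\<^sup>2 / (1024 * real d) \<ge> ln 12 + (real c + 1) * ln (real d + 1)"
  proof -
    have "ln 12 + (real c + 1) * ln (real d + 1) \<le> 3 * l + (real c + 1) * l"
      using ln_12_le_3 rb by (intro add_mono mult_left_mono) auto
    also have "\<dots> = (real c + 4) * l" by (simp add: algebra_simps)
    also have "\<dots> \<le> (K / 1024) * l\<^sup>2" using K l2 rb(1) by (intro mult_mono) auto
    also have "\<dots> \<le> real n * \<alpha>\<^sup>2 / (1024 * real d)"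
    proof -
      have "K * (real d / \<alpha>\<^sup>2) * l\<^sup>2 \<le> K * f * l\<^sup>2"
        using K rb(4) by (intro mult_right_mono mult_left_mono) auto
      with n' have "K * (real d / \<alpha>\<^sup>2) * l\<^sup>2 \<le> real n" by linarith
      then have "K * (real d / \<alpha>\<^sup>2) * l\<^sup>2 * (\<alpha>\<^sup>2 / (1024 * real d)) \<le> real n * (\<alpha>\<^sup>2 / (1024 * real d))"
        by (intro mult_right_mono) auto
      then show ?thesis using d \<alpha> by simp
    qed
    finally show ?thesis .
  qed
  define L where "L = 36 + 6 * real (c + 1) * real (lg (n + d + 1))"
  define \<tau> where "\<tau> = noise_bound c d"
  define x where "x = real n / f"
  have x: "x \<ge> K * l\<^sup>2" "real n = f * x" "x \<ge> 1" using n' f1 nf by (auto simp: x_def field_simps)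
  have lnn: "ln (real n) \<le> 4 * l + (x - 1)"
  proof -
    have "ln (real n) = ln f + ln x" unfolding x(2) using f1 x by (intro ln_mult_pos) auto
    then show ?thesis using rb(6) ln_le_minus_one[of x] x by linarith
  qed
  have L: "0 \<le> L" "L \<le> 114 * (real c + 1) * (l * x)"
  proof -
    have "real (n + d + 1) \<le> real n * 3" using n1 nd by simp
    then have "ln (real (n + d + 1)) \<le> ln (real n * 3)" using n1 by (subst ln_le_cancel_iff) auto
    also have "\<dots> = ln (real n) + ln 3" using n1 by (intro ln_mult_pos) auto
    also have "\<dots> \<le> 4 * l + (x - 1) + 2" using lnn ln_le_minus_one[of "3::real"] by simp
    finally have "real (lg (n + d + 1)) \<le> 1 + 2 * (4 * l + (x - 1) + 2)"
      using lg_le_ln[of "n + d + 1"] by simp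
    also have "\<dots> = 3 + 8 * l + 2 * x" by simp
    also have "\<dots> \<le> 3 * (l * x) + 8 * (l * x) + 2 * (l * x)"
    proof -
      have "1 * 1 \<le> l * x" "l * 1 \<le> l * x" "1 * x \<le> l * x" using rb(1) x by (intro mult_mono; simp)+
      then show ?thesis by simp
    qed
    also have "\<dots> = 13 * (l * x)" by simp
    finally have "6 * real (c + 1) * real (lg (n + d + 1)) \<le> 6 * real (c + 1) * (13 * (l * x))"
      by (intro mult_left_mono) auto
    then have "L \<le> 36 + 6 * (real c + 1) * (13 * (l * x))" unfolding L_def by (simp add: add.commute)
    also have "36 \<le> 36 * ((real c + 1) * (l * x))"
    proof -
      have "1 * (1 * 1) \<le> (real c + 1) * (l * x)" using rb(1) x by (intro mult_mono) auto
      then show ?thesis by simp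
    qed
    finally show "L \<le> 114 * (real c + 1) * (l * x)" by (simp add: algebra_simps)
  qed (simp add: L_def)
  have \<tau>2: "0 \<le> \<tau>" "\<tau>\<^sup>2 \<le> 2 * (real c + 5) * l"
  proof -
    have nn: "0 \<le> ln 12 + (real c + 2) * ln (real d + 1)" by (intro add_nonneg_nonneg mult_nonneg_nonneg) auto
    then show "0 \<le> \<tau>" by (simp add: \<tau>_def noise_bound_def)
    have "ln 12 + (real c + 2) * ln (real d + 1) \<le> 3 * l + (real c + 2) * l"
      using ln_12_le_3 rb by (intro add_mono mult_left_mono) auto
    then show "\<tau>\<^sup>2 \<le> 2 * (real c + 5) * l" using nn by (simp add: \<tau>_def noise_bound_def algebra_simps)
  qed
  \<comment> \<open>The noise condition reduces to this inequality. As L is of order l x and the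
    squared noise bound of order l, squaring leaves K l^2 \<le> x, the origin of the squared
    logarithm in the sample size.\<close>
  have key: "400 * (sqrt L * \<tau>) \<le> x"
  proof (rule power2_le_imp_le)
    have "(400 * (sqrt L * \<tau>))\<^sup>2 = 160000 * (L * \<tau>\<^sup>2)" using L by (simp add: power_mult_distrib)
    also have "\<dots> \<le> 160000 * ((114 * (real c + 1) * (l * x)) * (2 * (real c + 5) * l))"
      using L \<tau>2 by (intro mult_left_mono mult_mono) auto
    also have "\<dots> = K * l\<^sup>2 * x" by (simp add: K_def sample_const_def power2_eq_square algebra_simps)
    also have "\<dots> \<le> x * x" using x by (intro mult_right_mono) auto
    finally show "(400 * (sqrt L * \<tau>))\<^sup>2 \<le> x\<^sup>2" by (simp add: power2_eq_square)
  qed (use x in simp)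
  define D where "D = sqrt (real d)"
  have D: "D > 0" "D * D = real d" using d by (auto simp: D_def)
  have "noise_scale c d \<epsilon> n * \<tau> \<le> 5 * (2 * (D * sqrt L)) * (1 + \<epsilon>) / \<epsilon> * \<tau>"
  proof -
    have "real (side c d n) \<le> 2 * (D * sqrt L)"
      using side_bounds(2)[OF d, of c n] unfolding L_def[symmetric] by (simp add: D_def real_sqrt_mult)
    then show ?thesis unfolding noise_scale_def using \<epsilon> \<tau>2
      by (intro mult_right_mono divide_right_mono mult_left_mono) auto
  qed
  also have "\<dots> = \<alpha> / (40 * D) * ((real d * (1 + 1 / \<epsilon>) / \<alpha>) * (400 * (sqrt L * \<tau>)))"
  proof -
    have "5 * (2 * (D * sqrt L)) * (1 + \<epsilon>) / \<epsilon> * \<tau> = 10 * D * (1 + 1 / \<epsilon>) * (sqrt L * \<tau>)"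
      using \<epsilon> by (simp add: field_simps)
    moreover have "\<alpha> / (40 * D) * ((real d * (1 + 1 / \<epsilon>) / \<alpha>) * (400 * (sqrt L * \<tau>)))
        = 10 * D * (1 + 1 / \<epsilon>) * (sqrt L * \<tau>)"
      unfolding D(2)[symmetric] using \<alpha> D(1) by simp
    ultimately show ?thesis by simp
  qed
  also have "\<dots> \<le> \<alpha> / (40 * D) * (f * x)"
    using \<alpha> D(1) rb(5) key f1 L \<tau>2 by (intro mult_left_mono mult_mono) auto
  also have "f * x = real n" using x by simp
  finally show "noise_scale c d \<epsilon> n * noise_bound c d / real n \<le> \<alpha> / (40 * sqrt (real d))"
    using n1 by (simp add: \<tau>_def D_def pos_divide_le_eq)
qed

text \<open>Counts, row budgets and noise each get a third of the failure probability.\<close>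

lemma failure_probability:
  fixes c d n :: nat
  assumes d: "d \<ge> 1" and n: "real n * \<alpha>\<^sup>2 / (1024 * real d) \<ge> ln 12 + (real c + 1) * ln (real d + 1)"
  defines "\<beta> \<equiv> 1 / (real d + 1) ^ c"
  shows "4 * real d * exp (- (real n * \<alpha>\<^sup>2 / (1024 * real d))) \<le> \<beta> / 3"
    and "real n * exp (4 - 3 * (real (side c d n))\<^sup>2 / (16 * real d)) \<le> \<beta> / 3"
    and "real (2 * d * stages d) * (2 * exp (- (noise_bound c d)\<^sup>2 / 2)) \<le> \<beta> / 3"
proof -
  define z where "z = real d + 1"
  have z: "z > 0" "real d \<le> z" "1 \<le> z" by (auto simp: z_def)
  have expln: "exp (- (ln 12 + real k * ln z)) = 1 / (12 * z ^ k)" for k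
  proof -
    have "exp (ln 12 + real k * ln z) = 12 * z ^ k"
      using z by (simp add: exp_add exp_of_nat_mult)
    then show ?thesis by (simp only: exp_minus inverse_eq_divide)
  qed
  have "4 * real d * exp (- (real n * \<alpha>\<^sup>2 / (1024 * real d))) \<le> 4 * z * exp (- (ln 12 + real (c + 1) * ln z))"
    using z n by (intro mult_mono) (auto simp: z_def add.commute)
  also have "\<dots> = \<beta> / 3" unfolding expln using z by (simp add: \<beta>_def z_def[symmetric])
  finally show "4 * real d * exp (- (real n * \<alpha>\<^sup>2 / (1024 * real d))) \<le> \<beta> / 3" .
  have nn: "0 \<le> ln 12 + (real c + 2) * ln (real d + 1)" by (intro add_nonneg_nonneg mult_nonneg_nonneg) auto
  have "- (noise_bound c d)\<^sup>2 / 2 = - (ln 12 + real (c + 2) * ln z)"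
    using nn by (simp add: noise_bound_def z_def add.commute)
  then have "real (2 * d * stages d) * (2 * exp (- (noise_bound c d)\<^sup>2 / 2)) = 4 * (real d * real (stages d)) * (1 / (12 * z ^ (c + 2)))"
    by (simp only: expln) simp
  also have "\<dots> \<le> 4 * (z * z) * (1 / (12 * z ^ (c + 2)))"
    using z stages_le[OF d] by (intro mult_right_mono mult_left_mono mult_mono) auto
  also have "\<dots> = \<beta> / 3" using z by (simp add: \<beta>_def z_def[symmetric])
  finally show "real (2 * d * stages d) * (2 * exp (- (noise_bound c d)\<^sup>2 / 2)) \<le> \<beta> / 3" .
  define h where "h = real (lg (n + d + 1))"
  define y where "y = real (n + d + 1)"
  \<comment> \<open>The tail for one row is at most y^(- c - 1) / 3; one factor y pays for the union
    over the n rows, and the rest is below (d + 1)^(- c) / 3.\<close>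
  have y: "y \<ge> z" "real n \<le> y" "y > 0" by (auto simp: y_def z_def)
  have "real d * (36 + 6 * real (c + 1) * h) \<le> (real (side c d n))\<^sup>2"
    using side_bounds(1)[OF d, of c n] by (simp add: h_def)
  then have "3 * (real d * (36 + 6 * real (c + 1) * h)) / (16 * real d) \<le> 3 * (real (side c d n))\<^sup>2 / (16 * real d)"
    by (intro divide_right_mono) auto
  also have "3 * (real d * (36 + 6 * real (c + 1) * h)) / (16 * real d) = 27 / 4 + 9 / 8 * (real (c + 1) * h)"
    using d by (simp add: field_simps)
  finally have "27 / 4 + 9 / 8 * (real (c + 1) * h) \<le> 3 * (real (side c d n))\<^sup>2 / (16 * real d)" .
  moreover have "0 \<le> real (c + 1) * h" by (simp add: h_def)
  ultimately have "4 - 3 * (real (side c d n))\<^sup>2 / (16 * real d) \<le> - 2 + - (real (c + 1) * h)"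
    by linarith
  then have "exp (4 - 3 * (real (side c d n))\<^sup>2 / (16 * real d)) \<le> exp (- 2) * exp (- (real (c + 1) * h))"
    by (simp flip: exp_add)
  also have "\<dots> \<le> 1 / 3 * (1 / y ^ (c + 1))"
  proof (intro mult_mono)
    have "1 + 2 \<le> exp (2 :: real)" by (rule exp_ge_add_one_self)
    then show "exp (- 2) \<le> (1 / 3 :: real)" by (simp add: exp_minus field_simps)
    have "y ^ (c + 1) \<le> exp h ^ (c + 1)"
      using le_exp_lg[of "n + d + 1"] y by (intro power_mono) (auto simp: y_def h_def)
    also have "\<dots> = exp (real (c + 1) * h)" by (rule exp_of_nat_mult[symmetric])
    finally have "1 / exp (real (c + 1) * h) \<le> 1 / y ^ (c + 1)" using y by (intro divide_left_mono) auto
    then show "exp (- (real (c + 1) * h)) \<le> 1 / y ^ (c + 1)" by (simp add: exp_minus inverse_eq_divide)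
  qed auto
  finally have "real n * exp (4 - 3 * (real (side c d n))\<^sup>2 / (16 * real d)) \<le> y * (1 / 3 * (1 / y ^ (c + 1)))"
    using y by (intro mult_mono) auto
  also have "\<dots> = 1 / y ^ c / 3" using y by simp
  also have "\<dots> \<le> \<beta> / 3" unfolding \<beta>_def z_def[symmetric]
    using y z by (intro divide_right_mono divide_left_mono power_mono) auto
  finally show "real n * exp (4 - 3 * (real (side c d n))\<^sup>2 / (16 * real d)) \<le> \<beta> / 3" .
qed

text \<open>Zero for \<alpha> \<ge> 1, where any output is accurate. The rate tends to 0 as \<alpha>
  grows, so rounding up to a positive number of samples would violate the asymptotic bound
  there.\<close>

definition sample_size :: "nat \<Rightarrow> nat \<Rightarrow> real \<Rightarrow> real \<Rightarrow> nat" where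
  "sample_size c d \<alpha> \<epsilon> = (if \<alpha> < 1 then nat \<lceil>sample_const c * rate d \<alpha> \<epsilon> * (log_term d \<alpha> \<epsilon>)\<^sup>2\<rceil> else 0)"

lemma soft_O_sample_size: "soft_O (sample_size c) (\<lambda>d \<alpha> \<epsilon>. real d / \<alpha>\<^sup>2 + real d / (\<alpha> * \<epsilon>))"
  unfolding soft_O_def
proof (intro exI allI impI)
  fix d :: nat and \<alpha> \<epsilon> :: real
  assume d: "d \<ge> 1" and \<alpha>: "\<alpha> > 0" and \<epsilon>: "\<epsilon> > 0"
  have K: "sample_const c \<ge> 0" by (simp add: sample_const_def)
  have "real (sample_size c d \<alpha> \<epsilon>) \<le> (sample_const c + 1) * rate d \<alpha> \<epsilon> * (log_term d \<alpha> \<epsilon>)\<^sup>2"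
  proof (cases "\<alpha> < 1")
    case True
    note rb = rate_bounds[OF d \<alpha> True \<epsilon>]
    have "1 \<le> rate d \<alpha> \<epsilon>" using rb(3) d by linarith
    then have "1 * 1 \<le> rate d \<alpha> \<epsilon> * (log_term d \<alpha> \<epsilon>)\<^sup>2"
      using rb(1) by (intro mult_mono) auto
    then have r1: "1 \<le> rate d \<alpha> \<epsilon> * (log_term d \<alpha> \<epsilon>)\<^sup>2" by simp
    then have "0 \<le> sample_const c * (rate d \<alpha> \<epsilon> * (log_term d \<alpha> \<epsilon>)\<^sup>2)"
      by (intro mult_nonneg_nonneg[OF K] order_trans[OF zero_le_one])
    then have "real (sample_size c d \<alpha> \<epsilon>) \<le> sample_const c * (rate d \<alpha> \<epsilon> * (log_term d \<alpha> \<epsilon>)\<^sup>2) + 1"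
      using True by (simp add: sample_size_def mult.assoc)
    also have "\<dots> \<le> sample_const c * (rate d \<alpha> \<epsilon> * (log_term d \<alpha> \<epsilon>)\<^sup>2) + rate d \<alpha> \<epsilon> * (log_term d \<alpha> \<epsilon>)\<^sup>2"
      using r1 by simp
    finally show ?thesis by (simp add: algebra_simps)
  next
    case False
    moreover have "0 \<le> rate d \<alpha> \<epsilon>" using \<alpha> \<epsilon> by (simp add: rate_def)
    ultimately show ?thesis using K by (simp add: sample_size_def)
  qed
  then show "real (sample_size c d \<alpha> \<epsilon>) \<le> (sample_const c + 1) * (real d / \<alpha>\<^sup>2 + real d / (\<alpha> * \<epsilon>))
      * ln (2 + real d + 1 / \<alpha> + 1 / \<epsilon>) ^ 2"
    by (simp add: rate_def log_term_def)
qed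

lemma accuracy_estimator:
  assumes d: "d \<ge> 1" and \<alpha>: "\<alpha> > 0" and \<epsilon>: "\<epsilon> > 0" and n: "n \<ge> sample_size c d \<alpha> \<epsilon>"
    and P: "P \<in> product_distributions d"
  shows "measure (law_on_samples (estimator c) d \<alpha> \<epsilon> n P)
      {q \<in> {..<d} \<rightarrow>\<^sub>E {0..1}. tv_dist P (product_dist d q) \<le> \<alpha>}
    \<ge> 1 - 1 / (real d + 1) ^ c"
proof -
  obtain p where p: "p \<in> {..<d} \<rightarrow> {0..1}" and P: "P = product_dist d p"
    using P by (auto simp: product_distributions_def)
  let ?S = "{q \<in> {..<d} \<rightarrow>\<^sub>E {0..1}. tv_dist (product_dist d p) (product_dist d q) \<le> \<alpha>}"
  have S: "?S \<in> sets (\<Pi>\<^sub>M j\<in>{..<d}. borel)" by (rule sets_accurate[OF set_product_dist])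
  have fin: "finite (set_pmf (product_dist d p))" unfolding product_dist_def by simp
  show ?thesis unfolding P
  proof (cases "\<alpha> < 1")
    case False
    have "measure (law (estimator c) d \<alpha> \<epsilon> X) ?S \<ge> 1 - 0" for X
    proof -
      interpret S: prob_space noise_space by (rule prob_space_noise)
      have "tv_dist (product_dist d p) Q \<le> \<alpha>" for Q
        using False tv_dist_le_1[of "product_dist d p" Q] by linarith
      then have "result (estimator c) d \<alpha> \<epsilon> X \<omega> \<in> ?S" for \<omega>
        by (auto simp: result_estimator readout_def clip01_def)
      then have "result (estimator c) d \<alpha> \<epsilon> X -` ?S \<inter> space noise_space = space noise_space" by blast
      then show ?thesis
        unfolding law_estimator by (simp add: measure_distr[OF measurable_result S] S.prob_space)
    qed
    from measure_law_on_samples_ge[where G = UNIV and n = n, OF S _ fin this]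
    have "measure (law_on_samples (estimator c) d \<alpha> \<epsilon> n (product_dist d p)) ?S \<ge> 1" by simp
    moreover have "0 \<le> 1 / (real d + 1) ^ c" by simp
    ultimately show "1 - 1 / (real d + 1) ^ c \<le> measure (law_on_samples (estimator c) d \<alpha> \<epsilon> n (product_dist d p)) ?S"
      by linarith
  next
    case True
    have "real n \<ge> sample_const c * rate d \<alpha> \<epsilon> * (log_term d \<alpha> \<epsilon>)\<^sup>2"
      using n True by (simp add: sample_size_def)
    note ss = sample_size_sufficient[OF d \<alpha> True \<epsilon> this]
    define b where "b = real (2 * d * stages d) * (2 * exp (- (noise_bound c d)\<^sup>2 / 2))"
    have \<tau>: "noise_bound c d \<ge> 0"
      unfolding noise_bound_def by (intro real_sqrt_ge_zero mult_nonneg_nonneg add_nonneg_nonneg) auto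
    have "measure (law (estimator c) d \<alpha> \<epsilon> X) ?S \<ge> 1 - b"
      if "X \<in> {X. good_sample d p n \<alpha> ((real (side c d n))\<^sup>2) X}" for X
      unfolding b_def using that True
      by (intro measure_law_estimator_ge[OF d ss(1) \<alpha> _ \<epsilon> \<tau> p _ ss(3)]) auto
    then have "measure (law_on_samples (estimator c) d \<alpha> \<epsilon> n (product_dist d p)) ?S
      \<ge> measure_pmf.prob (replicate_pmf n (product_dist d p)) {X. good_sample d p n \<alpha> ((real (side c d n))\<^sup>2) X} - b"
      by (intro measure_law_on_samples_ge S fin) (simp_all add: b_def)
    moreover have "1 - \<beta> \<le> M" if "1 - (x + y) \<le> g" "x \<le> \<beta> / 3" "y \<le> \<beta> / 3" "b \<le> \<beta> / 3" "g - b \<le> M"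
      for x y g M \<beta> :: real
      using that by linarith
    ultimately show "1 - 1 / (real d + 1) ^ c \<le> measure (law_on_samples (estimator c) d \<alpha> \<epsilon> n (product_dist d p)) ?S"
      using prob_good_sample[OF d ss(1) \<alpha> less_imp_le[OF True] p] failure_probability[OF d ss(2)]
      unfolding b_def by blast
  qed
qed

text \<open>High probability means failure at most (d + 1)^(- c) for an exponent fixed beforehand;
  it enters the program through the row budget alone. Privacy and running time hold for every
  dataset, and only accuracy refers to the sample size.\<close>

theorem theorem1p3:
  fixes c :: nat
  shows "\<exists>M N. polynomial_time M \<and> outputs_product_distribution M \<and>
    soft_O N (\<lambda>d \<alpha> \<epsilon>. real d / \<alpha>\<^sup>2 + real d / (\<alpha> * \<epsilon>)) \<and>
    (\<forall>d\<ge>1. \<forall>\<alpha>>0. \<forall>\<epsilon>>0.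
      zCDP (cube d) (law M d \<alpha> \<epsilon>) (\<epsilon>\<^sup>2 / 2) \<and>
      (\<forall>\<delta>>0. differentially_private (cube d) (law M d \<alpha> \<epsilon>) (\<epsilon> * sqrt (ln (1 / \<delta>))) \<delta>) \<and>
      (\<forall>n\<ge>N d \<alpha> \<epsilon>. \<forall>P\<in>product_distributions d.
        measure (law_on_samples M d \<alpha> \<epsilon> n P)
          {q \<in> {..<d} \<rightarrow>\<^sub>E {0..1}. tv_dist P (product_dist d q) \<le> \<alpha>}
        \<ge> 1 - 1 / (real d + 1) ^ c))"
  by (intro exI[of _ "estimator c"] exI[of _ "sample_size c"] conjI allI impI ballI
      polynomial_time_estimator outputs_product_distribution_estimator soft_O_sample_size
      zCDP_estimator differentially_private_estimator accuracy_estimator)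

end
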